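(* Fix $\alpha>0$. Let $U_s\in W^{4,\infty}_\alpha(\mathbb R_+)$ and assume $U_s'(a)=0$ and $U_s''(a)\neq0$ for some $a>0$. For $k\in\mathbb N$, let $T_k(t)$, $t\ge0$, denote the solution operator (semigroup) on $W^{0,\infty}_\alpha(\mathbb R_+)$ of the linearised Prandtl system at frequency $k$, \[ \partial_t u_k+ikU_s(y)u_k+v_kU_s'(y)-\partial_y^2u_k=0,\qquad iku_k+\partial_y v_k=0,\qquad (t,y)\in(0,T)\times\mathbb R_+, \] with $u_k|_{y=0}=v_k|_{y=0}=0$, i.e. $T_k(t)u_k(0)=u_k(t)$. Then there exists $\sigma_0>0$ such that for all $\sigma\in[0,\sigma_0)$ and all $k\in\mathbb N$, \[ \sup_{0\le t\le \frac{1}{2(\sigma_0-\sigma)}\frac{\ln(k)}{\sqrt k}} e^{-\sigma t k^{1/2}}\,\big\|T_k(t)\big\|_{\mathcal L(W^{0,\infty}_\alpha)}>\mathcal C_\sigma\,k^{1/2}, \] for a constant $\mathcal C_\sigma>0$ depending only on $\sigma$ and $\sigma_0$.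
   Context: For $s\ge0$ and $\alpha>0$, $W^{s,\infty}_\alpha(\mathbb R_+)$ is the space of $f\in W^{s,\infty}(\mathbb R_+)$ such that $y\mapsto e^{\alpha y}f(y)$ also lies in $W^{s,\infty}(\mathbb R_+)$, normed by $\|f\|_{W^{s,\infty}_\alpha}=\|e^{\alpha\cdot}f\|_{W^{s,\infty}}$; $\mathbb R_+=[0,\infty)$. $\mathcal L(W^{0,\infty}_\alpha)$ denotes the operator norm on bounded linear operators of $W^{0,\infty}_\alpha(\mathbb R_+)$. Functions may be complex-valued. *)

theory Defs
  imports "HOL-Analysis.Analysis" "HOL-Probability.Essential_Supremum"
begin

definition halfline :: "real measure" where
  "halfline = restrict_space lebesgue {0..}"

text \<open>Weighted norm  || e^(alpha y) f ||_{L^infinity(R_+)}  (as an extended real;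
  it is infinite for non-measurable or unbounded f).\<close>
definition wnorm :: "real \<Rightarrow> (real \<Rightarrow> complex) \<Rightarrow> ereal" where
  "wnorm \<alpha> f = esssup halfline (\<lambda>y. ereal (exp (\<alpha> * y) * cmod (f y)))"

definition W0 :: "real \<Rightarrow> (real \<Rightarrow> complex) \<Rightarrow> bool" where
  "W0 \<alpha> f \<longleftrightarrow> f \<in> borel_measurable halfline \<and> wnorm \<alpha> f < \<infinity>"

definition opnorm :: "real \<Rightarrow> ((real \<Rightarrow> complex) \<Rightarrow> (real \<Rightarrow> complex)) \<Rightarrow> ereal" where
  "opnorm \<alpha> A = (SUP f\<in>{f. W0 \<alpha> f \<and> wnorm \<alpha> f \<le> 1}. wnorm \<alpha> (A f))"

text \<open>W^{4,infinity}(R_+) for real functions, via the classical characterisation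
  of W^{4,infinity} in one dimension: f is C^3 on [0,infinity) with bounded
  derivatives f, f', f'', f''' and f''' Lipschitz (i.e. f'''' in L^infinity).\<close>
definition W4inf :: "(real \<Rightarrow> real) \<Rightarrow> bool" where
  "W4inf f \<longleftrightarrow> (\<exists>D :: nat \<Rightarrow> real \<Rightarrow> real.
     (\<forall>y\<ge>0. D 0 y = f y) \<and>
     (\<forall>j<3. \<forall>y\<ge>0. (D j has_real_derivative D (Suc j) y) (at y within {0..})) \<and>
     (\<forall>j\<le>3. bounded (D j ` {0..})) \<and>
     (\<exists>L. lipschitz_on L {0..} (D 3)))"

definition W4alpha :: "real \<Rightarrow> (real \<Rightarrow> real) \<Rightarrow> bool" where
  "W4alpha \<alpha> f \<longleftrightarrow> W4inf f \<and> W4inf (\<lambda>y. exp (\<alpha> * y) * f y)"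

definition prandtl_sol :: "(real \<Rightarrow> real) \<Rightarrow> nat \<Rightarrow> (real \<Rightarrow> real \<Rightarrow> complex) \<Rightarrow> bool" where
  "prandtl_sol Us k u \<longleftrightarrow>
     continuous_on ({0<..} \<times> {0..}) (\<lambda>(t,y). u t y) \<and>
     (\<exists>ut uy uyy v :: real \<Rightarrow> real \<Rightarrow> complex.
        continuous_on ({0<..} \<times> {0<..}) (\<lambda>(t,y). ut t y) \<and>
        continuous_on ({0<..} \<times> {0<..}) (\<lambda>(t,y). uy t y) \<and>
        continuous_on ({0<..} \<times> {0<..}) (\<lambda>(t,y). uyy t y) \<and>
        (\<forall>t>0. \<forall>y>0.
           ((\<lambda>s. u s y) has_vector_derivative ut t y) (at t) \<and>
           ((\<lambda>z. u t z) has_vector_derivative uy t y) (at y) \<and>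
           ((\<lambda>z. uy t z) has_vector_derivative uyy t y) (at y) \<and>
           ut t y + \<i> * of_nat k * of_real (Us y) * u t y
             + v t y * of_real (deriv Us y) - uyy t y = 0) \<and>
        (\<forall>t>0. \<forall>y\<ge>0. ((\<lambda>z. v t z) has_vector_derivative
                          (- (\<i> * of_nat k * u t y))) (at y within {0..})) \<and>
        (\<forall>t>0. u t 0 = 0 \<and> v t 0 = 0))"

definition prandtl_semigroup ::
  "real \<Rightarrow> (real \<Rightarrow> real) \<Rightarrow> (nat \<Rightarrow> real \<Rightarrow> (real \<Rightarrow> complex) \<Rightarrow> (real \<Rightarrow> complex)) \<Rightarrow> bool" where
  "prandtl_semigroup \<alpha> Us T \<longleftrightarrow>
     (\<forall>k f. W0 \<alpha> f \<longrightarrow>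
        T k 0 f = f \<and>
        (\<forall>t\<ge>0. W0 \<alpha> (T k t f)) \<and>
        (\<forall>T0. \<exists>M. \<forall>t\<in>{0..T0}. wnorm \<alpha> (T k t f) \<le> ereal M) \<and>
        prandtl_sol Us k (\<lambda>t y. T k t f y) \<and>
        (AE y in halfline. ((\<lambda>t. T k t f y) \<longlongrightarrow> f y) (at_right 0)))"

end

theory Submission
  imports Defs "HOL-Real_Asymp.Real_Asymp"
begin

text \<open>
  Near the critical point, the shear layer problem of Gerard-Varet and Dormy has an explicit solution built
  from a complex Gaussian. Rescaled to the layer of width \<open>d = k\<close>\<open>^(-1/4)\<close> around \<open>a\<close> and corrected at the wall,
  it yields a growth rate \<open>\<mu>\<close> with real part \<open>\<sigma>0 * sqrt k\<close>, where \<open>\<sigma>0 = sqrt (\<bar>U2 a\<bar> / 4)\<close> and \<open>U2\<close> is the second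
  derivative of the shear flow, and a profile \<open>\<phi>\<close> that the generator maps to \<open>\<mu> \<phi> - r\<close>. Both \<open>\<phi>\<close> and \<open>r\<close> are
  bounded above, and \<open>\<phi>\<close> is bounded below, uniformly in \<open>k\<close>. So Duhamel's formula
  \<open>\<phi> = exp (- \<mu> t) T(t) \<phi> + \<integral> exp (- \<mu> s) T(s) r ds\<close> over \<open>0 < s < t\<close> excludes a bound
  \<open>\<parallel>T(t)\<parallel> \<le> C * sqrt k * exp (\<sigma> * t * sqrt k)\<close> on the given time interval when \<open>C\<close> is small. As \<open>T\<close> is only known to
  produce solutions, Duhamel's formula rests on uniqueness: the time integral of a solution with
  vanishing initial trace is twice differentiable in \<open>y\<close> up to the wall, so an energy estimate applies to it.
\<close>

section \<open>Integrals over half-open intervals and the half-line\<close>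

text \<open>The residual is bounded because of two exact cancellations. The profile is the
  derivative of the stream function \<open>shear d y * Om d y\<close>, so the nonlocal term drops
  out and \<open>\<i> / d^4 * shear^2 * om - \<phi>2\<close> remains. Near \<open>a\<close> its part
  of size \<open>1 / d\<close> is the shear layer operator applied to \<open>w\<close>, which
  vanishes; every Taylor error of the flow gains at least the missing factor \<open>d\<close>. The
  layer itself gives no lower bound, since \<open>shear * om\<close> is only of size
  \<open>d\<close>. What survives is \<open>U1 * Om\<close> at a fixed point beyond
  \<open>a\<close>, where \<open>Om\<close> is close to a multiple of the full complex Gaussian
  mass. That mass must therefore be shown to be nonzero. The root \<open>c\<close> of
  \<open>b c^2 = - \<i>\<close> is the one in the right half-plane: then
  \<open>exp (- z^2 / (2 c))\<close> decays, \<open>z^2 + c\<close> has no real zero, and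
  \<open>b c = - \<i> / c\<close> has negative imaginary part, which means growth. At the last time
  \<open>ln k / (2 (\<sigma>0 - \<sigma>) sqrt k)\<close> the factor
  \<open>exp (- (\<sigma>0 - \<sigma>) t sqrt k)\<close> is exactly \<open>1 / sqrt k\<close>. It
  pays for the \<open>sqrt k\<close> of the assumed bound in the first Duhamel term; in the integral
  term, integration in time yields the same gain.\<close>

lemma integrable_on_half_open:
  fixes g :: "real \<Rightarrow> complex"
  assumes cont: "continuous_on {0<..t} g" and bd: "\<And>s. 0 < s \<Longrightarrow> s \<le> t \<Longrightarrow> cmod (g s) \<le> M"
  shows "g integrable_on {0..t}"
proof -
  have "g integrable_on {0<..t}"
  proof (rule measurable_bounded_by_integrable_imp_integrable)
    show "g \<in> borel_measurable (lebesgue_on {0<..t})"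
      by (rule continuous_imp_measurable_on_sets_lebesgue[OF cont]) auto
    show "(\<lambda>s. M) integrable_on {0<..t}"
      by (rule integrable_spike_set[of _ "{0..t}"]) (auto intro: negligible_subset[of "{0}"])
  qed (use bd in auto)
  then show ?thesis
    by (rule integrable_spike_set) (auto intro: negligible_subset[of "{0}"])
qed

lemma integral_half_open_bound:
  fixes g :: "real \<Rightarrow> complex"
  assumes cont: "continuous_on {0<..t} g" and bd: "\<And>s. 0 < s \<Longrightarrow> s \<le> t \<Longrightarrow> cmod (g s) \<le> M"
    and "0 \<le> t"
  shows "cmod (integral {0..t} g) \<le> t * M"
proof -
  have "(g has_integral integral {0..t} g) {0..t}"
    using integrable_on_half_open[OF cont bd] by blast
  \<comment> \<open>The value \<open>g 0\<close> is not controlled by the hypotheses, so it is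
    replaced by 0 before the bound on the closed interval is applied.\<close>
  then have "((\<lambda>s. if s = 0 then 0 else g s) has_integral integral {0..t} g) {0..t}"
    by (rule has_integral_spike_finite[of "{0}", rotated 2]) auto
  then have "((\<lambda>s. if s = 0 then 0 else g s) has_integral integral {0..t} g) (cbox 0 t)"
    by simp
  then have "cmod (integral {0..t} g) \<le> \<bar>M\<bar> * measure lborel (cbox 0 t)"
    by (rule has_integral_bound[rotated 1])
       (auto intro: order_trans[OF bd] abs_ge_self)
  moreover have "0 \<le> M" if "0 < t" using bd[of t] that norm_ge_zero[of "g t"] by linarith
  ultimately show ?thesis using \<open>0 \<le> t\<close> by (cases "t = 0") (auto simp: mult.commute)
qed

lemma integral_half_open_split:
  fixes g :: "real \<Rightarrow> complex"
  assumes "continuous_on {0<..t} g" "\<And>s. 0 < s \<Longrightarrow> s \<le> t \<Longrightarrow> cmod (g s) \<le> M"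
    and "0 \<le> s" "s \<le> t"
  shows "integral {0..t} g = integral {0..s} g + integral {s..t} g"
  using Henstock_Kurzweil_Integration.integral_combine[OF assms(3,4) integrable_on_half_open[OF assms(1,2)]] by simp

text \<open>Nothing is known about \<open>g\<close> at 0 except boundedness near it. Splitting at
  \<open>t/2\<close> turns the part near 0 into a constant, and the fundamental theorem is applied
  only where \<open>g\<close> is continuous.\<close>

lemma integral_half_open_has_vector_derivative:
  fixes g :: "real \<Rightarrow> complex"
  assumes cont: "continuous_on {0<..} g" and bd: "\<And>s. 0 < s \<Longrightarrow> s \<le> t + 1 \<Longrightarrow> cmod (g s) \<le> M"
    and "0 < t"
  shows "((\<lambda>s. integral {0..s} g) has_vector_derivative g t) (at t)"
proof -
  have *: "integral {0..s} g = integral {0..t/2} g + integral {t/2..s} g" if "s \<in> {t/2<..<t+1}" for s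
    by (rule integral_half_open_split[of _ _ M]) (use that bd \<open>0 < t\<close> in \<open>auto intro: continuous_on_subset[OF cont]\<close>)
  have "((\<lambda>s. integral {t/2..s} g) has_vector_derivative g t) (at t within {t/2..t+1})"
    by (rule integral_has_vector_derivative) (use \<open>0 < t\<close> in \<open>auto intro: continuous_on_subset[OF cont]\<close>)
  then have "((\<lambda>s. integral {t/2..s} g) has_vector_derivative g t) (at t within {t/2<..<t+1})"
    by (rule has_vector_derivative_within_subset) auto
  then have "((\<lambda>s. integral {0..t/2} g + integral {t/2..s} g) has_vector_derivative g t) (at t within {t/2<..<t+1})"
    by (auto intro!: derivative_eq_intros)
  then have "((\<lambda>s. integral {0..s} g) has_vector_derivative g t) (at t within {t/2<..<t+1})"
    by (rule has_vector_derivative_transform[rotated 2]) (use * \<open>0 < t\<close> in auto)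
  then show ?thesis
    by (subst (asm) has_vector_derivative_within_open) (use \<open>0 < t\<close> in auto)
qed

lemma AE_halfline_iff:
  "(AE y in halfline. P y) \<longleftrightarrow> (\<exists>N. negligible N \<and> (\<forall>y\<ge>0. y \<notin> N \<longrightarrow> P y))"
proof -
  have "(AE y in halfline. P y) \<longleftrightarrow> (AE y in lebesgue. 0 \<le> y \<longrightarrow> P y)"
    unfolding halfline_def by (subst AE_restrict_space_iff) auto
  also have "\<dots> \<longleftrightarrow> (\<exists>N\<in>null_sets lebesgue. {y. \<not> (0 \<le> y \<longrightarrow> P y)} \<subseteq> N)"
    by (simp add: eventually_ae_filter)
  also have "\<dots> \<longleftrightarrow> (\<exists>N. negligible N \<and> (\<forall>y\<ge>0. y \<notin> N \<longrightarrow> P y))"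
    by (auto simp: negligible_iff_null_sets)
  finally show ?thesis .
qed

text \<open>By continuity a violation at one point would persist on an interval, which is not
  negligible. The interval extends to the right, so that it stays in the half-line even when
  \<open>y = 0\<close>.\<close>

lemma AE_halfline_continuous_le:
  fixes g :: "real \<Rightarrow> real"
  assumes cont: "continuous_on {0..} g" and ae: "AE y in halfline. g y \<le> M" and "0 \<le> y"
  shows "g y \<le> M"
proof (rule ccontr)
  assume "\<not> g y \<le> M"
  obtain N where N: "negligible N" "\<And>y. 0 \<le> y \<Longrightarrow> y \<notin> N \<Longrightarrow> g y \<le> M"
    using ae unfolding AE_halfline_iff by blast
  obtain d where d: "0 < d" "\<And>x. 0 \<le> x \<Longrightarrow> dist x y < d \<Longrightarrow> dist (g x) (g y) < g y - M"
    using cont[unfolded continuous_on_iff, rule_format, of y "g y - M"] \<open>0 \<le> y\<close> \<open>\<not> g y \<le> M\<close> by auto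
  have "{y..y+d/2} \<subseteq> N"
  proof
    fix x assume "x \<in> {y..y+d/2}"
    then have "dist (g x) (g y) < g y - M" using d \<open>0 \<le> y\<close> by (auto simp: dist_real_def)
    then have "\<not> g x \<le> M" by (auto simp: dist_real_def abs_if split: if_splits)
    then show "x \<in> N" using N(2)[of x] \<open>x \<in> _\<close> \<open>0 \<le> y\<close> by auto
  qed
  then have "negligible (cbox y (y+d/2))" using N(1) negligible_subset by auto
  then show False using d(1) unfolding negligible_interval(1) by simp
qed

lemma at_within_halfline: "0 < y \<Longrightarrow> at y within {0..} = at (y :: real)"
  by (rule at_within_interior) simp

lemma indefinite_integral_has_vector_derivative:
  fixes s :: "real \<Rightarrow> complex"
  assumes "continuous_on {0..} s" "0 \<le> y"
  shows "((\<lambda>y. integral {0..y} s) has_vector_derivative s y) (at y within {0..})"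
proof -
  have "((\<lambda>y. integral {0..y} s) has_vector_derivative s y) (at y within {0..y+1})"
    by (rule integral_has_vector_derivative) (use assms in \<open>auto intro: continuous_on_subset\<close>)
  moreover have "at y within {0..y+1} = at y within {0..}"
    by (rule at_within_nhd[of _ "{..<y+1}"]) (use \<open>0 \<le> y\<close> in auto)
  ultimately show ?thesis by simp
qed

lemma iterated_integral_has_vector_derivative:
  fixes s :: "real \<Rightarrow> complex"
  assumes "continuous_on {0..} s" "0 \<le> y"
  shows "((\<lambda>y. integral {0..y} (\<lambda>x. (y - x) *\<^sub>R s x)) has_vector_derivative integral {0..y} s)
          (at y within {0..})"
proof -
  have *: "integral {0..y} (\<lambda>x. (y - x) *\<^sub>R s x) = y *\<^sub>R integral {0..y} s - integral {0..y} (\<lambda>x. x *\<^sub>R s x)"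
    if "0 \<le> y" for y
  proof -
    have "(\<lambda>x. y *\<^sub>R s x) integrable_on {0..y}" "(\<lambda>x. x *\<^sub>R s x) integrable_on {0..y}"
      by (auto intro!: integrable_continuous_real continuous_intros continuous_on_subset[OF assms(1)])
    then show ?thesis
      by (simp add: scaleR_diff_left integral_diff)
  qed
  have "((\<lambda>y. y *\<^sub>R integral {0..y} s - integral {0..y} (\<lambda>x. x *\<^sub>R s x)) has_vector_derivative integral {0..y} s)
          (at y within {0..})"
    by (auto intro!: derivative_eq_intros indefinite_integral_has_vector_derivative assms continuous_intros)
  then show ?thesis
    by (rule has_vector_derivative_transform[rotated 2]) (use * assms(2) in auto)
qed

text \<open>This is where regularity up to the wall is gained: the derivatives are given only for
  \<open>y > 0\<close>, but the resulting formula makes sense at 0. Of the two constants of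
  integration, continuity of \<open>h\<close> at 0 together with \<open>h 0 = 0\<close> removes
  one.\<close>

lemma second_antiderivative_halfline:
  fixes h s :: "real \<Rightarrow> complex"
  assumes s: "continuous_on {0..} s" and h: "continuous_on {0..} h" "h 0 = 0"
    and h1: "\<And>y. 0 < y \<Longrightarrow> (h has_vector_derivative h1 y) (at y)"
    and h2: "\<And>y. 0 < y \<Longrightarrow> (h1 has_vector_derivative s y) (at y)"
  shows "\<exists>\<beta>. \<forall>y\<ge>0. h y = y *\<^sub>R \<beta> + integral {0..y} (\<lambda>x. (y - x) *\<^sub>R s x)"
proof -
  let ?F = "\<lambda>y. integral {0..y} (\<lambda>x. (y - x) *\<^sub>R s x)" and ?F1 = "\<lambda>y. integral {0..y} s"
  have sub: "at y within {0<..} = at y" if "0 < y" for y :: real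
    by (rule at_within_open) (use that in auto)
  have up: "(f has_vector_derivative d) (at y)"
    if "(f has_vector_derivative d) (at y within {0..})" "0 < y" for f :: "real \<Rightarrow> complex" and d y
  proof -
    have "{0<..} \<subseteq> {0::real..}" by auto
    from has_vector_derivative_within_subset[OF that(1) this] show ?thesis by (simp add: sub that(2))
  qed
  have F1: "(?F1 has_vector_derivative s y) (at y)" and F: "(?F has_vector_derivative ?F1 y) (at y)" if "0 < y" for y
    using that by (auto intro!: up indefinite_integral_has_vector_derivative iterated_integral_has_vector_derivative s)
  obtain \<beta> where \<beta>: "\<And>y. y \<in> {0<..} \<Longrightarrow> h1 y - ?F1 y = \<beta>"
  proof (rule has_vector_derivative_zero_constant[of "{0<..}" "\<lambda>y. h1 y - ?F1 y"])
    show "((\<lambda>y. h1 y - ?F1 y) has_vector_derivative 0) (at y within {0<..})" if "y \<in> {0<..}" for y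
      using that has_vector_derivative_diff[OF h2 F1, of y] by (auto simp: sub)
  qed auto
  obtain \<gamma> where \<gamma>: "\<And>y. y \<in> {0<..} \<Longrightarrow> h y - ?F y - y *\<^sub>R \<beta> = \<gamma>"
  proof (rule has_vector_derivative_zero_constant[of "{0<..}" "\<lambda>y. h y - ?F y - y *\<^sub>R \<beta>"])
    show "((\<lambda>y. h y - ?F y - y *\<^sub>R \<beta>) has_vector_derivative 0) (at y within {0<..})" if "y \<in> {0<..}" for y
      using that h1[of y] F[of y] \<beta>[OF that]
      by (auto simp: sub intro!: derivative_eq_intros)
  qed auto
  let ?G = "\<lambda>y. h y - ?F y - y *\<^sub>R \<beta>"
  have "continuous_on {0..} ?F"
    by (auto simp: continuous_on_eq_continuous_within
        intro: has_vector_derivative_continuous iterated_integral_has_vector_derivative[OF s])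
  then have G: "continuous_on {0..} ?G" by (intro continuous_intros h)
  have "((\<lambda>y. ?G y) \<longlongrightarrow> ?G 0) (at 0 within {0..})"
    using G unfolding continuous_on_def by (rule bspec) simp
  then have "(?G \<longlongrightarrow> ?G 0) (at_right 0)"
    by (rule tendsto_within_subset) auto
  moreover have "(?G \<longlongrightarrow> \<gamma>) (at_right 0)"
    by (rule tendsto_eventually) (auto simp: eventually_at_filter \<gamma> intro!: always_eventually)
  ultimately have "?G 0 = \<gamma>" by (intro tendsto_unique[of "at_right 0"]) auto
  then have "\<gamma> = 0" using h(2) by simp
  then have "h y = y *\<^sub>R \<beta> + ?F y" if "0 \<le> y" for y
    using \<gamma>[of y] that h(2) by (cases "y = 0") (auto simp: algebra_simps)
  then show ?thesis by blast
qed

text \<open>Separate continuity becomes joint continuity because the Lipschitz constant in time is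
  uniform in \<open>y\<close>. Time primitives satisfy this although their integrands are not
  continuous down to time 0.\<close>

lemma continuous_on_Times_Lipschitz:
  fixes F :: "real \<Rightarrow> real \<Rightarrow> complex"
  assumes lip: "\<And>a b. 0 < a \<Longrightarrow> a \<le> b \<Longrightarrow> \<exists>L. \<forall>t\<in>{a..b}. \<forall>t'\<in>{a..b}. \<forall>y\<in>Y. cmod (F t y - F t' y) \<le> L * \<bar>t - t'\<bar>"
    and cont: "\<And>t. 0 < t \<Longrightarrow> continuous_on Y (F t)"
  shows "continuous_on ({0<..} \<times> Y) (\<lambda>(t, y). F t y)"
  unfolding continuous_on_def
proof (clarsimp simp del: at_within_open)
  fix t y :: real assume t: "0 < t" "y \<in> Y"
  obtain L where L: "\<And>u y. u \<in> {t/2..2*t} \<Longrightarrow> y \<in> Y \<Longrightarrow> cmod (F u y - F t y) \<le> L * \<bar>u - t\<bar>"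
  proof -
    obtain L where "\<forall>u\<in>{t/2..2*t}. \<forall>t'\<in>{t/2..2*t}. \<forall>y\<in>Y. cmod (F u y - F t' y) \<le> L * \<bar>u - t'\<bar>"
      using lip[of "t/2" "2*t"] t by auto
    then show ?thesis using t by (intro that[of L]) auto
  qed
  let ?N = "at (t, y) within {0<..} \<times> Y"
  have fst: "((\<lambda>p. fst p) \<longlongrightarrow> t) ?N" and snd: "((\<lambda>p. snd p) \<longlongrightarrow> y) ?N"
    by (auto intro!: tendsto_eq_intros)
  have inN: "\<forall>\<^sub>F p in ?N. p \<in> {0<..} \<times> Y" by (auto simp: eventually_at_filter)
  have "((\<lambda>p. F t (snd p)) \<longlongrightarrow> F t y) ?N"
    by (rule continuous_on_tendsto_compose[OF cont[OF t(1)] snd]) (use t inN in \<open>auto elim: eventually_mono\<close>)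
  moreover have "((\<lambda>p. F (fst p) (snd p) - F t (snd p)) \<longlongrightarrow> 0) ?N"
  proof (rule Lim_null_comparison)
    have "\<forall>\<^sub>F p in ?N. fst p \<in> {t/2<..<2*t}"
      by (rule topological_tendstoD[OF fst]) (use t in auto)
    then show "\<forall>\<^sub>F p in ?N. cmod (F (fst p) (snd p) - F t (snd p)) \<le> L * \<bar>fst p - t\<bar>"
      using inN by eventually_elim (auto intro!: L)
    show "((\<lambda>p. L * \<bar>fst p - t\<bar>) \<longlongrightarrow> 0) ?N"
      by (auto intro!: tendsto_eq_intros)
  qed
  ultimately have "((\<lambda>p. F t (snd p) + (F (fst p) (snd p) - F t (snd p))) \<longlongrightarrow> F t y + 0) ?N"
    by (rule tendsto_add)
  then show "((\<lambda>(t, y). F t y) \<longlongrightarrow> F t y) ?N"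
    by (simp add: case_prod_beta')
qed

section \<open>The linearised equation\<close>

text \<open>The substitution \<open>x = y * \<theta>\<close> moves the variable endpoint into the
  integrand, so that continuity of parameter integrals over the fixed interval \<open>{0..1}\<close>
  applies.\<close>

lemma continuous_on_integral_upper_limit:
  fixes h :: "real \<Rightarrow> real \<Rightarrow> complex"
  assumes h: "continuous_on ({0<..} \<times> {0..}) (\<lambda>(t, y). h t y)"
  shows "continuous_on ({0<..} \<times> {0..}) (\<lambda>(t, y). integral {0..y} (h t))"
proof -
  have "continuous_on (({0<..} \<times> {0..}) \<times> cbox 0 1) (\<lambda>(p, \<theta>). h (fst p) (snd p * \<theta>))"
  proof -
    have "continuous_on (({0<..} \<times> {0..}) \<times> cbox 0 1)
        (\<lambda>q. case (fst (fst q), snd (fst q) * snd q) of (t, y) \<Rightarrow> h t y)"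
      by (rule continuous_on_compose2[OF h]) (auto intro!: continuous_intros)
    then show ?thesis by (simp add: case_prod_beta')
  qed
  then have "continuous_on ({0<..} \<times> {0..}) (\<lambda>p. integral (cbox 0 1) (\<lambda>\<theta>. h (fst p) (snd p * \<theta>)))"
    by (rule integral_continuous_on_param)
  then have "continuous_on ({0<..} \<times> {0..}) (\<lambda>p. snd p *\<^sub>R integral {0..1} (\<lambda>\<theta>. h (fst p) (snd p * \<theta>)))"
    by (auto intro!: continuous_intros)
  moreover have "y *\<^sub>R integral {0..1} (\<lambda>\<theta>. h t (y * \<theta>)) = integral {0..y} (h t)" if "0 < t" "0 \<le> y" for t y
  proof (cases "y = 0")
    case False
    have "(h t has_integral integral {0..y} (h t)) {0..y}"
      using that by (auto intro!: integrable_integral integrable_continuous_real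
          continuous_on_compose2[OF h, of _ "\<lambda>y. (t, y)", simplified] continuous_intros)
    from has_integral_stretch_real[OF this False]
    have "((\<lambda>x. h t (y * x)) has_integral (1 / \<bar>y\<bar>) *\<^sub>R integral {0..y} (h t)) ((\<lambda>x. x / y) ` {0..y})" .
    moreover have "(\<lambda>x. x / y) ` {0..y} = {0..1}"
      using that False by (simp add: image_divide_atLeastAtMost)
    ultimately show ?thesis using that False by (simp add: integral_unique)
  qed auto
  ultimately show ?thesis
    by - (erule continuous_on_eq, auto)
qed

text \<open>Here \<open>\<kappa>\<close> stands for \<open>\<i> * k\<close>. The component
  \<open>v\<close> is eliminated by integrating the divergence condition from the wall, so the flow
  enters only through \<open>U\<close> and its derivative \<open>U1\<close>.\<close>

locale shear_flow =
  fixes \<alpha> :: real and \<kappa> :: complex and U U1 :: "real \<Rightarrow> real" and A :: real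
  assumes \<alpha>_pos: "0 < \<alpha>"
    and U_cont: "continuous_on {0..} U" and U1_cont: "continuous_on {0..} U1"
    and U_bound: "\<And>y. 0 \<le> y \<Longrightarrow> \<bar>U y\<bar> \<le> A"
    and U1_bound: "\<And>y. 0 \<le> y \<Longrightarrow> \<bar>U1 y\<bar> \<le> A * exp (- (\<alpha> * y))"
begin

abbreviation decay :: "real \<Rightarrow> real" where "decay y \<equiv> exp (- (\<alpha> * y))"

text \<open>The class in which uniqueness holds. Continuity at \<open>t = 0\<close> is not part of
  it, as initial data are attained only almost everywhere; its place is taken by a decay bound that
  is uniform down to time 0.\<close>

definition tame :: "(real \<Rightarrow> real \<Rightarrow> complex) \<Rightarrow> bool" where
  "tame w \<longleftrightarrow> continuous_on ({0<..} \<times> {0..}) (\<lambda>(t, y). w t y) \<and> (\<forall>t>0. w t 0 = 0) \<and>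
     (\<forall>T. \<exists>M. \<forall>t y. 0 < t \<longrightarrow> t \<le> T \<longrightarrow> 0 \<le> y \<longrightarrow> cmod (w t y) \<le> M * decay y)"

definition primitive :: "(real \<Rightarrow> real \<Rightarrow> complex) \<Rightarrow> real \<Rightarrow> real \<Rightarrow> complex" where
  "primitive w t y = integral {0..t} (\<lambda>s. w s y)"

section \<open>Tame functions and their time primitives\<close>

lemma A_nonneg: "0 \<le> A"
  using U_bound[of 0] by simp

lemma tame_boundE:
  assumes "tame w"
  obtains M where "0 \<le> M" "\<And>t y. 0 < t \<Longrightarrow> t \<le> T \<Longrightarrow> 0 \<le> y \<Longrightarrow> cmod (w t y) \<le> M * decay y"
proof -
  obtain M where M: "\<And>t y. 0 < t \<Longrightarrow> t \<le> T \<Longrightarrow> 0 \<le> y \<Longrightarrow> cmod (w t y) \<le> M * decay y"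
    using assms unfolding tame_def by metis
  show ?thesis
  proof (rule that[of "max M 0"])
    fix t y :: real assume "0 < t" "t \<le> T" "0 \<le> y"
    from M[OF this] show "cmod (w t y) \<le> max M 0 * decay y"
      by (rule order_trans) (auto intro: mult_right_mono)
  qed auto
qed

lemma exp_decay_le_1: "0 \<le> y \<Longrightarrow> decay y \<le> 1"
  using \<alpha>_pos by simp

lemma tame_cont_time: "tame w \<Longrightarrow> 0 \<le> y \<Longrightarrow> continuous_on {0<..} (\<lambda>t. w t y)"
  unfolding tame_def
  by (auto intro!: continuous_on_compose2[of "{0<..} \<times> {0..}" "\<lambda>(t, y). w t y" _ "\<lambda>t. (t, y)", simplified] continuous_intros)

lemma tame_cont_space: "tame w \<Longrightarrow> 0 < t \<Longrightarrow> continuous_on {0..} (w t)"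
  unfolding tame_def
  by (auto intro!: continuous_on_compose2[of "{0<..} \<times> {0..}" "\<lambda>(t, y). w t y" _ "\<lambda>y. (t, y)", simplified] continuous_intros)

lemma primitive_bound:
  assumes "tame w" "0 \<le> t" "0 \<le> y"
    and M: "\<And>s y. 0 < s \<Longrightarrow> s \<le> t \<Longrightarrow> 0 \<le> y \<Longrightarrow> cmod (w s y) \<le> M * decay y"
  shows "cmod (primitive w t y) \<le> t * M * decay y"
proof -
  have "cmod (integral {0..t} (\<lambda>s. w s y)) \<le> t * (M * decay y)"
    by (rule integral_half_open_bound[OF continuous_on_subset[OF tame_cont_time[OF assms(1)]]])
       (use assms in auto)
  then show ?thesis by (simp add: primitive_def)
qed

lemma primitive_split:
  assumes "tame w" "0 \<le> s" "s \<le> t" "0 \<le> y"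
  shows "primitive w t y = primitive w s y + integral {s..t} (\<lambda>\<tau>. w \<tau> y)"
proof -
  obtain M where "\<And>s. 0 < s \<Longrightarrow> s \<le> t \<Longrightarrow> cmod (w s y) \<le> M * decay y"
    using tame_boundE[OF assms(1), of t] \<open>0 \<le> y\<close> by metis
  then show ?thesis unfolding primitive_def
    by (intro integral_half_open_split[OF continuous_on_subset[OF tame_cont_time[OF assms(1)]]])
       (use assms in auto)
qed

lemma primitive_lipschitz:
  assumes w: "tame w" and st: "0 < s" "s \<le> t" "0 \<le> y"
    and M: "\<And>s y. 0 < s \<Longrightarrow> s \<le> t \<Longrightarrow> 0 \<le> y \<Longrightarrow> cmod (w s y) \<le> M * decay y" and "0 \<le> M"
  shows "cmod (primitive w t y - primitive w s y) \<le> M * (t - s)"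
proof -
  have "cmod (integral {s..t} (\<lambda>\<tau>. w \<tau> y)) \<le> M * (t - s)"
  proof (rule integral_bound)
    show "continuous_on {s..t} (\<lambda>\<tau>. w \<tau> y)"
      by (rule continuous_on_subset[OF tame_cont_time[OF w]]) (use st in auto)
    fix \<tau> assume "\<tau> \<in> {s..t}"
    then have "cmod (w \<tau> y) \<le> M * decay y" using M st by auto
    also have "\<dots> \<le> M * 1" by (rule mult_left_mono[OF exp_decay_le_1]) (use st \<open>0 \<le> M\<close> in auto)
    finally show "cmod (w \<tau> y) \<le> M" by simp
  qed (use st in auto)
  then show ?thesis using primitive_split[OF w, of s t y] st by simp
qed

lemma slab_integral_cont:
  assumes w: "tame w" and s: "0 < s"
  shows "continuous_on {0..} (\<lambda>y. integral {s..t} (\<lambda>\<tau>. w \<tau> y))"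
proof -
  have "continuous_on ({0..} \<times> cbox s t) (\<lambda>(y, \<tau>). w \<tau> y)"
    using w s unfolding tame_def
    by (auto intro!: continuous_on_compose2[of "{0<..} \<times> {0..}" "\<lambda>(t, y). w t y" _ "\<lambda>p. (snd p, fst p)", simplified]
        continuous_intros simp: case_prod_beta')
  from integral_continuous_on_param[OF this] show ?thesis by simp
qed

text \<open>The integral over \<open>(s, t)\<close> is continuous in \<open>y\<close> by joint
  continuity away from time 0. It approximates the primitive with error at most
  \<open>s * M\<close>, uniformly in \<open>y\<close>, so continuity passes to the limit.\<close>

lemma primitive_cont_space:
  assumes w: "tame w" and t: "0 < t"
  shows "continuous_on {0..} (primitive w t)"
proof -
  obtain M where M: "0 \<le> M" "\<And>s y. 0 < s \<Longrightarrow> s \<le> t \<Longrightarrow> 0 \<le> y \<Longrightarrow> cmod (w s y) \<le> M * decay y"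
    using tame_boundE[OF w, of t] by metis
  have "uniform_limit {0..} (\<lambda>s y. integral {s..t} (\<lambda>\<tau>. w \<tau> y)) (primitive w t) (at_right 0)"
  proof (rule uniform_limitI)
    fix e :: real assume "0 < e"
    have "((\<lambda>s. s * M) \<longlongrightarrow> 0) (at_right 0)" by (auto intro!: tendsto_eq_intros)
    then have "\<forall>\<^sub>F s in at_right 0. s * M < e" using \<open>0 < e\<close> by (auto dest: order_tendstoD)
    moreover have "\<forall>\<^sub>F s in at_right 0. s \<in> {0<..<t}" using t by (rule eventually_at_right_real)
    ultimately show "\<forall>\<^sub>F s in at_right 0. \<forall>y\<in>{0..}. dist (integral {s..t} (\<lambda>\<tau>. w \<tau> y)) (primitive w t y) < e"
    proof eventually_elim
      case (elim s)
      have "dist (integral {s..t} (\<lambda>\<tau>. w \<tau> y)) (primitive w t y) \<le> s * M" if "0 \<le> y" for y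
      proof -
        have "cmod (primitive w s y) \<le> s * M * decay y"
          by (rule primitive_bound[OF w]) (use elim that M in auto)
        also have "\<dots> \<le> s * M * 1"
          by (rule mult_left_mono[OF exp_decay_le_1]) (use that M elim in auto)
        finally show ?thesis
          using primitive_split[OF w, of s t y] elim that by (auto simp: dist_norm norm_minus_commute)
      qed
      then show ?case using elim by (auto intro: le_less_trans)
    qed
  qed
  moreover have "\<forall>\<^sub>F s in at_right 0. continuous_on {0..} (\<lambda>y. integral {s..t} (\<lambda>\<tau>. w \<tau> y))"
    by (auto simp: eventually_at_filter intro!: always_eventually slab_integral_cont[OF w])
  ultimately show ?thesis
    by - (rule uniform_limit_theorem, auto)
qed

lemma primitive_tame:
  assumes w: "tame w"
  shows "tame (primitive w)"
  unfolding tame_def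
proof (intro conjI allI impI)
  show "continuous_on ({0<..} \<times> {0..}) (\<lambda>(t, y). primitive w t y)"
  proof (rule continuous_on_Times_Lipschitz)
    fix a b :: real assume ab: "0 < a" "a \<le> b"
    obtain M where M: "0 \<le> M" "\<And>s y. 0 < s \<Longrightarrow> s \<le> b \<Longrightarrow> 0 \<le> y \<Longrightarrow> cmod (w s y) \<le> M * decay y"
      using tame_boundE[OF w, of b] by metis
    have *: "cmod (primitive w t y - primitive w t' y) \<le> M * \<bar>t - t'\<bar>"
      if "t' \<le> t" "t \<in> {a..b}" "t' \<in> {a..b}" "y \<in> {0..}" for t t' y
      using primitive_lipschitz[OF w, of t' t y M] that M ab by auto
    have "cmod (primitive w t y - primitive w t' y) \<le> M * \<bar>t - t'\<bar>"
      if "t \<in> {a..b}" "t' \<in> {a..b}" "y \<in> {0..}" for t t' y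
      using *[of t' t y] *[of t t' y] that by (cases "t' \<le> t") (auto simp: norm_minus_commute abs_minus_commute)
    then show "\<exists>L. \<forall>t\<in>{a..b}. \<forall>t'\<in>{a..b}. \<forall>y\<in>{0..}. cmod (primitive w t y - primitive w t' y) \<le> L * \<bar>t - t'\<bar>"
      by blast
  qed (rule primitive_cont_space[OF w])
  show "primitive w t 0 = 0" if "0 < t" for t
  proof -
    have "integral {0..t} (\<lambda>s. w s 0) = integral {0..t} (\<lambda>s. 0)"
      by (rule integral_spike[of "{0}"]) (use w in \<open>auto simp: tame_def\<close>)
    then show ?thesis by (simp add: primitive_def)
  qed
  fix T
  obtain M where M: "0 \<le> M" "\<And>s y. 0 < s \<Longrightarrow> s \<le> T \<Longrightarrow> 0 \<le> y \<Longrightarrow> cmod (w s y) \<le> M * decay y"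
    using tame_boundE[OF w, of T] by metis
  have "cmod (primitive w t y) \<le> T * M * decay y" if "0 < t" "t \<le> T" "0 \<le> y" for t y
  proof -
    have "cmod (primitive w t y) \<le> t * M * decay y"
      by (rule primitive_bound[OF w]) (use that M in auto)
    also have "\<dots> \<le> T * M * decay y"
      using that M by (intro mult_right_mono) auto
    finally show ?thesis .
  qed
  then show "\<exists>M. \<forall>t y. 0 < t \<longrightarrow> t \<le> T \<longrightarrow> 0 \<le> y \<longrightarrow> cmod (primitive w t y) \<le> M * decay y"
    by blast
qed

lemma primitive_has_vector_derivative:
  assumes w: "tame w" and t: "0 < t" "0 \<le> y"
  shows "((\<lambda>t. primitive w t y) has_vector_derivative w t y) (at t)"
proof -
  obtain M where M: "\<And>s. 0 < s \<Longrightarrow> s \<le> t + 1 \<Longrightarrow> cmod (w s y) \<le> M * decay y"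
    using tame_boundE[OF w, of "t + 1"] t by metis
  show ?thesis
    unfolding primitive_def
    by (rule integral_half_open_has_vector_derivative[OF tame_cont_time[OF w]]) (use t M in auto)
qed

text \<open>The shift \<open>\<mu>\<close> is built into the equation, so that one theory serves
  both the semigroup orbit (\<open>\<mu> = 0\<close>) and the orbit multiplied by
  \<open>exp (- \<mu> t)\<close>. All derivatives live on the open half-line, as nothing more is
  known at the wall.\<close>

definition classical_sol ::
  "complex \<Rightarrow> (real \<Rightarrow> real \<Rightarrow> complex) \<Rightarrow> (real \<Rightarrow> real \<Rightarrow> complex) \<Rightarrow> (real \<Rightarrow> real \<Rightarrow> complex) \<Rightarrow> (real \<Rightarrow> real \<Rightarrow> complex) \<Rightarrow> bool"
  where "classical_sol \<mu> w wt wy wyy \<longleftrightarrow>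
     continuous_on ({0<..} \<times> {0<..}) (\<lambda>(t, y). wt t y) \<and>
     continuous_on ({0<..} \<times> {0<..}) (\<lambda>(t, y). wy t y) \<and>
     continuous_on ({0<..} \<times> {0<..}) (\<lambda>(t, y). wyy t y) \<and>
     (\<forall>t>0. \<forall>y>0.
        ((\<lambda>s. w s y) has_vector_derivative wt t y) (at t) \<and>
        (w t has_vector_derivative wy t y) (at y) \<and>
        (wy t has_vector_derivative wyy t y) (at y) \<and>
        wt t y = wyy t y - (\<mu> + \<kappa> * U y) * w t y + \<kappa> * U1 y * integral {0..y} (w t))"

definition strong_sol :: "complex \<Rightarrow> (real \<Rightarrow> real \<Rightarrow> complex) \<Rightarrow> bool" where
  "strong_sol \<mu> w \<longleftrightarrow> tame w \<and> (\<exists>wt wy wyy. classical_sol \<mu> w wt wy wyy)"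

lemma classical_solD:
  assumes "classical_sol \<mu> w wt wy wyy"
  shows "continuous_on ({0<..} \<times> {0<..}) (\<lambda>(t, y). wt t y)"
    "continuous_on ({0<..} \<times> {0<..}) (\<lambda>(t, y). wy t y)"
    "continuous_on ({0<..} \<times> {0<..}) (\<lambda>(t, y). wyy t y)"
    "0 < t \<Longrightarrow> 0 < y \<Longrightarrow> ((\<lambda>s. w s y) has_vector_derivative wt t y) (at t)"
    "0 < t \<Longrightarrow> 0 < y \<Longrightarrow> (w t has_vector_derivative wy t y) (at y)"
    "0 < t \<Longrightarrow> 0 < y \<Longrightarrow> (wy t has_vector_derivative wyy t y) (at y)"
    "0 < t \<Longrightarrow> 0 < y \<Longrightarrow>
       wt t y = wyy t y - (\<mu> + \<kappa> * U y) * w t y + \<kappa> * U1 y * integral {0..y} (w t)"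
  using assms unfolding classical_sol_def by blast+

text \<open>The second space derivative of \<open>primitive w\<close>, as obtained by integrating
  the equation over \<open>(0, t)\<close> with initial trace \<open>f\<close>. The formula contains
  no derivative of \<open>w\<close>, hence is continuous up to the wall.\<close>

definition source :: "complex \<Rightarrow> (real \<Rightarrow> complex) \<Rightarrow> (real \<Rightarrow> real \<Rightarrow> complex) \<Rightarrow> real \<Rightarrow> real \<Rightarrow> complex" where
  "source \<mu> f w t y = w t y - f y + (\<mu> + \<kappa> * U y) * primitive w t y
     - \<kappa> * U1 y * integral {0..y} (primitive w t)"

text \<open>The space derivative of \<open>primitive w\<close> at the wall, recovered from the value
  at \<open>y = 1\<close> because no derivative at the wall is available beforehand.\<close>

definition slope :: "complex \<Rightarrow> (real \<Rightarrow> complex) \<Rightarrow> (real \<Rightarrow> real \<Rightarrow> complex) \<Rightarrow> real \<Rightarrow> complex" where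
  "slope \<mu> f w t = primitive w t 1 - integral {0..1} (\<lambda>x. (1 - x) *\<^sub>R source \<mu> f w t x)"

section \<open>Regularity in space of the time primitive\<close>

lemma nonlocal_bound:
  fixes g :: "real \<Rightarrow> complex"
  assumes "continuous_on {0..} g" "0 \<le> y" "\<And>x. 0 \<le> x \<Longrightarrow> cmod (g x) \<le> M"
  shows "cmod (U1 y * integral {0..y} g) \<le> A * M / \<alpha>"
proof -
  have M: "0 \<le> M" using assms(3)[of 0] norm_ge_zero[of "g 0"] by linarith
  have "cmod (integral {0..y} g) \<le> M * (y - 0)"
    by (rule integral_bound) (use assms in \<open>auto intro: continuous_on_subset\<close>)
  then have "cmod (U1 y * integral {0..y} g) \<le> (A * decay y) * (M * y)"
    unfolding norm_mult by (intro mult_mono) (use U1_bound[OF assms(2)] A_nonneg in auto)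
  \<comment> \<open>The integral grows linearly in \<open>y\<close>; the exponential decay of
    \<open>U1\<close> absorbs this, since \<open>\<alpha> * y * decay y\<close> is at most
    1.\<close>
  also have "\<dots> = A * M / \<alpha> * (\<alpha> * y * decay y)" using \<alpha>_pos by simp
  also have "\<dots> \<le> A * M / \<alpha> * 1"
  proof (rule mult_left_mono)
    have "\<alpha> * y \<le> exp (\<alpha> * y)" using exp_ge_add_one_self[of "\<alpha> * y"] by linarith
    then show "\<alpha> * y * decay y \<le> 1" by (simp add: exp_minus field_simps)
  qed (use M A_nonneg \<alpha>_pos in auto)
  finally show ?thesis by simp
qed

lemma potential_bound: "0 \<le> y \<Longrightarrow> cmod (\<mu> + \<kappa> * U y) \<le> cmod \<mu> + cmod \<kappa> * A"
  using norm_triangle_ineq[of \<mu> "\<kappa> * U y"] mult_left_mono[OF U_bound norm_ge_zero[of \<kappa>]]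
  by (force simp: norm_mult)

lemma lower_order_bound:
  fixes g :: "real \<Rightarrow> complex"
  assumes g: "continuous_on {0..} g" "0 \<le> y" "\<And>x. 0 \<le> x \<Longrightarrow> cmod (g x) \<le> M"
  shows "cmod ((\<mu> + \<kappa> * U y) * g y - \<kappa> * U1 y * integral {0..y} g)
    \<le> (cmod \<mu> + cmod \<kappa> * A) * M + cmod \<kappa> * (A * M / \<alpha>)"
proof (rule norm_triangle_le_diff, rule add_mono)
  show "cmod ((\<mu> + \<kappa> * U y) * g y) \<le> (cmod \<mu> + cmod \<kappa> * A) * M"
    unfolding norm_mult using A_nonneg by (intro mult_mono potential_bound g) auto
  show "cmod (\<kappa> * U1 y * integral {0..y} g) \<le> cmod \<kappa> * (A * M / \<alpha>)"
    using mult_left_mono[OF nonlocal_bound[OF g], of "cmod \<kappa>"] by (simp add: norm_mult mult.assoc)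
qed

lemma source_cont_space:
  assumes "tame w" "continuous_on {0..} f" "0 < t"
  shows "continuous_on {0..} (source \<mu> f w t)"
proof -
  have "continuous_on {0..} (\<lambda>y. integral {0..y} (primitive w t))"
    by (auto simp: continuous_on_eq_continuous_within intro: has_vector_derivative_continuous
        indefinite_integral_has_vector_derivative primitive_cont_space[OF assms(1,3)])
  then show ?thesis
    unfolding source_def
    by (intro continuous_intros assms tame_cont_space[OF assms(1)] U_cont U1_cont primitive_cont_space)
qed

lemma source_bound:
  assumes w: "tame w" and f: "\<And>y. 0 \<le> y \<Longrightarrow> cmod (f y) \<le> Mf"
  obtains K where "\<And>t y. 0 < t \<Longrightarrow> t \<le> T \<Longrightarrow> 0 \<le> y \<Longrightarrow> cmod (source \<mu> f w t y) \<le> K"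
proof -
  obtain M where M: "0 \<le> M" "\<And>s y. 0 < s \<Longrightarrow> s \<le> T \<Longrightarrow> 0 \<le> y \<Longrightarrow> cmod (w s y) \<le> M * decay y"
    using tame_boundE[OF w, of T] by metis
  obtain N where N: "0 \<le> N" "\<And>s y. 0 < s \<Longrightarrow> s \<le> T \<Longrightarrow> 0 \<le> y \<Longrightarrow> cmod (primitive w s y) \<le> N * decay y"
    using tame_boundE[OF primitive_tame[OF w], of T] by metis
  show ?thesis
  proof (rule that[of "M + Mf + ((cmod \<mu> + cmod \<kappa> * A) * N + cmod \<kappa> * (A * N / \<alpha>))"])
    fix t y :: real assume t: "0 < t" "t \<le> T" "0 \<le> y"
    have M1: "c * decay y \<le> c" if "0 \<le> c" "0 \<le> y" for c y
      using mult_left_mono[OF exp_decay_le_1[OF that(2)] that(1)] by simp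
    have 1: "cmod (w t y) \<le> M" using M(2)[OF t] M1[of M y] M(1) t by linarith
    have 2: "cmod (primitive w t x) \<le> N" if "0 \<le> x" for x
      using N(2)[OF t(1,2) that] M1[of N x] N(1) that by linarith
    have "cmod (source \<mu> f w t y) \<le> cmod (w t y) + cmod (f y)
        + cmod ((\<mu> + \<kappa> * U y) * primitive w t y - \<kappa> * U1 y * integral {0..y} (primitive w t))"
      unfolding source_def add_diff_eq[symmetric]
      by (intro norm_triangle_le add_right_mono norm_triangle_ineq4)
    with 1 f[OF t(3)] lower_order_bound[OF primitive_cont_space[OF w t(1)] t(3) 2, of \<mu>]
    show "cmod (source \<mu> f w t y) \<le> M + Mf + ((cmod \<mu> + cmod \<kappa> * A) * N + cmod \<kappa> * (A * N / \<alpha>))"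
      by linarith
  qed
qed

lemma source_cont:
  assumes w: "tame w" and f: "continuous_on {0..} f"
  shows "continuous_on ({0<..} \<times> {0..}) (\<lambda>(t, y). source \<mu> f w t y)"
proof -
  let ?Q = "{0<..} \<times> {0::real..} :: (real \<times> real) set"
  have [continuous_intros]: "continuous_on ?Q (\<lambda>p. w (fst p) (snd p))"
      "continuous_on ?Q (\<lambda>p. primitive w (fst p) (snd p))"
      "continuous_on ?Q (\<lambda>p. integral {0..snd p} (primitive w (fst p)))"
    using w primitive_tame[OF w] continuous_on_integral_upper_limit[of "primitive w"]
    by (auto simp: tame_def case_prod_beta')
  have [continuous_intros]: "continuous_on ?Q (\<lambda>p. f (snd p))" "continuous_on ?Q (\<lambda>p. U (snd p))"
      "continuous_on ?Q (\<lambda>p. U1 (snd p))"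
    by (auto intro!: continuous_on_compose2[OF f] continuous_on_compose2[OF U_cont]
        continuous_on_compose2[OF U1_cont] continuous_intros)
  show ?thesis
    unfolding source_def case_prod_beta' by (intro continuous_intros)
qed

text \<open>The equation can be integrated directly only over \<open>(s, t)\<close> with
  \<open>s > 0\<close>, where differentiation under the integral is allowed twice. As
  \<open>s\<close> tends to 0, \<open>w s\<close> converges to \<open>f\<close> only almost
  everywhere, which suffices because it occurs under an integral in \<open>y\<close> with a fixed
  bound.\<close>

lemma primitive_representation:
  assumes sol: "strong_sol \<mu> w" and f: "continuous_on {0..} f"
    and init: "AE y in halfline. ((\<lambda>t. w t y) \<longlongrightarrow> f y) (at_right 0)"
    and t: "0 < t" and y: "0 \<le> y"
  shows "primitive w t y = y *\<^sub>R slope \<mu> f w t + integral {0..y} (\<lambda>x. (y - x) *\<^sub>R source \<mu> f w t x)"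
proof -
  have w: "tame w" using sol by (simp add: strong_sol_def)
  obtain wt wy wyy where cl: "classical_sol \<mu> w wt wy wyy"
    using sol unfolding strong_sol_def by blast
  note cont = classical_solD(1-3)[OF cl] and der = classical_solD(4-6)[OF cl] and eq = classical_solD(7)[OF cl]
  \<comment> \<open>Counterparts of \<open>primitive\<close> and \<open>source\<close> on the time
    interval \<open>(s, t)\<close>, with \<open>w s\<close> in place of the trace
    \<open>f\<close>.\<close>
  define slab where "slab s y = integral {s..t} (\<lambda>\<tau>. w \<tau> y)" for s y
  define src where "src s y = w t y - w s y + (\<mu> + \<kappa> * U y) * slab s y - \<kappa> * U1 y * integral {0..y} (slab s)" for s y
  have slab_cont: "continuous_on {0..} (slab s)" if "0 < s" for s
    unfolding slab_def by (rule slab_integral_cont[OF w that])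
  have int_slab_cont: "continuous_on {0..} (\<lambda>y. integral {0..y} (slab s))" if "0 < s" for s
    by (auto simp: continuous_on_eq_continuous_within intro: has_vector_derivative_continuous
        indefinite_integral_has_vector_derivative slab_cont[OF that])
  have src_cont: "continuous_on {0..} (src s)" if "0 < s" for s
    unfolding src_def
    by (intro continuous_intros tame_cont_space w t that U_cont U1_cont slab_cont int_slab_cont)
  have ex: "\<exists>\<beta>. \<forall>y\<ge>0. slab s y = y *\<^sub>R \<beta> + integral {0..y} (\<lambda>x. (y - x) *\<^sub>R src s x)" if s: "0 < s" "s \<le> t" for s
  proof (rule second_antiderivative_halfline[OF src_cont slab_cont])
    have "integral {s..t} (\<lambda>\<tau>. w \<tau> 0) = integral {s..t} (\<lambda>\<tau>. 0)"
      by (rule integral_cong) (use w s in \<open>auto simp: tame_def\<close>)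
    then show "slab s 0 = 0" by (simp add: slab_def)
    fix y :: real assume y: "0 < y"
    have flip: "continuous_on ({0<..} \<times> cbox s t) (\<lambda>(y, \<tau>). g \<tau> y)"
      if "continuous_on ({0<..} \<times> {0<..}) (\<lambda>(t, y). g t y)" for g :: "real \<Rightarrow> real \<Rightarrow> complex"
    proof -
      have "continuous_on ({0<..} \<times> cbox s t) (\<lambda>p. case (snd p, fst p) of (t, y) \<Rightarrow> g t y)"
        by (rule continuous_on_compose2[OF that]) (use s in \<open>auto intro!: continuous_intros\<close>)
      then show ?thesis by (simp add: case_prod_beta')
    qed
    have line: "continuous_on {s..t} (\<lambda>\<tau>. g \<tau> y)"
      if "continuous_on ({0<..} \<times> {0<..}) (\<lambda>(t, y). g t y)" for g :: "real \<Rightarrow> real \<Rightarrow> complex"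
    proof -
      have "continuous_on {s..t} (\<lambda>\<tau>. case (\<tau>, y) of (t, y) \<Rightarrow> g t y)"
        by (rule continuous_on_compose2[OF that]) (use s y in \<open>auto intro!: continuous_intros\<close>)
      then show ?thesis by simp
    qed
    have open_half: "at y within {0<..} = at y" by (rule at_within_open) (use y in auto)
    have "((\<lambda>y. integral (cbox s t) (\<lambda>\<tau>. w \<tau> y)) has_vector_derivative integral (cbox s t) (\<lambda>\<tau>. wy \<tau> y))
        (at y within {0<..})"
    proof (rule leibniz_rule_vector_derivative)
      show "continuous_on ({0<..} \<times> cbox s t) (\<lambda>(y, \<tau>). wy \<tau> y)" by (rule flip[OF cont(2)])
      show "(\<lambda>\<tau>. w \<tau> y) integrable_on cbox s t" if "y \<in> {0<..}" for y
        unfolding cbox_interval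
        by (rule integrable_continuous_real, rule continuous_on_subset[OF tame_cont_time[OF w]]) (use that s in auto)
      show "((\<lambda>y. w \<tau> y) has_vector_derivative wy \<tau> y) (at y within {0<..})"
        if "y \<in> {0<..}" "\<tau> \<in> cbox s t" for y \<tau>
        using der(2)[of \<tau> y] that s by (auto intro: has_vector_derivative_at_within)
    qed (use y in auto)
    then show "(slab s has_vector_derivative integral {s..t} (\<lambda>\<tau>. wy \<tau> y)) (at y)"
      by (simp add: open_half slab_def[abs_def])
    have "((\<lambda>y. integral (cbox s t) (\<lambda>\<tau>. wy \<tau> y)) has_vector_derivative integral (cbox s t) (\<lambda>\<tau>. wyy \<tau> y))
        (at y within {0<..})"
    proof (rule leibniz_rule_vector_derivative)
      show "continuous_on ({0<..} \<times> cbox s t) (\<lambda>(y, \<tau>). wyy \<tau> y)" by (rule flip[OF cont(3)])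
      show "(\<lambda>\<tau>. wy \<tau> y) integrable_on cbox s t" if "y \<in> {0<..}" for y
      proof -
        have "continuous_on (cbox s t) (\<lambda>\<tau>. case (y, \<tau>) of (y, \<tau>) \<Rightarrow> wy \<tau> y)"
          by (rule continuous_on_compose2[OF flip[OF cont(2)]]) (use that in \<open>auto intro!: continuous_intros\<close>)
        then show ?thesis by (simp add: integrable_continuous_real)
      qed
      show "((\<lambda>y. wy \<tau> y) has_vector_derivative wyy \<tau> y) (at y within {0<..})"
        if "y \<in> {0<..}" "\<tau> \<in> cbox s t" for y \<tau>
        using der(3)[of \<tau> y] that s by (auto intro: has_vector_derivative_at_within)
    qed (use y in auto)
    then have "((\<lambda>y. integral {s..t} (\<lambda>\<tau>. wy \<tau> y)) has_vector_derivative integral {s..t} (\<lambda>\<tau>. wyy \<tau> y)) (at y)"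
      by (simp add: open_half)
    moreover have "integral {s..t} (\<lambda>\<tau>. wyy \<tau> y) = src s y"
    proof -
      have 1: "(wt' has_integral w t y - w s y) {s..t}" if "wt' = (\<lambda>\<tau>. wt \<tau> y)" for wt'
        unfolding that by (rule fundamental_theorem_of_calculus)
          (use s y in \<open>auto intro!: has_vector_derivative_at_within[OF der(1)]\<close>)
      have 2: "((\<lambda>\<tau>. w \<tau> y) has_integral slab s y) {s..t}"
        unfolding slab_def
        by (rule integrable_integral[OF integrable_continuous_real],
            rule continuous_on_subset[OF tame_cont_time[OF w]]) (use s y in auto)
      \<comment> \<open>Exchanging the integrals in time and space turns the time integral of the
        nonlocal term into the nonlocal term of \<open>slab s\<close>.\<close>
      have cw: "continuous_on (cbox (s, 0) (t, y)) (\<lambda>(\<tau>, x). w \<tau> x)"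
        by (rule continuous_on_subset[of "{0<..} \<times> {0..}"]) (use w s in \<open>auto simp: tame_def\<close>)
      have "continuous_on (cbox s t) (\<lambda>\<tau>. integral (cbox 0 y) (w \<tau>))"
        by (rule integral_continuous_on_param) (use cw in \<open>simp add: cbox_Pair_eq\<close>)
      moreover have "integral (cbox s t) (\<lambda>\<tau>. integral (cbox 0 y) (w \<tau>)) = integral (cbox 0 y) (slab s)"
        unfolding slab_def using integral_swap_continuous[OF cw] by simp
      ultimately have 3: "((\<lambda>\<tau>. integral {0..y} (w \<tau>)) has_integral integral {0..y} (slab s)) {s..t}"
        using integrable_integral[OF integrable_continuous_real[of s t "\<lambda>\<tau>. integral {0..y} (w \<tau>)"]] by simp
      have "((\<lambda>\<tau>. wt \<tau> y + (\<mu> + \<kappa> * U y) * w \<tau> y - \<kappa> * U1 y * integral {0..y} (w \<tau>)) has_integral src s y) {s..t}"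
        unfolding src_def
        by (intro has_integral_add has_integral_diff has_integral_mult_right 1 2 3 refl)
      then have "((\<lambda>\<tau>. wyy \<tau> y) has_integral src s y) {s..t}"
        by (rule has_integral_eq[rotated]) (use s y eq in auto)
      then show ?thesis by (rule integral_unique)
    qed
    ultimately show "((\<lambda>y. integral {s..t} (\<lambda>\<tau>. wy \<tau> y)) has_vector_derivative src s y) (at y)" by simp
  qed (use s in auto)
  \<comment> \<open>Evaluation at \<open>y = 1\<close> expresses the unknown slope by quantities
    whose limits for \<open>s\<close> tending to 0 are available.\<close>
  have repr: "slab s y = y *\<^sub>R (slab s 1 - integral {0..1} (\<lambda>x. (1 - x) *\<^sub>R src s x))
      + integral {0..y} (\<lambda>x. (y - x) *\<^sub>R src s x)" if s: "0 < s" "s \<le> t" and y: "0 \<le> y" for s y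
  proof -
    obtain \<beta> where \<beta>: "\<And>y. 0 \<le> y \<Longrightarrow> slab s y = y *\<^sub>R \<beta> + integral {0..y} (\<lambda>x. (y - x) *\<^sub>R src s x)"
      using ex[OF s] by blast
    from \<beta>[of 1] \<beta>[OF y] show ?thesis by simp
  qed

  \<comment> \<open>Positive times, at most \<open>t\<close>, that tend to 0; a sequence is taken so
    that dominated convergence applies.\<close>
  define s where "s n = t / (real n + 2)" for n
  have s_pos: "0 < s n" and s_le: "s n \<le> t" for n
    using t by (auto simp: s_def field_simps)
  have s_lim: "s \<longlonglongrightarrow> 0"
    unfolding s_def by real_asymp
  have s_right: "filterlim s (at_right 0) sequentially"
    using s_lim s_pos by (simp add: filterlim_at less_imp_neq[OF s_pos, symmetric])
  obtain M where M: "0 \<le> M" "\<And>s y. 0 < s \<Longrightarrow> s \<le> t \<Longrightarrow> 0 \<le> y \<Longrightarrow> cmod (w s y) \<le> M * decay y"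
    using tame_boundE[OF w, of t] by metis
  have M1: "c * decay y \<le> c" if "0 \<le> c" "0 \<le> y" for c y
    using mult_left_mono[OF exp_decay_le_1[OF that(2)] that(1)] by simp
  have Mw: "cmod (w s y) \<le> M" if "0 < s" "s \<le> t" "0 \<le> y" for s y
    using M(2)[OF that] M1[of M y] M(1) that by linarith
  have slab_prim: "cmod (slab (s n) y - primitive w t y) \<le> s n * M" if "0 \<le> y" for n y
  proof -
    have "cmod (primitive w (s n) y) \<le> s n * M * decay y"
      by (rule primitive_bound[OF w]) (use that s_pos[of n] s_le[of n] M in auto)
    also have "\<dots> \<le> s n * M" by (rule M1) (use s_pos[of n] M that in auto)
    finally show ?thesis
      using primitive_split[OF w, of "s n" t y] that s_pos[of n] s_le[of n]
      by (simp add: slab_def norm_minus_commute)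
  qed
  have sM: "(\<lambda>n. s n * M) \<longlonglongrightarrow> 0" by (rule tendsto_mult_left_zero[OF s_lim])
  have slab_lim: "(\<lambda>n. slab (s n) y) \<longlonglongrightarrow> primitive w t y" if "0 \<le> y" for y
    by (rule LIM_zero_cancel, rule Lim_null_comparison[OF _ sM]) (use slab_prim that in auto)
  have int_slab_lim: "(\<lambda>n. integral {0..y} (slab (s n))) \<longlonglongrightarrow> integral {0..y} (primitive w t)" if "0 \<le> y" for y
  proof (rule LIM_zero_cancel, rule Lim_null_comparison)
    show "(\<lambda>n. s n * M * (y - 0)) \<longlonglongrightarrow> 0" by (rule tendsto_mult_left_zero[OF sM])
    have "cmod (integral {0..y} (slab (s n)) - integral {0..y} (primitive w t)) \<le> s n * M * (y - 0)" for n
    proof -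
      have c: "continuous_on {0..y} (slab (s n))" "continuous_on {0..y} (primitive w t)"
        by (auto intro: continuous_on_subset slab_cont[OF s_pos] primitive_cont_space[OF w t])
      have "integral {0..y} (slab (s n)) - integral {0..y} (primitive w t) = integral {0..y} (\<lambda>x. slab (s n) x - primitive w t x)"
        by (rule integral_diff[symmetric]) (intro integrable_continuous_real c)+
      also have "cmod \<dots> \<le> s n * M * (y - 0)"
        by (rule integral_bound) (use that c slab_prim in \<open>auto intro!: continuous_intros\<close>)
      finally show ?thesis .
    qed
    then show "\<forall>\<^sub>F n in sequentially. cmod (integral {0..y} (slab (s n)) - integral {0..y} (primitive w t)) \<le> s n * M * (y - 0)"
      by simp
  qed
  obtain N where N: "negligible N" "\<And>y. 0 \<le> y \<Longrightarrow> y \<notin> N \<Longrightarrow> ((\<lambda>t. w t y) \<longlongrightarrow> f y) (at_right 0)"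
    using init unfolding AE_halfline_iff by blast
  have src_lim: "(\<lambda>n. src (s n) x) \<longlonglongrightarrow> source \<mu> f w t x" if "0 \<le> x" "x \<notin> N" for x
    unfolding src_def source_def
    by (intro tendsto_intros slab_lim int_slab_lim that filterlim_compose[OF N(2) s_right])
  have slab_bound: "cmod (slab (s n) x) \<le> M * t" if "0 \<le> x" for n x
  proof -
    have "cmod (slab (s n) x) \<le> M * (t - s n)"
      unfolding slab_def
    proof (rule integral_bound)
      show "continuous_on {s n..t} (\<lambda>\<tau>. w \<tau> x)"
        by (rule continuous_on_subset[OF tame_cont_time[OF w]]) (use that s_pos[of n] in auto)
      show "cmod (w \<tau> x) \<le> M" if "\<tau> \<in> {s n..t}" for \<tau>
        using that s_pos[of n] \<open>0 \<le> x\<close> by (intro Mw) auto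
    qed (rule s_le)
    also have "\<dots> \<le> M * t" using s_pos[of n] M by (intro mult_left_mono) auto
    finally show ?thesis .
  qed
  define K where "K = M + M + ((cmod \<mu> + cmod \<kappa> * A) * (M * t) + cmod \<kappa> * (A * (M * t) / \<alpha>))"
  have src_bound: "cmod (src (s n) x) \<le> K" if "0 \<le> x" for n x
  proof -
    have "cmod (src (s n) x) \<le> cmod (w t x) + cmod (w (s n) x)
        + cmod ((\<mu> + \<kappa> * U x) * slab (s n) x - \<kappa> * U1 x * integral {0..x} (slab (s n)))"
      unfolding src_def add_diff_eq[symmetric]
      by (intro norm_triangle_le add_right_mono norm_triangle_ineq4)
    with Mw[OF t order_refl that] Mw[OF s_pos[of n] s_le[of n] that]
      lower_order_bound[OF slab_cont[OF s_pos[of n]] that slab_bound, of \<mu>]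
    show ?thesis unfolding K_def by linarith
  qed
  have int_lim: "(\<lambda>n. integral {0..y} (\<lambda>x. (y - x) *\<^sub>R src (s n) x)) \<longlonglongrightarrow> integral {0..y} (\<lambda>x. (y - x) *\<^sub>R source \<mu> f w t x)"
    if "0 \<le> y" for y
  proof -
    have spike: "integral ({0..y} - N) g = integral {0..y} g" for g :: "real \<Rightarrow> complex"
      by (rule integral_spike_set) (auto intro: negligible_subset[OF N(1)])
    have "(\<lambda>n. integral ({0..y} - N) (\<lambda>x. (y - x) *\<^sub>R src (s n) x))
        \<longlonglongrightarrow> integral ({0..y} - N) (\<lambda>x. (y - x) *\<^sub>R source \<mu> f w t x)"
    proof (rule dominated_convergence(2))
      show "(\<lambda>x. (y - x) *\<^sub>R src (s n) x) integrable_on {0..y} - N" for n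
      proof (rule integrable_spike_set)
        show "(\<lambda>x. (y - x) *\<^sub>R src (s n) x) integrable_on {0..y}"
          by (intro integrable_continuous_real continuous_intros continuous_on_subset[OF src_cont[OF s_pos]]) auto
      qed (auto intro: negligible_subset[OF N(1)])
      show "(\<lambda>x. y * K) integrable_on {0..y} - N"
        by (rule integrable_spike_set[of _ "{0..y}"]) (auto intro: negligible_subset[OF N(1)])
      show "norm ((y - x) *\<^sub>R src (s n) x) \<le> y * K" if "x \<in> {0..y} - N" for n x
        unfolding norm_scaleR using that by (intro mult_mono src_bound) auto
      show "(\<lambda>n. (y - x) *\<^sub>R src (s n) x) \<longlonglongrightarrow> (y - x) *\<^sub>R source \<mu> f w t x" if "x \<in> {0..y} - N" for x
        using that by (intro tendsto_intros src_lim) auto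
    qed
    then show ?thesis by (simp add: spike)
  qed
  have "(\<lambda>n. slab (s n) y) \<longlonglongrightarrow> y *\<^sub>R slope \<mu> f w t + integral {0..y} (\<lambda>x. (y - x) *\<^sub>R source \<mu> f w t x)"
    unfolding repr[OF s_pos s_le y] slope_def
    by (intro tendsto_intros int_lim slab_lim y) auto
  then show ?thesis
    by (rule LIMSEQ_unique[OF slab_lim[OF y]])
qed

definition primitive_y :: "complex \<Rightarrow> (real \<Rightarrow> complex) \<Rightarrow> (real \<Rightarrow> real \<Rightarrow> complex) \<Rightarrow> real \<Rightarrow> real \<Rightarrow> complex" where
  "primitive_y \<mu> f w t y = slope \<mu> f w t + integral {0..y} (source \<mu> f w t)"

lemma primitive_space_derivatives:
  assumes sol: "strong_sol \<mu> w" and f: "continuous_on {0..} f"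
    and init: "AE y in halfline. ((\<lambda>t. w t y) \<longlongrightarrow> f y) (at_right 0)"
    and t: "0 < t" and y: "0 \<le> y"
  shows "(primitive w t has_vector_derivative primitive_y \<mu> f w t y) (at y within {0..})"
    and "(primitive_y \<mu> f w t has_vector_derivative source \<mu> f w t y) (at y within {0..})"
proof -
  have w: "tame w" using sol by (simp add: strong_sol_def)
  note src = source_cont_space[OF w f t]
  have "((\<lambda>y. y *\<^sub>R slope \<mu> f w t + integral {0..y} (\<lambda>x. (y - x) *\<^sub>R source \<mu> f w t x))
      has_vector_derivative primitive_y \<mu> f w t y) (at y within {0..})"
    unfolding primitive_y_def
    by (auto intro!: derivative_eq_intros iterated_integral_has_vector_derivative src y)
  then show "(primitive w t has_vector_derivative primitive_y \<mu> f w t y) (at y within {0..})"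
    by (rule has_vector_derivative_transform[rotated 2])
       (use y primitive_representation[OF sol f init t] in auto)
  show "(primitive_y \<mu> f w t has_vector_derivative source \<mu> f w t y) (at y within {0..})"
    unfolding primitive_y_def[abs_def]
    by (auto intro!: derivative_eq_intros indefinite_integral_has_vector_derivative src y)
qed

lemma slope_bound:
  assumes "tame w" "continuous_on {0..} f" "0 < t"
    and "cmod (primitive w t 1) \<le> N" and K: "\<And>x. 0 \<le> x \<Longrightarrow> cmod (source \<mu> f w t x) \<le> K"
  shows "cmod (slope \<mu> f w t) \<le> N + K"
proof -
  have "cmod (integral {0..1} (\<lambda>x. (1 - x) *\<^sub>R source \<mu> f w t x)) \<le> K * (1 - 0)"
  proof (rule integral_bound)
    show "continuous_on {0..1} (\<lambda>x. (1 - x) *\<^sub>R source \<mu> f w t x)"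
      by (intro continuous_intros continuous_on_subset[OF source_cont_space[OF assms(1-3)]]) auto
    show "cmod ((1 - x) *\<^sub>R source \<mu> f w t x) \<le> K" if "x \<in> {0..1}" for x
    proof -
      have "\<bar>1 - x\<bar> * cmod (source \<mu> f w t x) \<le> 1 * K"
        by (rule mult_mono) (use that K in auto)
      then show ?thesis by simp
    qed
  qed auto
  then show ?thesis
    unfolding slope_def using assms(4) by (intro norm_triangle_le_diff) auto
qed

text \<open>Linear growth in \<open>y\<close> is acceptable: in the energy estimate this derivative
  occurs only at the cutoff, multiplied by the exponentially small primitive.\<close>

lemma primitive_y_bound:
  assumes "tame w" "continuous_on {0..} f" "0 < t" "0 \<le> y"
    and "cmod (primitive w t 1) \<le> N" and K: "\<And>x. 0 \<le> x \<Longrightarrow> cmod (source \<mu> f w t x) \<le> K"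
  shows "cmod (primitive_y \<mu> f w t y) \<le> N + K + K * y"
proof -
  have "cmod (integral {0..y} (source \<mu> f w t)) \<le> K * (y - 0)"
    by (rule integral_bound) (use assms in \<open>auto intro!: continuous_on_subset[OF source_cont_space]\<close>)
  then show ?thesis
    unfolding primitive_y_def using slope_bound[OF assms(1-3,5,6)] by (intro norm_triangle_le) auto
qed

section \<open>Energy estimate and uniqueness\<close>

lemma energy_nonlocal:
  fixes g :: "real \<Rightarrow> complex"
  assumes g: "continuous_on {0..} g" and "0 \<le> y" "y \<le> R" and E: "integral {0..R} (\<lambda>x. (cmod (g x))\<^sup>2) \<le> E"
  shows "cmod (g y) * cmod (U1 y * integral {0..y} g)
    \<le> A / (2 * \<alpha>) * (cmod (g y))\<^sup>2 + A / 2 * decay y * E"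
proof -
  have int: "(\<lambda>x. (cmod (g x))\<^sup>2) integrable_on {0..z}" "(\<lambda>x. cmod (g y) * cmod (g x)) integrable_on {0..z}"
    "g integrable_on {0..z}" for z
    by (auto intro!: integrable_continuous_real continuous_intros continuous_on_subset[OF g])
  have "cmod (g y) * cmod (integral {0..y} g) \<le> cmod (g y) * integral {0..y} (\<lambda>x. cmod (g x))"
    by (intro mult_left_mono integral_norm_bound_integral int)
       (auto intro!: integrable_continuous_real continuous_intros continuous_on_subset[OF g])
  also have "\<dots> = integral {0..y} (\<lambda>x. cmod (g y) * cmod (g x))" by simp
  also have "\<dots> \<le> integral {0..y} (\<lambda>x. ((cmod (g y))\<^sup>2 + (cmod (g x))\<^sup>2) / 2)"
  proof (rule integral_le[OF int(2)])
    show "(\<lambda>x. ((cmod (g y))\<^sup>2 + (cmod (g x))\<^sup>2) / 2) integrable_on {0..y}"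
      by (auto intro!: integrable_continuous_real continuous_intros continuous_on_subset[OF g])
    show "cmod (g y) * cmod (g x) \<le> ((cmod (g y))\<^sup>2 + (cmod (g x))\<^sup>2) / 2" for x
      using sum_squares_bound[of "cmod (g y)" "cmod (g x)"] by simp
  qed
  also have "\<dots> = (y * (cmod (g y))\<^sup>2 + integral {0..y} (\<lambda>x. (cmod (g x))\<^sup>2)) / 2"
  proof -
    have "integral {0..y} (\<lambda>x. (cmod (g y))\<^sup>2 + (cmod (g x))\<^sup>2) = y * (cmod (g y))\<^sup>2 + integral {0..y} (\<lambda>x. (cmod (g x))\<^sup>2)"
      by (subst integral_add) (use \<open>0 \<le> y\<close> int(1) in auto)
    then show ?thesis by simp
  qed
  also have "integral {0..y} (\<lambda>x. (cmod (g x))\<^sup>2) \<le> E"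
    by (rule order_trans[OF _ E], rule integral_subset_le) (use assms int in auto)
  finally have 1: "cmod (g y) * cmod (integral {0..y} g) \<le> (y * (cmod (g y))\<^sup>2 + E) / 2" by simp
  then have nonneg: "0 \<le> (y * (cmod (g y))\<^sup>2 + E) / 2"
    using order_trans[OF mult_nonneg_nonneg[OF norm_ge_zero norm_ge_zero]] by blast
  \<comment> \<open>Young's inequality has left a factor \<open>y\<close> in front of the local
    term, which the decay of \<open>U1\<close> absorbs. In the other term \<open>decay y\<close>
    remains, so that its integral in \<open>y\<close> is bounded independently of
    \<open>R\<close>.\<close>
  have "\<alpha> * y \<le> exp (\<alpha> * y)" using exp_ge_add_one_self[of "\<alpha> * y"] by linarith
  then have y: "\<alpha> * y * decay y \<le> 1" by (simp add: exp_minus field_simps)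
  have "cmod (g y) * cmod (U1 y * integral {0..y} g) = \<bar>U1 y\<bar> * (cmod (g y) * cmod (integral {0..y} g))"
    by (simp add: norm_mult)
  also have "\<dots> \<le> (A * decay y) * ((y * (cmod (g y))\<^sup>2 + E) / 2)"
    using 1 nonneg U1_bound[OF \<open>0 \<le> y\<close>] A_nonneg by (intro mult_mono) auto
  also have "\<dots> = A / (2 * \<alpha>) * (cmod (g y))\<^sup>2 * (\<alpha> * y * decay y) + A / 2 * decay y * E"
    using \<alpha>_pos by (simp add: field_simps)
  also have "\<dots> \<le> A / (2 * \<alpha>) * (cmod (g y))\<^sup>2 * 1 + A / 2 * decay y * E"
    using y A_nonneg \<alpha>_pos by (intro add_right_mono mult_left_mono) auto
  finally show ?thesis by simp
qed

lemma integral_exp_decay_le: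
  assumes "0 \<le> R" shows "integral {0..R} (\<lambda>y. decay y) \<le> 1 / \<alpha>"
proof -
  have "((\<lambda>y. decay y) has_integral (- decay R / \<alpha> - (- decay 0 / \<alpha>))) {0..R}"
    using \<alpha>_pos assms
    by (intro fundamental_theorem_of_calculus)
       (auto intro!: derivative_eq_intros simp: has_real_derivative_iff_has_vector_derivative[symmetric])
  then show ?thesis using \<alpha>_pos by (simp add: integral_unique divide_simps)
qed

text \<open>The inequality says that \<open>exp (- (L * t)) * (E t + \<delta> / L)\<close> does not
  increase. Only a limit of \<open>E\<close> at 0 is used, as the energy is differentiable for
  positive times only.\<close>

lemma gronwall_vanishing:
  fixes E E' :: "real \<Rightarrow> real"
  assumes der: "\<And>t. 0 < t \<Longrightarrow> t < T \<Longrightarrow> (E has_real_derivative E' t) (at t)"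
    and le: "\<And>t. 0 < t \<Longrightarrow> t < T \<Longrightarrow> E' t \<le> L * E t + \<delta>"
    and lim: "(E \<longlongrightarrow> 0) (at_right 0)" and "0 < L" "0 < t" "t < T" "0 \<le> \<delta>"
  shows "E t \<le> exp (L * t) * \<delta> / L"
proof -
  define G where "G t = exp (- (L * t)) * (E t + \<delta> / L)" for t
  have *: "G t \<le> G s" if s: "0 < s" "s \<le> t" for s
  proof (rule DERIV_nonpos_imp_nonincreasing[OF s(2)])
    fix x assume x: "s \<le> x" "x \<le> t"
    have "(G has_real_derivative exp (- (L * x)) * (E' x - L * E x - \<delta>)) (at x)"
      unfolding G_def using x s assms(4-)
      by (auto intro!: derivative_eq_intros der simp: algebra_simps)
    moreover have "exp (- (L * x)) * (E' x - L * E x - \<delta>) \<le> 0"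
      using le[of x] x s assms(4-) by (intro mult_nonneg_nonpos) auto
    ultimately show "\<exists>y. (G has_real_derivative y) (at x) \<and> y \<le> 0" by blast
  qed
  have "\<forall>\<^sub>F s in at_right 0. G t \<le> G s"
    using eventually_at_right_real[OF \<open>0 < t\<close>] by (rule eventually_mono) (auto intro: *)
  moreover have "(G \<longlongrightarrow> \<delta> / L) (at_right 0)"
    unfolding G_def by (auto intro!: tendsto_eq_intros lim)
  ultimately have "G t \<le> \<delta> / L"
    using tendsto_lowerbound[of G "\<delta> / L" "at_right 0" "G t"] by simp
  then have "E t + \<delta> / L \<le> exp (L * t) * (\<delta> / L)"
    unfolding G_def by (simp add: exp_minus field_simps)
  moreover have "0 \<le> \<delta> / L" using assms by simp
  ultimately show ?thesis by simp
qed

text \<open>The time-integrated equation is tested with the primitive itself. The wall term vanishes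
  because the primitive is 0 there and its derivative exists up to the wall; the term at the cutoff
  \<open>R\<close> gives the exponentially small \<open>\<delta> R\<close>, while \<open>L\<close>
  is independent of \<open>R\<close>.\<close>

lemma strong_sol_energy_le:
  assumes sol: "strong_sol \<mu> w"
    and init: "AE y in halfline. ((\<lambda>t. w t y) \<longlongrightarrow> 0) (at_right 0)" and "0 < T"
  obtains L \<delta> where "0 < L" "(\<delta> \<longlongrightarrow> 0) at_top"
    "\<And>R t. 0 < R \<Longrightarrow> 0 < t \<Longrightarrow> t < T \<Longrightarrow> integral {0..R} (\<lambda>y. (cmod (primitive w t y))\<^sup>2) \<le> exp (L * t) * \<delta> R / L"
proof -
  have w: "tame w" using sol by (simp add: strong_sol_def)
  define P where "P = primitive w"
  define S where "S = source \<mu> (\<lambda>_. 0) w"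
  define Py where "Py = primitive_y \<mu> (\<lambda>_. 0) w"
  have P: "tame P" unfolding P_def by (rule primitive_tame[OF w])
  obtain M where M: "0 \<le> M" "\<And>s y. 0 < s \<Longrightarrow> s \<le> T \<Longrightarrow> 0 \<le> y \<Longrightarrow> cmod (w s y) \<le> M * decay y"
    using tame_boundE[OF w, of T] by metis
  obtain N where N: "0 \<le> N" "\<And>s y. 0 < s \<Longrightarrow> s \<le> T \<Longrightarrow> 0 \<le> y \<Longrightarrow> cmod (P s y) \<le> N * decay y"
    using tame_boundE[OF P, of T] by metis
  obtain K where K: "\<And>s y. 0 < s \<Longrightarrow> s \<le> T \<Longrightarrow> 0 \<le> y \<Longrightarrow> cmod (S s y) \<le> K"
    unfolding S_def using source_bound[OF w, of "\<lambda>_. 0" 0 T \<mu>] by auto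
  have K0: "0 \<le> K" using K[of T 0] \<open>0 < T\<close> norm_ge_zero[of "S T 0"] by linarith
  have dP: "(P t has_vector_derivative Py t y) (at y within {0..})"
    and dPy: "(Py t has_vector_derivative S t y) (at y within {0..})" if "0 < t" "0 \<le> y" for t y
    unfolding P_def Py_def S_def
    using primitive_space_derivatives[OF sol continuous_on_const init that] by auto
  have Py_bound: "cmod (Py t y) \<le> N + K + K * y" if t: "0 < t" "t \<le> T" "0 \<le> y" for t y
    unfolding Py_def
  proof (rule primitive_y_bound[OF w continuous_on_const t(1,3)])
    have "cmod (P t 1) \<le> N * decay 1" using N(2)[OF t(1,2), of 1] by simp
    also have "\<dots> \<le> N * 1" using N(1) \<alpha>_pos by (intro mult_left_mono) auto
    finally show "cmod (primitive w t 1) \<le> N" by (simp add: P_def)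
  qed (use K[OF t(1,2)] in \<open>simp add: S_def\<close>)
  \<comment> \<open>\<open>c\<close> collects the potential and the local half of the nonlocal term.
    The other half is proportional to the total energy and is added in \<open>L\<close>, whose final
    \<open>+ 1\<close> ensures that it is positive.\<close>
  define c where "c = cmod \<mu> + cmod \<kappa> * A + cmod \<kappa> * (A / (2 * \<alpha>))"
  define L where "L = 2 * (c + cmod \<kappa> * (A / (2 * \<alpha>))) + 1"
  define \<delta> where "\<delta> R = 2 * (N * decay R * (N + K + K * R))" for R
  have "0 < L" unfolding L_def c_def using A_nonneg \<alpha>_pos by (auto intro!: add_nonneg_pos)
  have "(\<delta> \<longlongrightarrow> 0) at_top"
    unfolding \<delta>_def using \<alpha>_pos by real_asymp
  define E where "E R t = integral {0..R} (\<lambda>y. (cmod (P t y))\<^sup>2)" for R t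
  define E' where "E' R t = integral {0..R} (\<lambda>y. 2 * (P t y \<bullet> w t y))" for R t
  have cw: "continuous_on ({0<..} \<times> {0..}) (\<lambda>(t, y). w t y)" and cP: "continuous_on ({0<..} \<times> {0..}) (\<lambda>(t, y). P t y)"
    using w P by (auto simp: tame_def)
  have cP1: "continuous_on {0..y} (P t)" and cw1: "continuous_on {0..y} (w t)" if "0 < t" for t y
    using tame_cont_space[OF P that] tame_cont_space[OF w that] by (auto intro: continuous_on_subset)
  have E_der: "(E R has_real_derivative E' R t) (at t)" if "0 < R" "0 < t" for R t
  proof -
    have "((\<lambda>t. integral (cbox 0 R) (\<lambda>y. (cmod (P t y))\<^sup>2)) has_vector_derivative
        integral (cbox 0 R) (\<lambda>y. 2 * (P t y \<bullet> w t y))) (at t within {0<..})"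
    proof (rule leibniz_rule_vector_derivative)
      fix s y :: real assume s: "s \<in> {0<..}" "y \<in> cbox 0 R"
      have dt: "((\<lambda>s. P s y) has_vector_derivative w s y) (at s within {0<..})"
        unfolding P_def by (rule has_vector_derivative_at_within[OF primitive_has_vector_derivative[OF w]]) (use s in auto)
      have "((\<lambda>s. P s y \<bullet> P s y) has_vector_derivative P s y \<bullet> w s y + w s y \<bullet> P s y) (at s within {0<..})"
        by (rule bounded_bilinear.has_vector_derivative[OF bounded_bilinear_inner dt dt])
      then show "((\<lambda>s. (cmod (P s y))\<^sup>2) has_vector_derivative 2 * (P s y \<bullet> w s y)) (at s within {0<..})"
        by (simp add: power2_norm_eq_inner inner_commute)
    next
      show "(\<lambda>y. (cmod (P s y))\<^sup>2) integrable_on cbox 0 R" if "s \<in> {0<..}" for s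
        unfolding cbox_interval using that by (intro integrable_continuous_real continuous_intros cP1) auto
      have *: "{0<..} \<times> cbox 0 R \<subseteq> {0<..} \<times> {0::real..}" by auto
      show "continuous_on ({0<..} \<times> cbox 0 R) (\<lambda>(s, y). 2 * (P s y \<bullet> w s y))"
        using continuous_on_subset[OF cw *] continuous_on_subset[OF cP *]
        by (auto simp: case_prod_beta' intro!: continuous_intros)
    qed (use that in auto)
    then have "((\<lambda>t. E R t) has_vector_derivative E' R t) (at t within {0<..})"
      by (simp add: E_def E'_def)
    then show ?thesis
      using that by (subst (asm) at_within_open) (auto simp: has_real_derivative_iff_has_vector_derivative)
  qed
  have E'_le: "E' R t \<le> L * E R t + \<delta> R" if R: "0 < R" and t: "0 < t" "t < T" for R t
  proof -
    have E0: "0 \<le> E R t" unfolding E_def by (rule integral_nonneg) (use t in \<open>auto intro!: integrable_continuous_real continuous_intros cP1\<close>)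
    have Sc: "continuous_on {0..R} (S t)"
      unfolding S_def by (rule continuous_on_subset[OF source_cont_space[OF w continuous_on_const t(1)]]) auto
    have Pyc: "continuous_on {0..R} (Py t)"
      by (auto simp: continuous_on_eq_continuous_within intro!: has_vector_derivative_continuous
          has_vector_derivative_within_subset[OF dPy] t)
    \<comment> \<open>Integration by parts up to the wall, as \<open>S\<close> is the second
      derivative of \<open>P\<close>. The dissipation \<open>Py t y \<bullet> Py t y\<close> is
      nonnegative and is discarded afterwards.\<close>
    have flux: "((\<lambda>y. P t y \<bullet> S t y + Py t y \<bullet> Py t y) has_integral P t R \<bullet> Py t R - P t 0 \<bullet> Py t 0) {0..R}"
    proof (rule fundamental_theorem_of_calculus)
      show "((\<lambda>y. P t y \<bullet> Py t y) has_vector_derivative P t y \<bullet> S t y + Py t y \<bullet> Py t y) (at y within {0..R})"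
        if "y \<in> {0..R}" for y
        by (rule bounded_bilinear.has_vector_derivative[OF bounded_bilinear_inner];
            rule has_vector_derivative_within_subset) (use that t in \<open>auto intro: dP dPy\<close>)
    qed (use R in auto)
    have "P t 0 = 0" using P t by (auto simp: tame_def)
    have "integral {0..R} (\<lambda>y. P t y \<bullet> S t y) \<le> integral {0..R} (\<lambda>y. P t y \<bullet> S t y + Py t y \<bullet> Py t y)"
      by (rule integral_le) (use t in \<open>auto intro!: integrable_continuous_real continuous_intros cP1 Sc Pyc\<close>)
    also have "\<dots> = P t R \<bullet> Py t R" using integral_unique[OF flux] \<open>P t 0 = 0\<close> by simp
    also have "\<dots> \<le> cmod (P t R) * cmod (Py t R)" by (rule norm_cauchy_schwarz)
    also have "\<dots> \<le> (N * decay R) * (N + K + K * R)"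
      by (rule mult_mono[OF N(2) Py_bound]) (use t R N in auto)
    finally have flux_le: "integral {0..R} (\<lambda>y. P t y \<bullet> S t y) \<le> \<delta> R / 2" by (simp add: \<delta>_def)
    have point: "P t y \<bullet> w t y \<le> P t y \<bullet> S t y + (c * (cmod (P t y))\<^sup>2 + cmod \<kappa> * (A / 2) * E R t * decay y)"
      if y: "y \<in> {0..R}" for y
    proof -
      let ?V = "U1 y * integral {0..y} (P t)"
      \<comment> \<open>The definition of \<open>source\<close> solved for \<open>w\<close>, the
        time derivative of \<open>P\<close>: this is the evolution equation that \<open>P\<close>
        satisfies for zero initial trace.\<close>
      have weq: "w t y = S t y - (\<mu> + \<kappa> * U y) * P t y + \<kappa> * ?V"
        by (simp add: S_def source_def P_def algebra_simps)
      have "P t y \<bullet> w t y = P t y \<bullet> S t y + P t y \<bullet> (- ((\<mu> + \<kappa> * U y) * P t y)) + P t y \<bullet> (\<kappa> * ?V)"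
        unfolding weq by (simp add: inner_diff_right inner_add_right)
      also have "P t y \<bullet> (- ((\<mu> + \<kappa> * U y) * P t y)) \<le> cmod (P t y) * cmod (- ((\<mu> + \<kappa> * U y) * P t y))"
        by (rule norm_cauchy_schwarz)
      also have "\<dots> = cmod (\<mu> + \<kappa> * U y) * (cmod (P t y))\<^sup>2" by (simp add: norm_mult power2_eq_square)
      also have "\<dots> \<le> (cmod \<mu> + cmod \<kappa> * A) * (cmod (P t y))\<^sup>2"
        using y by (intro mult_right_mono potential_bound) auto
      also have "P t y \<bullet> (\<kappa> * ?V) \<le> cmod (P t y) * cmod (\<kappa> * ?V)" by (rule norm_cauchy_schwarz)
      also have "\<dots> = cmod \<kappa> * (cmod (P t y) * cmod ?V)" by (simp only: norm_mult mult_ac)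
      also have "\<dots> \<le> cmod \<kappa> * (A / (2 * \<alpha>) * (cmod (P t y))\<^sup>2 + A / 2 * decay y * E R t)"
        using y t by (intro mult_left_mono energy_nonlocal[OF tame_cont_space[OF P], of t y R]) (auto simp: E_def)
      finally show ?thesis by (simp add: c_def algebra_simps)
    qed
    have i1: "(\<lambda>y. P t y \<bullet> S t y) integrable_on {0..R}" "(\<lambda>y. (cmod (P t y))\<^sup>2) integrable_on {0..R}"
      "(\<lambda>y. decay y) integrable_on {0..R}" "(\<lambda>y. P t y \<bullet> w t y) integrable_on {0..R}"
      using t by (auto intro!: integrable_continuous_real continuous_intros cP1 Sc cw1)
    have "((\<lambda>y. P t y \<bullet> S t y + (c * (cmod (P t y))\<^sup>2 + cmod \<kappa> * (A / 2) * E R t * decay y)) has_integral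
        integral {0..R} (\<lambda>y. P t y \<bullet> S t y) + (c * E R t + cmod \<kappa> * (A / 2) * E R t * integral {0..R} (\<lambda>y. decay y))) {0..R}"
      unfolding E_def by (intro has_integral_add has_integral_mult_right integrable_integral i1)
    from has_integral_le[OF integrable_integral[OF i1(4)] this point]
    have "integral {0..R} (\<lambda>y. P t y \<bullet> w t y)
        \<le> integral {0..R} (\<lambda>y. P t y \<bullet> S t y) + (c * E R t + cmod \<kappa> * (A / 2) * E R t * integral {0..R} (\<lambda>y. decay y))"
      by simp
    also have "\<dots> \<le> \<delta> R / 2 + (c * E R t + cmod \<kappa> * (A / 2) * E R t * (1 / \<alpha>))"
      using E0 A_nonneg R by (intro add_mono flux_le order_refl mult_left_mono integral_exp_decay_le) auto
    finally have "integral {0..R} (\<lambda>y. P t y \<bullet> w t y) \<le> \<delta> R / 2 + (c * E R t + cmod \<kappa> * (A / 2) * E R t * (1 / \<alpha>))" .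
    moreover have "2 * (c * E R t + cmod \<kappa> * (A / 2) * E R t * (1 / \<alpha>)) = (L - 1) * E R t"
      by (simp add: L_def field_simps)
    moreover have "2 * a \<le> d + r" if "a \<le> d / 2 + x" "2 * x = r" for a d x r :: real
      using that by linarith
    ultimately have "2 * integral {0..R} (\<lambda>y. P t y \<bullet> w t y) \<le> \<delta> R + (L - 1) * E R t" by blast
    also have "\<dots> \<le> L * E R t + \<delta> R" using E0 by (simp add: algebra_simps)
    finally show ?thesis by (simp add: E'_def)
  qed
  have E_lim: "(E R \<longlongrightarrow> 0) (at_right 0)" if R: "0 < R" for R
  proof (rule Lim_null_comparison)
    have "norm (E R t) \<le> (t * M)\<^sup>2 * (R - 0)" if t: "t \<in> {0<..<T}" for t
      unfolding E_def
    proof (rule integral_bound)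
      show "continuous_on {0..R} (\<lambda>y. (cmod (P t y))\<^sup>2)" using t by (intro continuous_intros cP1) auto
      fix y assume y: "y \<in> {0..R}"
      have "cmod (P t y) \<le> t * M * decay y"
        unfolding P_def by (rule primitive_bound[OF w]) (use t y M in auto)
      also have "\<dots> \<le> t * M * 1" using t M y by (intro mult_left_mono exp_decay_le_1) auto
      finally show "norm ((cmod (P t y))\<^sup>2) \<le> (t * M)\<^sup>2" by (simp add: power_mono)
    qed (use R in auto)
    then show "\<forall>\<^sub>F t in at_right 0. norm (E R t) \<le> (t * M)\<^sup>2 * (R - 0)"
      using eventually_at_right_real[OF \<open>0 < T\<close>] by (auto elim: eventually_mono)
    show "((\<lambda>t. (t * M)\<^sup>2 * (R - 0)) \<longlongrightarrow> 0) (at_right 0)" by (auto intro!: tendsto_eq_intros)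
  qed
  show ?thesis
  proof (rule that[OF \<open>0 < L\<close> \<open>(\<delta> \<longlongrightarrow> 0) at_top\<close>])
    fix R t :: real assume "0 < R" "0 < t" "t < T"
    have "E R t \<le> exp (L * t) * \<delta> R / L"
      by (rule gronwall_vanishing[OF E_der E'_le E_lim])
         (use \<open>0 < R\<close> \<open>0 < t\<close> \<open>t < T\<close> \<open>0 < L\<close> N K0 in \<open>auto simp: \<delta>_def\<close>)
    then show "integral {0..R} (\<lambda>y. (cmod (primitive w t y))\<^sup>2) \<le> exp (L * t) * \<delta> R / L"
      by (simp add: E_def P_def)
  qed
qed

text \<open>Letting the cutoff tend to infinity makes the energy of the primitive vanish, hence the
  primitive itself by continuity, at all times up to \<open>t + 1\<close>. On this open set of times
  it can be differentiated, which returns \<open>w\<close>. The interval \<open>{0..y+1}\<close> is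
  nondegenerate even for \<open>y = 0\<close>.\<close>

lemma strong_sol_unique:
  assumes sol: "strong_sol \<mu> w"
    and init: "AE y in halfline. ((\<lambda>t. w t y) \<longlongrightarrow> 0) (at_right 0)" and ty: "0 < t" "0 \<le> y"
  shows "w t y = 0"
proof -
  have w: "tame w" using sol by (simp add: strong_sol_def)
  have zero: "primitive w s y = 0" if s: "s \<in> {0<..<t+1}" for s
  proof -
    obtain L \<delta> where L: "0 < L" "(\<delta> \<longlongrightarrow> 0) at_top"
      "\<And>R s. 0 < R \<Longrightarrow> 0 < s \<Longrightarrow> s < t + 1 \<Longrightarrow> integral {0..R} (\<lambda>y. (cmod (primitive w s y))\<^sup>2) \<le> exp (L * s) * \<delta> R / L"
      using strong_sol_energy_le[OF sol init, of "t + 1"] ty by auto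
    let ?g = "\<lambda>y. (cmod (primitive w s y))\<^sup>2"
    have g: "continuous_on {0..R} ?g" for R
      by (intro continuous_intros continuous_on_subset[OF primitive_cont_space[OF w]]) (use s in auto)
    have "((\<lambda>R. exp (L * s) * \<delta> R / L) \<longlongrightarrow> 0) at_top"
      using L by (auto intro!: tendsto_eq_intros)
    moreover have "\<forall>\<^sub>F R in at_top. integral {0..y+1} ?g \<le> exp (L * s) * \<delta> R / L"
      using eventually_ge_at_top[of "y + 1"]
    proof eventually_elim
      case (elim R)
      have "integral {0..y+1} ?g \<le> integral {0..R} ?g"
        by (rule integral_subset_le) (use elim in \<open>auto intro!: integrable_continuous_real g\<close>)
      also have "\<dots> \<le> exp (L * s) * \<delta> R / L" by (rule L(3)) (use elim s ty in auto)
      finally show ?case .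
    qed
    ultimately have "integral {0..y+1} ?g \<le> 0"
      by (rule tendsto_lowerbound) simp
    moreover have "0 \<le> integral {0..y+1} ?g"
      by (rule integral_nonneg) (auto intro!: integrable_continuous_real g)
    ultimately have "integral {0..y+1} ?g = 0" by simp
    then show ?thesis
      using integral_eq_0_iff[OF g, of "y+1"] ty by auto
  qed
  have "((\<lambda>s. primitive w s y) has_vector_derivative w t y) (at t)"
    by (rule primitive_has_vector_derivative[OF w ty])
  moreover have "((\<lambda>s. primitive w s y) has_vector_derivative 0) (at t)"
    by (rule has_vector_derivative_transform_within_open[of "\<lambda>_. 0" _ _ "{0<..<t+1}"]) (use zero ty in auto)
  ultimately show ?thesis by (rule vector_derivative_unique_at)
qed

subsection \<open>Duhamel formula\<close>

lemma tame_diff: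
  assumes "tame v" "tame w"
  shows "tame (\<lambda>t y. v t y - w t y)"
  unfolding tame_def
proof (intro conjI allI impI)
  show "continuous_on ({0<..} \<times> {0..}) (\<lambda>(t, y). v t y - w t y)"
    using assms by (auto simp: tame_def case_prod_beta' intro!: continuous_intros)
  show "v t 0 - w t 0 = 0" if "0 < t" for t using assms that by (simp add: tame_def)
  fix T
  obtain M where M: "\<And>s y. 0 < s \<Longrightarrow> s \<le> T \<Longrightarrow> 0 \<le> y \<Longrightarrow> cmod (v s y) \<le> M * decay y"
    using tame_boundE[OF assms(1), of T] by metis
  obtain N where N: "\<And>s y. 0 < s \<Longrightarrow> s \<le> T \<Longrightarrow> 0 \<le> y \<Longrightarrow> cmod (w s y) \<le> N * decay y"
    using tame_boundE[OF assms(2), of T] by metis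
  have "cmod (v t y - w t y) \<le> (M + N) * decay y" if "0 < t" "t \<le> T" "0 \<le> y" for t y
    unfolding distrib_right by (rule norm_triangle_le_diff, rule add_mono[OF M N]) (use that in auto)
  then show "\<exists>M. \<forall>t y. 0 < t \<longrightarrow> t \<le> T \<longrightarrow> 0 \<le> y \<longrightarrow> cmod (v t y - w t y) \<le> M * decay y"
    by blast
qed

lemma tame_stationary:
  assumes "continuous_on {0..} \<phi>" "\<phi> 0 = 0" "\<And>y. 0 \<le> y \<Longrightarrow> cmod (\<phi> y) \<le> M * decay y"
  shows "tame (\<lambda>t. \<phi>)"
  unfolding tame_def
proof (intro conjI allI impI)
  show "continuous_on ({0<..} \<times> {0..}) (\<lambda>(t, y). \<phi> y)"
    unfolding case_prod_beta' by (rule continuous_on_compose2[OF assms(1)]) (auto intro!: continuous_intros)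
qed (use assms in auto)

lemma strong_sol_exp_shift:
  assumes "strong_sol 0 u"
  shows "strong_sol \<mu> (\<lambda>t y. exp (- \<mu> * of_real t) * u t y)"
proof -
  have u: "tame u" using assms by (simp add: strong_sol_def)
  obtain ut uy uyy where cl: "classical_sol 0 u ut uy uyy"
    using assms unfolding strong_sol_def by blast
  note cont = classical_solD(1-3)[OF cl] and der = classical_solD(4-6)[OF cl] and eq = classical_solD(7)[OF cl]
  let ?e = "\<lambda>t::real. exp (- \<mu> * of_real t)"
  have e: "(?e has_vector_derivative - \<mu> * ?e t) (at t within X)" for t X
    by (rule has_vector_derivative_real_field) (auto intro!: derivative_eq_intros)
  have "tame (\<lambda>t y. ?e t * u t y)"
    unfolding tame_def
  proof (intro conjI allI impI)
    show "continuous_on ({0<..} \<times> {0..}) (\<lambda>(t, y). ?e t * u t y)"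
      using u by (auto simp: tame_def case_prod_beta' intro!: continuous_intros)
    show "?e t * u t 0 = 0" if "0 < t" for t using u that by (simp add: tame_def)
    fix T
    obtain M where M: "0 \<le> M" "\<And>s y. 0 < s \<Longrightarrow> s \<le> T \<Longrightarrow> 0 \<le> y \<Longrightarrow> cmod (u s y) \<le> M * decay y"
      using tame_boundE[OF u, of T] by metis
    have "cmod (?e t * u t y) \<le> exp (\<bar>Re \<mu>\<bar> * T) * M * decay y" if "0 < t" "t \<le> T" "0 \<le> y" for t y
    proof -
      have "- Re \<mu> * t \<le> \<bar>Re \<mu>\<bar> * t" using that by (intro mult_right_mono) auto
      also have "\<dots> \<le> \<bar>Re \<mu>\<bar> * T" using that by (intro mult_left_mono) auto
      finally have "cmod (?e t) \<le> exp (\<bar>Re \<mu>\<bar> * T)" by simp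
      then show ?thesis
        unfolding norm_mult mult.assoc by (rule mult_mono[OF _ M(2)]) (use that in auto)
    qed
    then show "\<exists>M. \<forall>t y. 0 < t \<longrightarrow> t \<le> T \<longrightarrow> 0 \<le> y \<longrightarrow> cmod (?e t * u t y) \<le> M * decay y"
      by blast
  qed
  moreover have "classical_sol \<mu> (\<lambda>t y. ?e t * u t y) (\<lambda>t y. ?e t * ut t y + - \<mu> * ?e t * u t y)
      (\<lambda>t y. ?e t * uy t y) (\<lambda>t y. ?e t * uyy t y)"
    unfolding classical_sol_def
  proof (intro conjI allI impI)
    show "continuous_on ({0<..} \<times> {0<..}) (\<lambda>(t, y). ?e t * ut t y + - \<mu> * ?e t * u t y)"
    proof -
      have "continuous_on ({0<..} \<times> {0<..}) (\<lambda>(t, y). u t y)"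
        by (rule continuous_on_subset[of "{0<..} \<times> {0..}"]) (use u in \<open>auto simp: tame_def\<close>)
      with cont(1) show ?thesis by (auto simp: case_prod_beta' intro!: continuous_intros)
    qed
    show "continuous_on ({0<..} \<times> {0<..}) (\<lambda>(t, y). ?e t * uy t y)"
      using cont(2) by (auto simp: case_prod_beta' intro!: continuous_intros)
    show "continuous_on ({0<..} \<times> {0<..}) (\<lambda>(t, y). ?e t * uyy t y)"
      using cont(3) by (auto simp: case_prod_beta' intro!: continuous_intros)
    fix t y :: real assume ty: "0 < t" "0 < y"
    show "((\<lambda>s. ?e s * u s y) has_vector_derivative ?e t * ut t y + - \<mu> * ?e t * u t y) (at t)"
      by (rule has_vector_derivative_mult[OF e der(1)[OF ty]])
    show "((\<lambda>y. ?e t * u t y) has_vector_derivative ?e t * uy t y) (at y)"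
      by (rule has_vector_derivative_mult_right[OF der(2)[OF ty]])
    show "((\<lambda>y. ?e t * uy t y) has_vector_derivative ?e t * uyy t y) (at y)"
      by (rule has_vector_derivative_mult_right[OF der(3)[OF ty]])
    show "?e t * ut t y + - \<mu> * ?e t * u t y = ?e t * uyy t y - (\<mu> + \<kappa> * U y) * (?e t * u t y)
        + \<kappa> * U1 y * integral {0..y} (\<lambda>y. ?e t * u t y)"
      unfolding eq[OF ty] by (simp add: algebra_simps)
  qed
  ultimately show ?thesis unfolding strong_sol_def by blast
qed

lemma primitive_y_cont:
  assumes w: "tame w" and f: "continuous_on {0..} f"
  shows "continuous_on ({0<..} \<times> {0<..}) (\<lambda>(t, y). primitive_y \<mu> f w t y)"
proof -
  note src = source_cont[OF w f, of \<mu>]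
  have "continuous_on ({0<..} \<times> cbox 0 1) (\<lambda>(t, x). (1 - x) *\<^sub>R source \<mu> f w t x)"
  proof -
    have "continuous_on ({0<..} \<times> cbox 0 1) (\<lambda>(t, x). source \<mu> f w t x)"
      by (rule continuous_on_subset[OF src]) auto
    then show ?thesis by (auto simp: case_prod_beta' intro!: continuous_intros)
  qed
  then have "continuous_on {0<..} (\<lambda>t. integral (cbox 0 1) (\<lambda>x. (1 - x) *\<^sub>R source \<mu> f w t x))"
    by (rule integral_continuous_on_param)
  then have slope: "continuous_on {0<..} (slope \<mu> f w)"
    unfolding slope_def using tame_cont_time[OF primitive_tame[OF w], of 1] by (auto intro!: continuous_intros)
  have "continuous_on ({0<..} \<times> {0<..}) (\<lambda>p. slope \<mu> f w (fst p))"
    by (rule continuous_on_compose2[OF slope]) (auto intro!: continuous_intros)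
  moreover have "continuous_on ({0<..} \<times> {0<..}) (\<lambda>(t, y). integral {0..y} (source \<mu> f w t))"
    by (rule continuous_on_subset[OF continuous_on_integral_upper_limit[OF src]]) auto
  ultimately show ?thesis
    unfolding primitive_y_def by (auto simp: case_prod_beta' intro!: continuous_intros)
qed

text \<open>Because \<open>source\<close> is the second space derivative of
  \<open>primitive u2\<close>, this primitive solves the evolution equation with forcing
  \<open>r\<close> and zero initial value. The stationary \<open>\<phi>\<close> solves the same
  forced equation with initial value \<open>\<phi>\<close>, as does \<open>u1\<close> without
  forcing, so the defect \<open>W\<close> solves the homogeneous equation with vanishing trace and
  uniqueness applies.\<close>

lemma duhamel_stationary:
  assumes \<phi>: "continuous_on {0..} \<phi>" "\<phi> 0 = 0" "\<And>y. 0 \<le> y \<Longrightarrow> cmod (\<phi> y) \<le> M * decay y"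
    and \<phi>1: "\<And>y. 0 < y \<Longrightarrow> (\<phi> has_vector_derivative \<phi>1 y) (at y)"
    and \<phi>2: "\<And>y. 0 < y \<Longrightarrow> (\<phi>1 has_vector_derivative \<phi>2 y) (at y)" "continuous_on {0<..} \<phi>2"
    and r: "continuous_on {0..} r"
      "\<And>y. 0 < y \<Longrightarrow> r y = (\<mu> + \<kappa> * U y) * \<phi> y - \<kappa> * U1 y * integral {0..y} \<phi> - \<phi>2 y"
    and u1: "strong_sol \<mu> u1" "AE y in halfline. ((\<lambda>t. u1 t y) \<longlongrightarrow> \<phi> y) (at_right 0)"
    and u2: "strong_sol \<mu> u2" "AE y in halfline. ((\<lambda>t. u2 t y) \<longlongrightarrow> r y) (at_right 0)"
    and ty: "0 < t" "0 \<le> y"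
  shows "\<phi> y = u1 t y + primitive u2 t y"
proof -
  define W where "W = (\<lambda>t y. \<phi> y - u1 t y - primitive u2 t y)"
  have t1: "tame u1" and t2: "tame u2" using u1 u2 by (auto simp: strong_sol_def)
  note tP = primitive_tame[OF t2]
  have "tame W" unfolding W_def
    by (intro tame_diff tP t1 tame_stationary[OF \<phi>])
  obtain ut uy uyy where cl: "classical_sol \<mu> u1 ut uy uyy"
    using u1(1) unfolding strong_sol_def by blast
  note cont = classical_solD(1-3)[OF cl] and der = classical_solD(4-6)[OF cl] and eq = classical_solD(7)[OF cl]
  have \<phi>1_cont: "continuous_on {0<..} \<phi>1"
    by (rule continuous_on_vector_derivative) (use \<phi>2 in \<open>auto intro: has_vector_derivative_at_within\<close>)
  have stat: "continuous_on ({0<..} \<times> {0<..}) (\<lambda>p. g (snd p))" if "continuous_on {0<..} g" for g :: "real \<Rightarrow> complex"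
    by (rule continuous_on_compose2[OF that]) (auto intro!: continuous_intros)
  have "classical_sol \<mu> W (\<lambda>t y. 0 - ut t y - u2 t y) (\<lambda>t y. \<phi>1 y - uy t y - primitive_y \<mu> r u2 t y)
      (\<lambda>t y. \<phi>2 y - uyy t y - source \<mu> r u2 t y)"
    unfolding classical_sol_def
  proof (intro conjI allI impI)
    show "continuous_on ({0<..} \<times> {0<..}) (\<lambda>(t, y). 0 - ut t y - u2 t y)"
    proof -
      have "continuous_on ({0<..} \<times> {0<..}) (\<lambda>(t, y). u2 t y)"
        by (rule continuous_on_subset[of "{0<..} \<times> {0..}"]) (use t2 in \<open>auto simp: tame_def\<close>)
      with cont(1) show ?thesis by (auto simp: case_prod_beta' intro!: continuous_intros)
    qed
    show "continuous_on ({0<..} \<times> {0<..}) (\<lambda>(t, y). \<phi>1 y - uy t y - primitive_y \<mu> r u2 t y)"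
      using stat[OF \<phi>1_cont] cont(2) primitive_y_cont[OF t2 r(1)]
      by (auto simp: case_prod_beta' intro!: continuous_intros)
    have "continuous_on ({0<..} \<times> {0<..}) (\<lambda>(t, y). source \<mu> r u2 t y)"
      by (rule continuous_on_subset[OF source_cont[OF t2 r(1)]]) auto
    then show "continuous_on ({0<..} \<times> {0<..}) (\<lambda>(t, y). \<phi>2 y - uyy t y - source \<mu> r u2 t y)"
      using stat[OF \<phi>2(2)] cont(3)
      by (auto simp: case_prod_beta' intro!: continuous_intros)
    fix t y :: real assume ty: "0 < t" "0 < y"
    show "((\<lambda>s. W s y) has_vector_derivative 0 - ut t y - u2 t y) (at t)"
      unfolding W_def using ty
      by (intro has_vector_derivative_diff has_vector_derivative_const der primitive_has_vector_derivative t2) auto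
    note P = primitive_space_derivatives[OF u2(1) r(1) u2(2) ty(1) less_imp_le[OF ty(2)], unfolded at_within_halfline[OF ty(2)]]
    show "(W t has_vector_derivative \<phi>1 y - uy t y - primitive_y \<mu> r u2 t y) (at y)"
      unfolding W_def using ty by (intro has_vector_derivative_diff \<phi>1 der P)
    show "((\<lambda>y. \<phi>1 y - uy t y - primitive_y \<mu> r u2 t y) has_vector_derivative \<phi>2 y - uyy t y - source \<mu> r u2 t y) (at y)"
      using ty by (intro has_vector_derivative_diff \<phi>2 der P)
    have i: "\<phi> integrable_on {0..y}" "u1 t integrable_on {0..y}" "primitive u2 t integrable_on {0..y}"
      using \<phi>(1) tame_cont_space[OF t1 ty(1)] tame_cont_space[OF tP ty(1)]
      by (auto intro!: integrable_continuous_real intro: continuous_on_subset)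
    have W_int: "integral {0..y} (W t) = integral {0..y} \<phi> - integral {0..y} (u1 t) - integral {0..y} (primitive u2 t)"
      unfolding W_def by (simp add: integral_diff i integrable_diff)
    show "0 - ut t y - u2 t y = \<phi>2 y - uyy t y - source \<mu> r u2 t y - (\<mu> + \<kappa> * U y) * W t y
        + \<kappa> * U1 y * integral {0..y} (W t)"
      unfolding eq[OF ty] source_def r(2)[OF ty(2)] W_int by (simp add: W_def algebra_simps)
  qed
  with \<open>tame W\<close> have "strong_sol \<mu> W" unfolding strong_sol_def by blast
  moreover have "AE y in halfline. ((\<lambda>t. W t y) \<longlongrightarrow> 0) (at_right 0)"
  proof -
    have prim0: "((\<lambda>t. primitive u2 t y) \<longlongrightarrow> 0) (at_right 0)" if y: "0 \<le> y" for y
    proof -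
      obtain N where N: "0 \<le> N" "\<And>s y. 0 < s \<Longrightarrow> s \<le> 1 \<Longrightarrow> 0 \<le> y \<Longrightarrow> cmod (u2 s y) \<le> N * decay y"
        using tame_boundE[OF t2, of 1] by metis
      show ?thesis
      proof (rule Lim_null_comparison)
        have "cmod (primitive u2 t y) \<le> t * N * decay y" if "t \<in> {0<..<1}" for t
          by (rule primitive_bound[OF t2]) (use that y N in auto)
        then show "\<forall>\<^sub>F t in at_right 0. cmod (primitive u2 t y) \<le> t * N * decay y"
          using eventually_at_right_real[of 0 "1::real"] by (auto elim: eventually_mono)
        show "((\<lambda>t. t * N * decay y) \<longlongrightarrow> 0) (at_right 0)" by (auto intro!: tendsto_eq_intros)
      qed
    qed
    obtain Z where Z: "negligible Z" "\<And>y. 0 \<le> y \<Longrightarrow> y \<notin> Z \<Longrightarrow> ((\<lambda>t. u1 t y) \<longlongrightarrow> \<phi> y) (at_right 0)"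
      using u1(2) unfolding AE_halfline_iff by blast
    have "((\<lambda>t. W t y) \<longlongrightarrow> \<phi> y - \<phi> y - 0) (at_right 0)" if "0 \<le> y" "y \<notin> Z" for y
      unfolding W_def by (intro tendsto_intros Z prim0 that)
    then show ?thesis unfolding AE_halfline_iff using Z(1) by auto
  qed
  ultimately have "W t y = 0" by (rule strong_sol_unique[OF _ _ ty])
  then show ?thesis by (simp add: W_def diff_eq_eq add.commute)
qed

end

section \<open>The shear layer mode\<close>

lemma bounded_if_tendsto_0:
  fixes f :: "real \<Rightarrow> real"
  assumes "continuous_on {0..} f" "(f \<longlongrightarrow> 0) at_top"
  obtains C where "\<And>x. 0 \<le> x \<Longrightarrow> f x \<le> C"
proof -
  have "\<forall>\<^sub>F x in at_top. f x < 1" using order_tendstoD(2)[OF assms(2), of 1] by simp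
  then obtain X where X: "\<And>x. X \<le> x \<Longrightarrow> f x < 1" unfolding eventually_at_top_linorder by blast
  have "compact (f ` {0..max X 0})"
    by (intro compact_continuous_image continuous_on_subset[OF assms(1)]) auto
  then obtain C where C: "\<And>x. x \<in> {0..max X 0} \<Longrightarrow> f x \<le> C"
    using compact_imp_bounded bounded_imp_bdd_above unfolding bdd_above_def by (metis imageI)
  show ?thesis
  proof (rule that[of "max C 1"])
    fix x :: real assume "0 \<le> x"
    then show "f x \<le> max C 1" using X[of x] C[of x] by (cases "X \<le> x") auto
  qed
qed

locale critical_layer =
  fixes c :: complex
  assumes c_pos: "0 < Re c" and inv_pos: "0 < Re (1 / c)"
begin

text \<open>If \<open>b c\<^sup>2 = - \<i>\<close> and \<open>\<tau> = b c\<close>, then a suitable triple antiderivative \<open>Y\<close> of the Gaussian \<open>K\<close> solves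
  the shear layer equation \<open>\<i> Y_zzz + (\<tau> + b z\<^sup>2) Y_z = 2 b z Y\<close>. Up to a constant factor,
  \<open>w\<close> is the derivative of \<open>Y / q\<close>.\<close>

definition p :: complex where "p = 1 / (2 * c)"
definition K :: "real \<Rightarrow> complex" where "K z = exp (- p * of_real z ^ 2)"
text \<open>The integral of \<open>K\<close> from 0 to \<open>z\<close>, rescaled to
  \<open>{0..1}\<close> so that negative \<open>z\<close> needs no separate treatment and oddness is
  immediate.\<close>

definition G :: "real \<Rightarrow> complex" where "G z = of_real z * integral {0..1} (\<lambda>s. K (z * s))"
definition q :: "real \<Rightarrow> complex" where "q z = of_real z ^ 2 + c"
definition w :: "real \<Rightarrow> complex" where "w z = K z / q z ^ 2"
definition w1 :: "real \<Rightarrow> complex" where "w1 z = - of_real z * (1 / c + 4 / q z) * w z"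
definition w2 :: "real \<Rightarrow> complex" where
  "w2 z = (of_real z ^ 2 * (1 / c + 4 / q z) ^ 2 - (1 / c + 4 / q z) + 8 * of_real z ^ 2 / q z ^ 2) * w z"
text \<open>The odd antiderivative of \<open>w\<close>: the derivative of the second term is
  \<open>w\<close> up to a multiple of \<open>K\<close>, which the first term corrects.\<close>

definition \<Gamma> :: "real \<Rightarrow> complex" where "\<Gamma> z = G z / (2 * c ^ 2) + of_real z * K z / (2 * c * q z)"

lemma c_nz: "c \<noteq> 0" using c_pos by auto
lemma p_nz: "p \<noteq> 0" using c_nz by (simp add: p_def)
lemma Re_p: "0 < Re p"
proof -
  have "p = (1 / c) / 2" by (simp add: p_def)
  then have "Re p = Re (1 / c) / 2" by (simp only: Re_divide_numeral)
  then show ?thesis using inv_pos by simp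
qed

lemma cmod_K: "cmod (K z) = exp (- Re p * z\<^sup>2)"
  by (simp add: K_def flip: of_real_power)

lemma q_ge: "Re c \<le> cmod (q z)"
proof -
  have "Re c \<le> Re (q z)" by (simp add: q_def flip: of_real_power)
  also have "\<dots> \<le> cmod (q z)" by (rule complex_Re_le_cmod)
  finally show ?thesis .
qed

lemma q_nz: "q z \<noteq> 0" using q_ge[of z] c_pos by auto

lemma K_deriv: "(K has_vector_derivative - 2 * p * of_real z * K z) (at z within X)"
  unfolding K_def by (rule has_vector_derivative_real_field) (auto intro!: derivative_eq_intros)

lemma inverse_q_deriv: "((\<lambda>z. 1 / q z) has_vector_derivative - (2 * of_real z) / q z ^ 2) (at z within X)"
proof -
  have "((\<lambda>z. 1 / (z ^ 2 + c)) has_field_derivative - (2 * of_real z) / q z ^ 2) (at (complex_of_real z))"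
    using q_nz[of z] by (auto intro!: derivative_eq_intros simp: q_def power2_eq_square)
  then show ?thesis unfolding q_def by (rule has_vector_derivative_real_field)
qed

lemma w_deriv: "(w has_vector_derivative w1 z) (at z within X)"
proof -
  have "w = (\<lambda>z. K z * (1 / q z * (1 / q z)))" by (simp add: w_def fun_eq_iff power2_eq_square)
  moreover have "w1 z = K z * (1 / q z * (- (2 * of_real z) / q z ^ 2) + - (2 * of_real z) / q z ^ 2 * (1 / q z))
      + - 2 * p * of_real z * K z * (1 / q z * (1 / q z))"
    using q_nz[of z] c_nz unfolding w1_def w_def
    by (simp add: p_def divide_simps power2_eq_square) (simp add: algebra_simps)
  ultimately show ?thesis
    by (simp only:) (intro has_vector_derivative_mult K_deriv inverse_q_deriv)
qed

lemma w1_deriv: "(w1 has_vector_derivative w2 z) (at z within X)"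
proof -
  have z: "(complex_of_real has_vector_derivative 1) (at z within X)"
    by (auto intro!: derivative_eq_intros)
  have "((\<lambda>z. - of_real z * (1 / c + 4 * (1 / q z)) * w z) has_vector_derivative
      (- of_real z * (1 / c + 4 * (1 / q z))) * w1 z
      + (- of_real z * (0 + 4 * (- (2 * of_real z) / q z ^ 2)) + - 1 * (1 / c + 4 * (1 / q z))) * w z) (at z within X)"
    by (intro has_vector_derivative_mult has_vector_derivative_minus z has_vector_derivative_add
        has_vector_derivative_const has_vector_derivative_mult_right inverse_q_deriv w_deriv)
  then show ?thesis
    unfolding w1_def[abs_def] w2_def by (simp add: algebra_simps power2_eq_square)
qed

text \<open>The left side is the third derivative of \<open>q * \<Gamma>\<close> and the right side
  is \<open>K / c^2\<close>: up to constants, \<open>q * \<Gamma>\<close> is the triple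
  antiderivative \<open>Y\<close> of the Gaussian.\<close>

lemma mode_ode: "6 * w z + 6 * of_real z * w1 z + q z * w2 z = q z ^ 2 * w z / c ^ 2"
proof -
  \<comment> \<open>After division by \<open>w\<close> only \<open>z^2 = q - c\<close> occurs, so
    the claim is a rational identity in the single variable \<open>Q\<close>.\<close>
  have *: "6 - 6 * s * (1 / c + 4 / Q) + Q * (s * (1 / c + 4 / Q) ^ 2 - (1 / c + 4 / Q) + 8 * s / Q ^ 2) = Q ^ 2 / c ^ 2"
    if "Q \<noteq> 0" "s = Q - c" for s Q :: complex
    unfolding that(2) using that(1) c_nz by (simp add: divide_simps power2_eq_square) (simp add: algebra_simps)
  have "6 * w z + 6 * of_real z * w1 z + q z * w2 z =
      (6 - 6 * of_real z ^ 2 * (1 / c + 4 / q z) + q z * (of_real z ^ 2 * (1 / c + 4 / q z) ^ 2 - (1 / c + 4 / q z)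
        + 8 * of_real z ^ 2 / q z ^ 2)) * w z"
    unfolding w1_def w2_def by (simp add: algebra_simps power2_eq_square)
  also have "\<dots> = q z ^ 2 / c ^ 2 * w z"
    by (subst *) (use q_nz in \<open>auto simp: q_def\<close>)
  finally show ?thesis by simp
qed

section \<open>The complex Gaussian integral\<close>

lemma K_cont: "continuous_on X K"
  unfolding K_def by (intro continuous_intros)

text \<open>Differentiation under the integral and the product rule leave the integral over
  \<open>{0..1}\<close> of the derivative of \<open>s * K (z * s)\<close> in \<open>s\<close>, whose
  boundary value at 1 is \<open>K z\<close>.\<close>

lemma G_deriv: "(G has_vector_derivative K z) (at z)"
proof -
  have "((\<lambda>z. integral (cbox 0 1) (\<lambda>s. K (z * s))) has_vector_derivative
      integral (cbox 0 1) (\<lambda>s. s *\<^sub>R (- 2 * p * of_real (z * s) * K (z * s)))) (at z within UNIV)"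
  proof (rule leibniz_rule_vector_derivative)
    show "((\<lambda>z. K (z * s)) has_vector_derivative s *\<^sub>R (- 2 * p * of_real (z * s) * K (z * s))) (at z within UNIV)" for z s
    proof -
      have "((\<lambda>z. z * s) has_vector_derivative s) (at z within UNIV)" by (auto intro!: derivative_eq_intros)
      from vector_diff_chain_within[OF this K_deriv] show ?thesis by (simp add: o_def)
    qed
    show "(\<lambda>s. K (z * s)) integrable_on cbox 0 1" for z
      unfolding K_def by (intro integrable_continuous continuous_intros)
    show "continuous_on (UNIV \<times> cbox 0 1) (\<lambda>(z, s). s *\<^sub>R (- 2 * p * of_real (z * s) * K (z * s)))"
      unfolding K_def case_prod_beta' by (intro continuous_intros)
  qed auto
  then have "(G has_vector_derivative of_real z * integral {0..1} (\<lambda>s. s *\<^sub>R (- 2 * p * of_real (z * s) * K (z * s)))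
      + 1 * integral {0..1} (\<lambda>s. K (z * s))) (at z)"
    unfolding G_def[abs_def] by (intro has_vector_derivative_mult) (auto intro!: derivative_eq_intros)
  moreover have "((\<lambda>s. of_real z * (s *\<^sub>R (- 2 * p * of_real (z * s) * K (z * s))) + 1 * K (z * s)) has_integral
      of_real z * integral {0..1} (\<lambda>s. s *\<^sub>R (- 2 * p * of_real (z * s) * K (z * s)))
      + 1 * integral {0..1} (\<lambda>s. K (z * s))) {0..1}"
    unfolding K_def
    by (intro has_integral_add has_integral_mult_right integrable_integral integrable_continuous_real continuous_intros)
  moreover have "((\<lambda>s. of_real z * (s *\<^sub>R (- 2 * p * of_real (z * s) * K (z * s))) + 1 * K (z * s)) has_integral
      1 *\<^sub>R K (z * 1) - 0 *\<^sub>R K (z * 0)) {0..1}"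
  proof (rule fundamental_theorem_of_calculus)
    fix s :: real
    have "((\<lambda>s. K (z * s)) has_vector_derivative z *\<^sub>R (- 2 * p * of_real (z * s) * K (z * s))) (at s within {0..1})"
    proof -
      have "((\<lambda>s. z * s) has_vector_derivative z) (at s within {0..1})" by (auto intro!: derivative_eq_intros)
      from vector_diff_chain_within[OF this K_deriv] show ?thesis by (simp add: o_def)
    qed
    from has_vector_derivative_scaleR[OF DERIV_ident this]
    show "((\<lambda>s. s *\<^sub>R K (z * s)) has_vector_derivative
        of_real z * (s *\<^sub>R (- 2 * p * of_real (z * s) * K (z * s))) + 1 * K (z * s)) (at s within {0..1})"
      by (simp add: scaleR_conv_of_real algebra_simps)
  qed simp
  ultimately show ?thesis by (auto dest: has_integral_unique)
qed

lemma G_minus: "G (- z) = - G z"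
  by (simp add: G_def K_def)

text \<open>Chosen so that its derivative cancels that of \<open>p * G^2\<close>: the exponential
  factors as \<open>K z * K (z * s)\<close>, and differentiation in \<open>z\<close> removes the
  denominator.\<close>

definition H :: "real \<Rightarrow> complex" where
  "H z = integral {0..1} (\<lambda>s. exp (- p * of_real (z\<^sup>2 * (1 + s\<^sup>2))) / of_real (1 + s\<^sup>2))"

lemma H_bound: "cmod (H z) \<le> exp (- Re p * z\<^sup>2)"
proof -
  have nz: "complex_of_real (1 + s\<^sup>2) \<noteq> 0" for s
    unfolding of_real_eq_0_iff using zero_le_power2[of s] by linarith
  have "cmod (H z) \<le> exp (- Re p * z\<^sup>2) * (1 - 0)"
    unfolding H_def
  proof (rule integral_bound)
    show "continuous_on {0..1} (\<lambda>s. exp (- p * complex_of_real (z\<^sup>2 * (1 + s\<^sup>2))) / complex_of_real (1 + s\<^sup>2))"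
      using nz by (intro continuous_intros) auto
    fix s :: real
    have "cmod (exp (- p * complex_of_real (z\<^sup>2 * (1 + s\<^sup>2))) / complex_of_real (1 + s\<^sup>2)) = exp (- Re p * (z\<^sup>2 * (1 + s\<^sup>2))) / (1 + s\<^sup>2)"
      unfolding norm_divide norm_of_real by simp
    also have "\<dots> \<le> exp (- Re p * (z\<^sup>2 * (1 + s\<^sup>2))) / 1"
      by (rule divide_left_mono) (auto intro: add_pos_nonneg)
    also have "\<dots> \<le> exp (- Re p * z\<^sup>2)"
      using Re_p by (auto simp: algebra_simps intro!: mult_nonneg_nonneg)
    finally show "cmod (exp (- p * complex_of_real (z\<^sup>2 * (1 + s\<^sup>2))) / complex_of_real (1 + s\<^sup>2)) \<le> exp (- Re p * z\<^sup>2)" .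
  qed auto
  then show ?thesis by simp
qed

lemma H_deriv: "(H has_vector_derivative - 2 * p * G z * K z) (at z)"
proof -
  have nz: "complex_of_real (1 + s\<^sup>2) \<noteq> 0" for s
    unfolding of_real_eq_0_iff using zero_le_power2[of s] by linarith
  have fact: "exp (- p * complex_of_real (z\<^sup>2 * (1 + s\<^sup>2))) = K z * K (z * s)" for z s
    by (simp add: K_def algebra_simps power_mult_distrib flip: exp_add)
  have "((\<lambda>z. integral (cbox 0 1) (\<lambda>s. exp (- p * of_real (z\<^sup>2 * (1 + s\<^sup>2))) / of_real (1 + s\<^sup>2))) has_vector_derivative
      integral (cbox 0 1) (\<lambda>s. (- 2 * p * of_real z * K z) * K (z * s))) (at z within UNIV)"
  proof (rule leibniz_rule_vector_derivative)
    fix z s :: real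
    have "((\<lambda>z. exp (- p * (z\<^sup>2 * of_real (1 + s\<^sup>2))) / of_real (1 + s\<^sup>2)) has_field_derivative
        exp (- p * (of_real z ^ 2 * of_real (1 + s\<^sup>2))) * (- p * (2 * of_real z * of_real (1 + s\<^sup>2))) / of_real (1 + s\<^sup>2)) (at (complex_of_real z))"
      by (intro DERIV_cdivide) (auto intro!: derivative_eq_intros)
    then have "((\<lambda>z. exp (- p * (of_real z ^ 2 * of_real (1 + s\<^sup>2))) / of_real (1 + s\<^sup>2)) has_vector_derivative
        exp (- p * (of_real z ^ 2 * of_real (1 + s\<^sup>2))) * (- p * (2 * of_real z * of_real (1 + s\<^sup>2))) / of_real (1 + s\<^sup>2)) (at z)"
      by (rule has_vector_derivative_real_field)
    moreover have "exp (- p * (of_real z ^ 2 * of_real (1 + s\<^sup>2))) * (- p * (2 * of_real z * of_real (1 + s\<^sup>2))) / of_real (1 + s\<^sup>2)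
        = (- 2 * p * of_real z * K z) * K (z * s)"
      using fact[of z s] nz[of s] by (simp only: of_real_mult of_real_power) simp
    ultimately show "((\<lambda>z. exp (- p * of_real (z\<^sup>2 * (1 + s\<^sup>2))) / of_real (1 + s\<^sup>2)) has_vector_derivative
        (- 2 * p * of_real z * K z) * K (z * s)) (at z within UNIV)"
      by simp
  next
    show "(\<lambda>s. exp (- p * of_real (z\<^sup>2 * (1 + s\<^sup>2))) / of_real (1 + s\<^sup>2)) integrable_on cbox 0 1" for z
      using nz by (intro integrable_continuous continuous_intros) auto
    show "continuous_on (UNIV \<times> cbox 0 1) (\<lambda>(z, s). (- 2 * p * of_real z * K z) * K (z * s))"
      unfolding K_def case_prod_beta' by (intro continuous_intros)
  qed auto
  then show ?thesis
    unfolding H_def[abs_def] by (simp add: G_def mult_ac)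
qed

text \<open>The classical evaluation of the Gaussian integral through \<open>G\<^sup>2 + H\<close>, which works verbatim
  for complex \<open>p\<close> and shows that the Gaussian has nonzero mass.\<close>

lemma G_square: "p * G z ^ 2 + H z = of_real (pi / 4)"
proof -
  have "((\<lambda>z. p * G z ^ 2 + H z) has_vector_derivative 0) (at z within UNIV)" for z
  proof -
    have "((\<lambda>z. p * (G z * G z) + H z) has_vector_derivative p * (G z * K z + K z * G z) + (- 2 * p * G z * K z)) (at z)"
      by (intro has_vector_derivative_add has_vector_derivative_mult_right has_vector_derivative_mult G_deriv H_deriv)
    then show ?thesis by (simp add: power2_eq_square algebra_simps)
  qed
  then obtain k where k: "\<And>z. p * G z ^ 2 + H z = k"
    using has_vector_derivative_zero_constant[of UNIV "\<lambda>z. p * G z ^ 2 + H z"] by auto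
  \<comment> \<open>The constant is read off at \<open>z = 0\<close>, where \<open>G\<close>
    vanishes and \<open>H\<close> is an arctangent integral.\<close>
  have "((\<lambda>s. 1 / (1 + s\<^sup>2)) has_integral arctan 1 - arctan 0) {0..1::real}"
    by (rule fundamental_theorem_of_calculus)
       (auto intro!: derivative_eq_intros simp: has_real_derivative_iff_has_vector_derivative[symmetric] divide_inverse)
  then have "((\<lambda>s. complex_of_real (1 / (1 + s\<^sup>2))) has_integral complex_of_real (arctan 1 - arctan 0)) {0..1}"
    by (rule has_integral_of_real)
  then have "H 0 = of_real (pi / 4)"
    unfolding H_def by (simp add: integral_unique arctan_one)
  with k[of 0] have "k = of_real (pi / 4)" by (simp add: G_def)
  with k show ?thesis by simp
qed

section \<open>Decay of the mode and behaviour of its antiderivative\<close>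

lemma gaussian_decay:
  assumes "0 < \<alpha>"
  obtains C where "0 < C" "\<And>z. (1 + \<bar>z\<bar>) ^ 8 * exp (\<alpha> * \<bar>z\<bar>) * cmod (K z) \<le> C"
proof -
  define \<rho> where "\<rho> = Re p"
  have "0 < \<rho>" using Re_p by (simp add: \<rho>_def)
  have "((\<lambda>x. (1 + x) ^ 8 * exp (\<alpha> * x) * exp (- \<rho> * x\<^sup>2)) \<longlongrightarrow> 0) at_top"
    using \<open>0 < \<rho>\<close> \<open>0 < \<alpha>\<close> by real_asymp
  moreover have "continuous_on {0..} (\<lambda>x. (1 + x) ^ 8 * exp (\<alpha> * x) * exp (- \<rho> * x\<^sup>2))"
    by (intro continuous_intros)
  ultimately obtain C where C: "\<And>x. 0 \<le> x \<Longrightarrow> (1 + x) ^ 8 * exp (\<alpha> * x) * exp (- \<rho> * x\<^sup>2) \<le> C"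
    using bounded_if_tendsto_0 by blast
  show ?thesis
  proof (rule that[of C])
    show "0 < C" using C[of 0] by simp
    show "(1 + \<bar>z\<bar>) ^ 8 * exp (\<alpha> * \<bar>z\<bar>) * cmod (K z) \<le> C" for z
      using C[of "\<bar>z\<bar>"] by (simp add: cmod_K \<rho>_def)
  qed
qed

lemma cmod_w_le: "cmod (w z) \<le> cmod (K z) / (Re c)\<^sup>2"
  unfolding w_def norm_divide norm_power using c_pos
  by (intro divide_left_mono power_mono q_ge) (auto intro!: mult_pos_pos simp: q_nz)

text \<open>The sixth power is what the squared cubic Taylor error of the flow costs in the
  residual. The prefactor of \<open>w2\<close> grows quadratically in \<open>z\<close>, which is why
  the Gaussian was bounded with the eighth power.\<close>

lemma mode_decay:
  assumes "0 < \<alpha>"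
  obtains C where "0 < C"
    "\<And>z. (1 + \<bar>z\<bar>) ^ 6 * exp (\<alpha> * \<bar>z\<bar>) * cmod (w z) \<le> C"
    "\<And>z. (1 + \<bar>z\<bar>) ^ 6 * exp (\<alpha> * \<bar>z\<bar>) * cmod (w1 z) \<le> C"
    "\<And>z. (1 + \<bar>z\<bar>) ^ 6 * exp (\<alpha> * \<bar>z\<bar>) * cmod (w2 z) \<le> C"
proof -
  obtain C where C: "0 < C" "\<And>z. (1 + \<bar>z\<bar>) ^ 8 * exp (\<alpha> * \<bar>z\<bar>) * cmod (K z) \<le> C"
    using gaussian_decay[OF assms] by metis
  define B where "B = 1 / cmod c + 4 / Re c"
  have B: "0 \<le> B" using c_pos by (simp add: B_def)
  have Bq: "cmod (1 / c + 4 / q z) \<le> B" for z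
  proof (rule norm_triangle_le)
    have "4 / cmod (q z) \<le> 4 / Re c" using q_ge[of z] c_pos by (intro divide_left_mono) (auto simp: q_nz)
    then show "cmod (1 / c) + cmod (4 / q z) \<le> B" by (simp add: B_def norm_divide)
  qed
  define D where "D = 1 + B + (B\<^sup>2 + 8 / (Re c)\<^sup>2)"
  have D1: "1 \<le> D" and DB: "B \<le> D" using B by (auto simp: D_def)
  have *: "(1 + \<bar>z\<bar>) ^ 6 * exp (\<alpha> * \<bar>z\<bar>) * X \<le> D * (C / (Re c)\<^sup>2)"
    if X: "X \<le> D * (1 + \<bar>z\<bar>)\<^sup>2 * cmod (w z)" for X z
  proof -
    have "(1 + \<bar>z\<bar>) ^ 6 * exp (\<alpha> * \<bar>z\<bar>) * X \<le> (1 + \<bar>z\<bar>) ^ 6 * exp (\<alpha> * \<bar>z\<bar>) * (D * (1 + \<bar>z\<bar>)\<^sup>2 * (cmod (K z) / (Re c)\<^sup>2))"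
      by (rule mult_left_mono, rule order_trans[OF X], rule mult_left_mono[OF cmod_w_le]) (use D1 in auto)
    also have "\<dots> = D * ((1 + \<bar>z\<bar>) ^ 8 * exp (\<alpha> * \<bar>z\<bar>) * cmod (K z) / (Re c)\<^sup>2)"
      by (simp add: eval_nat_numeral)
    also have "\<dots> \<le> D * (C / (Re c)\<^sup>2)"
      using C(2)[of z] D1 by (intro mult_left_mono divide_right_mono) auto
    finally show ?thesis .
  qed
  have z2: "1 \<le> (1 + \<bar>z\<bar>)\<^sup>2" "\<bar>z\<bar> \<le> (1 + \<bar>z\<bar>)\<^sup>2" "z\<^sup>2 \<le> (1 + \<bar>z\<bar>)\<^sup>2" for z :: real
    by (auto simp: power2_eq_square algebra_simps abs_mult[symmetric])
  show ?thesis
  proof (rule that[of "D * (C / (Re c)\<^sup>2)"])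
    show "0 < D * (C / (Re c)\<^sup>2)" using D1 C c_pos by (intro mult_pos_pos) auto
    fix z
    have "1 * cmod (w z) \<le> D * (1 + \<bar>z\<bar>)\<^sup>2 * cmod (w z)"
      using mult_mono[OF D1 z2(1)] D1 by (intro mult_right_mono) auto
    then show "(1 + \<bar>z\<bar>) ^ 6 * exp (\<alpha> * \<bar>z\<bar>) * cmod (w z) \<le> D * (C / (Re c)\<^sup>2)"
      by (intro *) simp
    have "cmod (w1 z) = cmod (1 / c + 4 / q z) * \<bar>z\<bar> * cmod (w z)" by (simp add: w1_def norm_mult)
    also have "\<dots> \<le> D * (1 + \<bar>z\<bar>)\<^sup>2 * cmod (w z)"
      by (intro mult_right_mono mult_mono z2 order_trans[OF Bq DB]) (use D1 in auto)
    finally show "(1 + \<bar>z\<bar>) ^ 6 * exp (\<alpha> * \<bar>z\<bar>) * cmod (w1 z) \<le> D * (C / (Re c)\<^sup>2)" by (rule *)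
    have "cmod (of_real z ^ 2 * (1 / c + 4 / q z) ^ 2 - (1 / c + 4 / q z) + 8 * of_real z ^ 2 / q z ^ 2)
      \<le> cmod (of_real z ^ 2 * (1 / c + 4 / q z) ^ 2) + cmod (1 / c + 4 / q z) + cmod (8 * of_real z ^ 2 / q z ^ 2)"
      by (rule norm_triangle_le norm_triangle_le_diff add_mono norm_triangle_ineq4 order_refl)+
    also have "\<dots> \<le> (1 + \<bar>z\<bar>)\<^sup>2 * B\<^sup>2 + B * (1 + \<bar>z\<bar>)\<^sup>2 + (1 + \<bar>z\<bar>)\<^sup>2 * (8 / (Re c)\<^sup>2)"
    proof (intro add_mono)
      show "cmod (of_real z ^ 2 * (1 / c + 4 / q z) ^ 2) \<le> (1 + \<bar>z\<bar>)\<^sup>2 * B\<^sup>2"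
        unfolding norm_mult norm_power norm_of_real
        by (intro mult_mono power_mono Bq) auto
      show "cmod (1 / c + 4 / q z) \<le> B * (1 + \<bar>z\<bar>)\<^sup>2"
        using mult_mono[OF Bq[of z] z2(1)[of z]] B by simp
      have "cmod (8 * of_real z ^ 2 / q z ^ 2) = z\<^sup>2 * (8 / (cmod (q z))\<^sup>2)"
        by (simp add: norm_mult norm_divide norm_power)
      also have "\<dots> \<le> (1 + \<bar>z\<bar>)\<^sup>2 * (8 / (Re c)\<^sup>2)"
        using c_pos q_ge[of z] by (intro mult_mono z2 divide_left_mono power_mono) (auto intro!: mult_pos_pos simp: q_nz)
      finally show "cmod (8 * of_real z ^ 2 / q z ^ 2) \<le> (1 + \<bar>z\<bar>)\<^sup>2 * (8 / (Re c)\<^sup>2)" .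
    qed
    also have "\<dots> \<le> D * (1 + \<bar>z\<bar>)\<^sup>2"
      by (simp add: D_def algebra_simps)
    finally have "cmod (w2 z) \<le> D * (1 + \<bar>z\<bar>)\<^sup>2 * cmod (w z)"
      unfolding w2_def norm_mult by (intro mult_right_mono) auto
    then show "(1 + \<bar>z\<bar>) ^ 6 * exp (\<alpha> * \<bar>z\<bar>) * cmod (w2 z) \<le> D * (C / (Re c)\<^sup>2)" by (rule *)
  qed
qed

lemma \<Gamma>_minus: "\<Gamma> (- z) = - \<Gamma> z"
  by (simp add: \<Gamma>_def G_minus K_def q_def)

lemma \<Gamma>_deriv: "(\<Gamma> has_vector_derivative w z) (at z)"
proof -
  have z: "(complex_of_real has_vector_derivative 1) (at z)"
    by (auto intro!: derivative_eq_intros)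
  have "((\<lambda>z. 1 / (2 * c ^ 2) * G z + 1 / (2 * c) * (of_real z * K z * (1 / q z))) has_vector_derivative
      1 / (2 * c ^ 2) * K z + 1 / (2 * c) * (of_real z * K z * (- (2 * of_real z) / q z ^ 2)
        + (of_real z * (- 2 * p * of_real z * K z) + 1 * K z) * (1 / q z))) (at z)"
    by (intro has_vector_derivative_mult z has_vector_derivative_add
        has_vector_derivative_mult_right inverse_q_deriv G_deriv K_deriv)
  moreover have "1 / (2 * c ^ 2) * K z + 1 / (2 * c) * (of_real z * K z * (- (2 * of_real z) / q z ^ 2)
        + (of_real z * (- 2 * p * of_real z * K z) + 1 * K z) * (1 / q z)) = w z"
  proof -
    have *: "1 / (2 * c ^ 2) * k + 1 / (2 * c) * (- (2 * s) * k / Q ^ 2 + (- (1 / c) * s * k + k) * (1 / Q)) = k / Q ^ 2"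
      if "Q \<noteq> 0" "s = Q - c" for s Q k :: complex
      unfolding that(2) using that(1) c_nz by (simp add: divide_simps power2_eq_square) (simp add: algebra_simps)
    show ?thesis
      unfolding w_def using *[of "q z" "of_real z ^ 2" "K z", OF q_nz]
      by (simp add: q_def[of z] p_def power2_eq_square mult_ac)
  qed
  ultimately show ?thesis by (simp add: \<Gamma>_def[abs_def])
qed

lemma gaussian_weight_le:
  assumes C: "\<And>z. (1 + \<bar>z\<bar>) ^ 8 * exp (\<alpha> * \<bar>z\<bar>) * cmod (K z) \<le> C" and "0 < \<alpha>"
  shows "(1 + \<bar>z\<bar>)\<^sup>2 * cmod (K z) \<le> C"
proof -
  have "(1 + \<bar>z\<bar>) ^ 2 * 1 \<le> (1 + \<bar>z\<bar>) ^ 8 * exp (\<alpha> * \<bar>z\<bar>)"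
    using \<open>0 < \<alpha>\<close> by (intro mult_mono power_increasing) auto
  from mult_right_mono[OF this norm_ge_zero] C[of z] show ?thesis by (auto intro: order_trans)
qed

text \<open>\<open>G_square\<close> also bounds \<open>G\<close>: as \<open>H\<close> has modulus at
  most 1, \<open>p * G^2\<close> has modulus at most 2.\<close>

lemma \<Gamma>_bound:
  obtains C where "\<And>z. cmod (\<Gamma> z) \<le> C"
proof -
  obtain C where C: "0 < C" "\<And>z. (1 + \<bar>z\<bar>)\<^sup>2 * cmod (K z) \<le> C"
    using gaussian_decay[of 1] gaussian_weight_le[of 1] by (metis zero_less_one)
  have G2: "(cmod (G z))\<^sup>2 \<le> 2 / cmod p" for z
  proof -
    have "cmod (p * G z ^ 2) = cmod (of_real (pi / 4) - H z)" using G_square[of z] by (metis add_diff_cancel_right')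
    also have "\<dots> \<le> cmod (of_real (pi / 4)) + cmod (H z)" by (rule norm_triangle_ineq4)
    also have "\<dots> \<le> 1 + 1"
    proof (rule add_mono)
      show "cmod (of_real (pi / 4)) \<le> 1" using pi_less_4 by simp
      have "exp (- Re p * z\<^sup>2) \<le> 1" using Re_p by simp
      then show "cmod (H z) \<le> 1" using H_bound[of z] by linarith
    qed
    finally show ?thesis using p_nz by (simp add: norm_mult norm_power field_simps)
  qed
  show ?thesis
  proof (rule that)
    fix z
    have "cmod (G z) \<le> sqrt (2 / cmod p)" using G2[of z] by (rule real_le_rsqrt)
    moreover have "\<bar>z\<bar> * cmod (K z) \<le> C"
    proof -
      have "\<bar>z\<bar> \<le> (1 + \<bar>z\<bar>)\<^sup>2" by (auto simp: power2_eq_square algebra_simps)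
      from mult_right_mono[OF this norm_ge_zero] C(2)[of z] show ?thesis by (auto intro: order_trans)
    qed
    ultimately have "cmod (G z) / (2 * (cmod c)\<^sup>2) + \<bar>z\<bar> * cmod (K z) / (2 * cmod c * cmod (q z))
        \<le> sqrt (2 / cmod p) / (2 * (cmod c)\<^sup>2) + C / (2 * cmod c * Re c)"
      using c_pos c_nz q_ge[of z] q_nz[of z] C(1)
      by (intro add_mono divide_right_mono frac_le mult_left_mono) (auto intro!: mult_pos_pos)
    then show "cmod (\<Gamma> z) \<le> sqrt (2 / cmod p) / (2 * (cmod c)\<^sup>2) + C / (2 * cmod c * Re c)"
      unfolding \<Gamma>_def by (intro norm_triangle_le) (simp add: norm_mult norm_divide norm_power)
  qed
qed

text \<open>\<open>G_square\<close> keeps the modulus of \<open>G\<close> away from 0 where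
  \<open>H\<close> is small. This alone would not prevent \<open>G x\<close> and \<open>G y\<close>
  from cancelling, so the tail bound \<open>C / x\<close> is used to show that they are close to
  each other. The other summand of \<open>\<Gamma>\<close> is negligible far out.\<close>

lemma \<Gamma>_sum_lower_bound:
  obtains m X where "0 < m" "0 < X" "\<And>x y. X \<le> x \<Longrightarrow> X \<le> y \<Longrightarrow> m \<le> cmod (\<Gamma> x + \<Gamma> y)"
proof -
  obtain C where C: "0 < C" "\<And>z. (1 + \<bar>z\<bar>)\<^sup>2 * cmod (K z) \<le> C"
    using gaussian_decay[of 1] gaussian_weight_le[of 1] by (metis zero_less_one)
  have Kz: "cmod (K z) \<le> C / z\<^sup>2" "z * cmod (K z) \<le> C / z" if "0 < z" for z
  proof -
    have "z\<^sup>2 * cmod (K z) \<le> (1 + \<bar>z\<bar>)\<^sup>2 * cmod (K z)"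
      using that by (intro mult_right_mono power_mono) auto
    then have "z\<^sup>2 * cmod (K z) \<le> C" using C(2)[of z] by linarith
    then show "cmod (K z) \<le> C / z\<^sup>2" "z * cmod (K z) \<le> C / z" using that by (auto simp: field_simps power2_eq_square)
  qed
  have G_diff: "cmod (G y - G x) \<le> C / x" if "0 < x" "x \<le> y" for x y
  proof -
    have "cmod (G y - G x) \<le> - C / y - - C / x"
    proof (cases "x = y")
      case False
      show ?thesis
      proof (rule differentiable_bound_general)
        show "x < y" using False that by simp
        show "continuous_on {x..y} G"
          by (auto simp: continuous_on_eq_continuous_within intro!: has_vector_derivative_continuous
            has_vector_derivative_at_within[OF G_deriv])
        show "continuous_on {x..y} (\<lambda>z. - C / z)" using that by (intro continuous_intros) auto
        show "(G has_vector_derivative K z) (at z)" for z by (rule G_deriv)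
        show "((\<lambda>z. - C / z) has_vector_derivative C / z\<^sup>2) (at z)" if "x < z" for z
          using that \<open>0 < x\<close>
          by (auto intro!: derivative_eq_intros simp: has_real_derivative_iff_has_vector_derivative[symmetric] power2_eq_square)
        show "cmod (K z) \<le> C / z\<^sup>2" if "x < z" for z using that \<open>0 < x\<close> by (intro Kz) auto
      qed
    qed auto
    also have "\<dots> \<le> C / x" using that C by simp
    finally show ?thesis .
  qed
  \<comment> \<open>\<open>cmod p * s^2\<close> is \<open>pi / 8\<close>, half of the limit
    \<open>pi / 4\<close> of \<open>p * G^2\<close>; the other half is given to
    \<open>H\<close>.\<close>
  define s where "s = sqrt (pi / (8 * cmod p))"
  have s: "0 < s" using p_nz by (simp add: s_def)
  have "((\<lambda>x. exp (- Re p * x\<^sup>2)) \<longlongrightarrow> 0) at_top" using Re_p by real_asymp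
  then have "\<forall>\<^sub>F x in at_top. exp (- Re p * x\<^sup>2) < pi / 8" by (rule order_tendstoD) simp
  then obtain X0 where X0: "\<And>x. X0 \<le> x \<Longrightarrow> exp (- Re p * x\<^sup>2) < pi / 8" unfolding eventually_at_top_linorder by blast
  have G_lower: "s \<le> cmod (G x)" if "X0 \<le> x" for x
  proof -
    have "pi / 4 = cmod (p * G x ^ 2 + H x)" unfolding G_square by simp
    also have "\<dots> \<le> cmod p * (cmod (G x))\<^sup>2 + cmod (H x)"
      by (rule order_trans[OF norm_triangle_ineq]) (simp add: norm_mult norm_power)
    also have "cmod (H x) \<le> pi / 8" using H_bound[of x] X0[OF that] by linarith
    finally have "pi / (8 * cmod p) \<le> (cmod (G x))\<^sup>2" using p_nz by (simp add: field_simps)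
    then show ?thesis unfolding s_def by (rule real_le_lsqrt[rotated -1]) auto
  qed
  \<comment> \<open>Beyond the first summand, \<open>C / x\<close> is at most \<open>s / 2\<close>.
    Beyond the second, the two terms of the form \<open>z * K z / (2 * c * q z)\<close> contribute
    at most \<open>s / (4 * (cmod c)^2)\<close>, a third of the bound obtained for the
    \<open>G\<close> part.\<close>
  define E where "E = 2 * C / s + 4 * C * cmod c / (Re c * s)"
  have E: "0 \<le> E" using C s c_pos by (simp add: E_def)
  define X where "X = max X0 (1 + E)"
  show ?thesis
  proof (rule that[of "s / (2 * (cmod c)\<^sup>2)" X])
    show "0 < s / (2 * (cmod c)\<^sup>2)" using s c_nz by simp
    show "0 < X" using E by (simp add: X_def)
    have main: "s / (2 * (cmod c)\<^sup>2) \<le> cmod (\<Gamma> x + \<Gamma> y)" if x: "X \<le> x" and xy: "x \<le> y" for x y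
    proof -
      have x0: "0 < x" "0 < y" "X0 \<le> x" "E \<le> x" using x xy E by (auto simp: X_def)
      have e1: "C / x \<le> s / 2"
      proof -
        have "2 * C / s \<le> x" using x0(4) C s c_pos unfolding E_def by (smt (verit) divide_nonneg_pos mult_nonneg_nonneg mult_pos_pos norm_ge_zero)
        then show ?thesis using x0(1) s by (simp add: field_simps)
      qed
      have e2: "C / x / (2 * cmod c * Re c) + C / x / (2 * cmod c * Re c) \<le> s / (4 * (cmod c)\<^sup>2)"
      proof -
        have "4 * C * cmod c / (Re c * s) \<le> x" using x0(4) C s unfolding E_def by (smt (verit) divide_nonneg_pos)
        then show ?thesis using x0(1) s c_pos c_nz by (simp add: field_simps power2_eq_square)
      qed
      have err: "cmod (of_real z * K z / (2 * c * q z)) \<le> C / x / (2 * cmod c * Re c)" if "x \<le> z" for z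
      proof -
        have "cmod (of_real z * K z / (2 * c * q z)) = z * cmod (K z) / (2 * cmod c * cmod (q z))"
          using that x0 by (simp add: norm_mult norm_divide)
        also have "\<dots> \<le> C / x / (2 * cmod c * Re c)"
        proof (rule frac_le)
          have "z * cmod (K z) \<le> C / z" using that x0 by (intro Kz) auto
          also have "\<dots> \<le> C / x" using that x0 C by (intro divide_left_mono) auto
          finally show "z * cmod (K z) \<le> C / x" .
        qed (use c_pos c_nz q_ge[of z] x0 C in auto)
        finally show ?thesis .
      qed
      have "2 * s - s / 2 \<le> cmod (2 * G x) - cmod (G y - G x)"
      proof -
        have "cmod (2 * G x) = 2 * cmod (G x)" by (simp add: norm_mult)
        then show ?thesis using G_lower[OF x0(3)] G_diff[OF x0(1) xy] e1 by linarith
      qed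
      also have "\<dots> \<le> cmod (G x + G y)"
        using norm_triangle_ineq2[of "2 * G x" "- (G y - G x)"] by (simp only: norm_minus_cancel) (simp add: algebra_simps)
      finally have "3 * s / 2 / (2 * (cmod c)\<^sup>2) \<le> cmod (G x + G y) / (2 * (cmod c)\<^sup>2)"
        by (intro divide_right_mono) auto
      also have "\<dots> = cmod ((G x + G y) / (2 * c\<^sup>2))" by (simp add: norm_divide norm_mult norm_power)
      finally have g: "3 * s / 2 / (2 * (cmod c)\<^sup>2) \<le> cmod ((G x + G y) / (2 * c\<^sup>2))" .
      have "\<Gamma> x + \<Gamma> y = (G x + G y) / (2 * c\<^sup>2) + (of_real x * K x / (2 * c * q x) + of_real y * K y / (2 * c * q y))"
        by (simp add: \<Gamma>_def add_divide_distrib)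
      then have "cmod ((G x + G y) / (2 * c\<^sup>2)) \<le> cmod (\<Gamma> x + \<Gamma> y)
          + (cmod (of_real x * K x / (2 * c * q x)) + cmod (of_real y * K y / (2 * c * q y)))"
        using norm_triangle_ineq4[of "\<Gamma> x + \<Gamma> y" "of_real x * K x / (2 * c * q x) + of_real y * K y / (2 * c * q y)"]
          norm_triangle_ineq[of "of_real x * K x / (2 * c * q x)" "of_real y * K y / (2 * c * q y)"] by simp
      also have "\<dots> \<le> cmod (\<Gamma> x + \<Gamma> y) + s / (4 * (cmod c)\<^sup>2)"
        using err[OF order_refl] err[OF xy] e2 by linarith
      finally show ?thesis using g by (simp add: field_simps)
    qed
    show "s / (2 * (cmod c)\<^sup>2) \<le> cmod (\<Gamma> x + \<Gamma> y)" if "X \<le> x" "X \<le> y" for x y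
      using main[of x y] main[of y x] that by (cases "x \<le> y") (auto simp: add.commute)
  qed
qed

end

section \<open>The quasimode\<close>

text \<open>The mean value inequality on the segment from \<open>a\<close> to \<open>y\<close>.
  Iterating it gives Taylor estimates at the critical point; the factor \<open>1 / (n + 1)\<close>
  is given away.\<close>

lemma power_growth_bound:
  fixes g g' :: "real \<Rightarrow> real"
  assumes g: "\<And>x. 0 \<le> x \<Longrightarrow> (g has_real_derivative g' x) (at x within {0..})"
    and g': "\<And>x. 0 \<le> x \<Longrightarrow> \<bar>g' x\<bar> \<le> C * \<bar>x - a\<bar> ^ n"
    and "0 \<le> C" "g a = 0" "0 \<le> a" "0 \<le> y"
  shows "\<bar>g y\<bar> \<le> C * \<bar>y - a\<bar> ^ Suc n"
proof -
  have seg: "x \<in> closed_segment a y \<Longrightarrow> 0 \<le> x \<and> \<bar>x - a\<bar> \<le> \<bar>y - a\<bar>" for x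
    using \<open>0 \<le> a\<close> \<open>0 \<le> y\<close> by (auto simp: closed_segment_eq_real_ivl split: if_splits)
  have "norm (g y - g a) \<le> C * \<bar>y - a\<bar> ^ n * norm (y - a)"
  proof (rule field_differentiable_bound[of "closed_segment a y"])
    show "(g has_real_derivative g' x) (at x within closed_segment a y)" if "x \<in> closed_segment a y" for x
      by (rule DERIV_subset[OF g]) (use seg that in auto)
    show "norm (g' x) \<le> C * \<bar>y - a\<bar> ^ n" if "x \<in> closed_segment a y" for x
      unfolding real_norm_def
      by (rule order_trans[OF g'], use seg[OF that] in simp, rule mult_left_mono[OF power_mono])
         (use seg[OF that] \<open>0 \<le> C\<close> in auto)
  qed auto
  then show ?thesis using \<open>g a = 0\<close> by (simp add: mult_ac)
qed

text \<open>\<open>b\<close> is the quadratic Taylor coefficient of the flow at its critical point,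
  and \<open>b c^2 = - \<i>\<close> is the condition under which the Gaussian mode solves the shear
  layer equation for this coefficient.\<close>

locale critical_profile = critical_layer c for c :: complex +
  fixes \<alpha> a b A :: real and U U1 U2 U3 :: "real \<Rightarrow> real"
  assumes \<alpha>_pos: "0 < \<alpha>" and a_pos: "0 < a" and b_c: "of_real b * c\<^sup>2 = - \<i>"
    and U_deriv: "\<And>y. 0 \<le> y \<Longrightarrow> (U has_real_derivative U1 y) (at y within {0..})"
    and U1_deriv: "\<And>y. 0 \<le> y \<Longrightarrow> (U1 has_real_derivative U2 y) (at y within {0..})"
    and U2_deriv: "\<And>y. 0 \<le> y \<Longrightarrow> (U2 has_real_derivative U3 y) (at y within {0..})"
    and U3_cont: "continuous_on {0..} U3"
    and U_le: "\<And>y. 0 \<le> y \<Longrightarrow> \<bar>U y\<bar> \<le> A"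
    and U1_le: "\<And>y. 0 \<le> y \<Longrightarrow> \<bar>U1 y\<bar> \<le> A * exp (- (\<alpha> * y))"
    and U2_le: "\<And>y. 0 \<le> y \<Longrightarrow> \<bar>U2 y\<bar> \<le> A * exp (- (\<alpha> * y))"
    and U3_le: "\<And>y. 0 \<le> y \<Longrightarrow> \<bar>U3 y\<bar> \<le> A * exp (- (\<alpha> * y))"
    and U1_a: "U1 a = 0" and U2_a: "U2 a = 2 * b"
begin

abbreviation decay :: "real \<Rightarrow> real" where "decay y \<equiv> exp (- (\<alpha> * y))"

text \<open>The eigenvalue of the layer problem, equal to \<open>- \<i> / c\<close>. The growth rate
  is \<open>- Im \<tau>\<close> times \<open>sqrt k\<close>.\<close>

definition \<tau> :: complex where "\<tau> = of_real b * c"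
text \<open>With \<open>z = (y - a) / d\<close> this is \<open>d^2 * b * q z\<close> up to a cubic
  Taylor error, and \<open>\<kappa> * shear d y\<close> equals
  \<open>\<mu> + \<kappa> * U y\<close>.\<close>

definition shear :: "real \<Rightarrow> real \<Rightarrow> complex" where
  "shear d y = of_real (U y - U a) + of_real d ^ 2 * \<tau>"
text \<open>Subtracting \<open>wall d\<close> enforces \<open>om d 0 = 0\<close>, hence the boundary condition \<open>\<phi> d 0 = 0\<close>;
  it is smaller than any power of \<open>d\<close>.\<close>

definition wall :: "real \<Rightarrow> complex" where "wall d = w ((0 - a) / d) / of_real d"
definition om :: "real \<Rightarrow> real \<Rightarrow> complex" where
  "om d y = w ((y - a) / d) / of_real d - wall d * of_real (decay y)"
definition om1 :: "real \<Rightarrow> real \<Rightarrow> complex" where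
  "om1 d y = w1 ((y - a) / d) / of_real d ^ 2 + of_real \<alpha> * wall d * of_real (decay y)"
definition om2 :: "real \<Rightarrow> real \<Rightarrow> complex" where
  "om2 d y = w2 ((y - a) / d) / of_real d ^ 3 - of_real \<alpha> ^ 2 * wall d * of_real (decay y)"
definition Om :: "real \<Rightarrow> real \<Rightarrow> complex" where
  "Om d y = \<Gamma> ((y - a) / d) - \<Gamma> ((0 - a) / d) - wall d * of_real ((1 - decay y) / \<alpha>)"
definition \<phi> :: "real \<Rightarrow> real \<Rightarrow> complex" where
  "\<phi> d y = of_real (U1 y) * Om d y + shear d y * om d y"
definition \<phi>1 :: "real \<Rightarrow> real \<Rightarrow> complex" where
  "\<phi>1 d y = of_real (U2 y) * Om d y + 2 * of_real (U1 y) * om d y + shear d y * om1 d y"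
definition \<phi>2 :: "real \<Rightarrow> real \<Rightarrow> complex" where
  "\<phi>2 d y = of_real (U3 y) * Om d y + 3 * of_real (U2 y) * om d y + 3 * of_real (U1 y) * om1 d y + shear d y * om2 d y"
text \<open>The closed form that is left after the nonlocal term has cancelled;
  \<open>\<i> / d^4\<close> is \<open>\<kappa>\<close>, as \<open>d = k^(-1/4)\<close>.\<close>

definition residual :: "real \<Rightarrow> real \<Rightarrow> complex" where
  "residual d y = \<i> / of_real d ^ 4 * (shear d y ^ 2 * om d y) - \<phi>2 d y"

lemma A_nonneg: "0 \<le> A"
  using U_le[of 0] by simp

lemma exp_le_1: "0 \<le> y \<Longrightarrow> decay y \<le> 1"
  using \<alpha>_pos by simp

section \<open>Derivatives of the profile and the exact residual\<close>

lemma of_real_deriv: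
  "(f has_real_derivative f') (at y within X) \<Longrightarrow> ((\<lambda>y. complex_of_real (f y)) has_vector_derivative of_real f') (at y within X)"
  by (simp add: has_real_derivative_iff_has_vector_derivative has_vector_derivative_of_real)

lemma scaled_deriv:
  fixes g :: "real \<Rightarrow> complex"
  assumes "0 < d" and g: "\<And>z. (g has_vector_derivative g' z) (at z)"
  shows "((\<lambda>y. g ((y - a) / d)) has_vector_derivative g' ((y - a) / d) / of_real d) (at y within X)"
proof -
  have "((\<lambda>y. (y - a) / d) has_vector_derivative 1 / d) (at y within X)"
    using \<open>0 < d\<close> by (auto intro!: derivative_eq_intros simp: has_real_derivative_iff_has_vector_derivative[symmetric])
  from vector_diff_chain_within[OF this has_vector_derivative_at_within[OF g]] show ?thesis
    by (simp add: o_def scaleR_conv_of_real)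
qed

lemma exp_deriv: "((\<lambda>y. complex_of_real (decay y)) has_vector_derivative - of_real \<alpha> * of_real (decay y)) (at y within X)"
proof -
  have "((\<lambda>y. decay y) has_real_derivative - \<alpha> * decay y) (at y within X)"
    by (auto intro!: derivative_eq_intros)
  from of_real_deriv[OF this] show ?thesis by simp
qed

lemma Om_deriv: "0 < d \<Longrightarrow> (Om d has_vector_derivative om d y) (at y within X)"
proof -
  assume d: "0 < d"
  have e: "((\<lambda>y. (1 - decay y) / \<alpha>) has_real_derivative decay y) (at y within X)"
    using \<alpha>_pos by (auto intro!: derivative_eq_intros)
  have "((\<lambda>y. \<Gamma> ((y - a) / d) - \<Gamma> ((0 - a) / d) - wall d * of_real ((1 - decay y) / \<alpha>))
     has_vector_derivative w ((y - a) / d) / of_real d - 0 - wall d * of_real (decay y)) (at y within X)"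
    by (intro has_vector_derivative_diff has_vector_derivative_const has_vector_derivative_mult_right
        scaled_deriv[OF d \<Gamma>_deriv] of_real_deriv[OF e])
  then show ?thesis by (simp add: Om_def[abs_def] om_def)
qed

lemma om_deriv: "0 < d \<Longrightarrow> (om d has_vector_derivative om1 d y) (at y within X)"
proof -
  assume d: "0 < d"
  have "((\<lambda>y. 1 / of_real d * w ((y - a) / d) - wall d * of_real (decay y)) has_vector_derivative
     1 / of_real d * (w1 ((y - a) / d) / of_real d) - wall d * (- of_real \<alpha> * of_real (decay y))) (at y within X)"
    by (intro has_vector_derivative_diff has_vector_derivative_mult_right scaled_deriv[OF d w_deriv] exp_deriv)
  then show ?thesis by (simp add: om_def[abs_def] om1_def power2_eq_square mult_ac)
qed

lemma om1_deriv: "0 < d \<Longrightarrow> (om1 d has_vector_derivative om2 d y) (at y within X)"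
proof -
  assume d: "0 < d"
  have "((\<lambda>y. 1 / of_real d ^ 2 * w1 ((y - a) / d) + of_real \<alpha> * wall d * of_real (decay y)) has_vector_derivative
     1 / of_real d ^ 2 * (w2 ((y - a) / d) / of_real d) + of_real \<alpha> * wall d * (- of_real \<alpha> * of_real (decay y))) (at y within X)"
    by (intro has_vector_derivative_add has_vector_derivative_mult_right scaled_deriv[OF d w1_deriv] exp_deriv)
  then show ?thesis by (simp add: om1_def[abs_def] om2_def eval_nat_numeral mult_ac)
qed

lemma shear_deriv:
  assumes "0 \<le> y" shows "(shear d has_vector_derivative of_real (U1 y)) (at y within {0..})"
proof -
  have "((\<lambda>y. U y - U a) has_real_derivative U1 y) (at y within {0..})"
    by (auto intro!: derivative_eq_intros U_deriv assms)
  from has_vector_derivative_add[OF of_real_deriv[OF this] has_vector_derivative_const] show ?thesis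
    by (simp add: shear_def[abs_def])
qed

lemma \<phi>_antiderivative:
  assumes "0 < d" "0 \<le> y"
  shows "((\<lambda>y. shear d y * Om d y) has_vector_derivative \<phi> d y) (at y within {0..})"
  using has_vector_derivative_mult[OF shear_deriv[OF assms(2)] Om_deriv[OF assms(1)]]
  by (simp add: \<phi>_def algebra_simps)

lemma \<phi>_deriv:
  assumes "0 < d" "0 \<le> y"
  shows "(\<phi> d has_vector_derivative \<phi>1 d y) (at y within {0..})"
proof -
  have "((\<lambda>y. of_real (U1 y) * Om d y + shear d y * om d y) has_vector_derivative
      (of_real (U1 y) * om d y + of_real (U2 y) * Om d y) + (shear d y * om1 d y + of_real (U1 y) * om d y)) (at y within {0..})"
    by (intro has_vector_derivative_add has_vector_derivative_mult of_real_deriv U1_deriv shear_deriv Om_deriv om_deriv assms)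
  then show ?thesis by (simp add: \<phi>_def[abs_def] \<phi>1_def algebra_simps)
qed

lemma \<phi>1_deriv:
  assumes "0 < d" "0 \<le> y"
  shows "(\<phi>1 d has_vector_derivative \<phi>2 d y) (at y within {0..})"
proof -
  have "((\<lambda>y. of_real (U2 y) * Om d y + (2 * (of_real (U1 y) * om d y)) + shear d y * om1 d y) has_vector_derivative
      (of_real (U2 y) * om d y + of_real (U3 y) * Om d y) + 2 * (of_real (U1 y) * om1 d y + of_real (U2 y) * om d y)
      + (shear d y * om2 d y + of_real (U1 y) * om1 d y)) (at y within {0..})"
    by (intro has_vector_derivative_add has_vector_derivative_mult has_vector_derivative_mult_right of_real_deriv
        U1_deriv U2_deriv shear_deriv Om_deriv om_deriv om1_deriv assms)
  then show ?thesis by (simp add: \<phi>1_def[abs_def] \<phi>2_def algebra_simps)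
qed

lemma \<phi>_0: "\<phi> d 0 = 0" and Om_0: "Om d 0 = 0"
  by (simp_all add: \<phi>_def Om_def om_def wall_def)

lemma cont_if_deriv:
  assumes "\<And>y. 0 \<le> y \<Longrightarrow> (f has_vector_derivative f' y) (at y within {0..})"
  shows "continuous_on {0..} (f :: real \<Rightarrow> complex)"
  using assms by (auto simp: continuous_on_eq_continuous_within intro!: has_vector_derivative_continuous)

lemma \<phi>_cont: "0 < d \<Longrightarrow> continuous_on {0..} (\<phi> d)"
  by (rule cont_if_deriv[OF \<phi>_deriv])

lemma \<phi>2_cont: "0 < d \<Longrightarrow> continuous_on {0..} (\<phi>2 d)"
proof -
  assume d: "0 < d"
  have 1: "continuous_on {0..} (Om d)" by (rule cont_if_deriv[OF Om_deriv[OF d]])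
  have 2: "continuous_on {0..} (om d)" by (rule cont_if_deriv[OF om_deriv[OF d]])
  have 3: "continuous_on {0..} (om1 d)" by (rule cont_if_deriv[OF om1_deriv[OF d]])
  have 4: "continuous_on {0..} (shear d)" by (rule cont_if_deriv[OF shear_deriv])
  have q: "continuous_on X q" for X unfolding q_def by (intro continuous_intros)
  have w: "continuous_on X w" for X unfolding w_def by (intro continuous_intros K_cont q) (simp add: q_nz)
  have "continuous_on X w2" for X
    unfolding w2_def by (intro continuous_intros q w) (auto simp: q_nz)
  then have "continuous_on {0..} (\<lambda>y. w2 ((y - a) / d))"
    by (rule continuous_on_compose2) (use d in \<open>auto intro!: continuous_intros\<close>)
  then have 5: "continuous_on {0..} (om2 d)"
    unfolding om2_def using d by (intro continuous_intros) auto
  have 6: "continuous_on {0..} U1" "continuous_on {0..} U2"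
    using U1_deriv U2_deriv by (auto simp: continuous_on_eq_continuous_within intro!: DERIV_continuous)
  show ?thesis unfolding \<phi>2_def
    by (intro continuous_intros 1 2 3 4 5 6 U3_cont)
qed

lemma residual_cont: "0 < d \<Longrightarrow> continuous_on {0..} (residual d)"
  unfolding residual_def
  by (intro continuous_intros \<phi>2_cont cont_if_deriv[OF om_deriv] cont_if_deriv[OF shear_deriv]) auto

text \<open>\<open>Om d 0 = 0\<close> makes \<open>shear d y * Om d y\<close> the integral of
  \<open>\<phi> d\<close> from the wall. Hence the term \<open>U1 * Om\<close> of the profile
  cancels against the nonlocal term and only \<open>shear^2 * om\<close> survives.\<close>

lemma residual_eq:
  assumes d: "0 < d" and y: "0 \<le> y" and \<kappa>: "\<kappa> = \<i> / of_real d ^ 4" and \<mu>: "\<mu> = \<kappa> * (of_real d ^ 2 * \<tau> - of_real (U a))"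
  shows "residual d y = (\<mu> + \<kappa> * of_real (U y)) * \<phi> d y - \<kappa> * of_real (U1 y) * integral {0..y} (\<phi> d) - \<phi>2 d y"
proof -
  have "(\<phi> d has_integral shear d y * Om d y - shear d 0 * Om d 0) {0..y}"
    by (rule fundamental_theorem_of_calculus)
       (use y in \<open>auto intro!: has_vector_derivative_within_subset[OF \<phi>_antiderivative[OF d]]\<close>)
  then have I: "integral {0..y} (\<phi> d) = shear d y * Om d y" by (simp add: Om_0 integral_unique)
  have "\<mu> + \<kappa> * of_real (U y) = \<kappa> * shear d y" by (simp add: \<mu> shear_def algebra_simps)
  then show ?thesis unfolding I residual_def \<kappa>[symmetric] by (simp add: \<phi>_def algebra_simps power2_eq_square)
qed

text \<open>The bound on \<open>U3\<close> is integrated up to three times starting from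
  \<open>a\<close>, where the three remainders vanish.\<close>

lemma profile_taylor:
  assumes "0 \<le> y"
  shows "\<bar>U2 y - 2 * b\<bar> \<le> A * \<bar>y - a\<bar>"
    and "\<bar>U1 y - 2 * b * (y - a)\<bar> \<le> A * \<bar>y - a\<bar> ^ 2"
    and "\<bar>U y - U a - b * (y - a)\<^sup>2\<bar> \<le> A * \<bar>y - a\<bar> ^ 3"
proof -
  have 2: "\<bar>U2 y - 2 * b\<bar> \<le> A * \<bar>y - a\<bar> ^ Suc 0" if "0 \<le> y" for y
  proof (rule power_growth_bound[of "\<lambda>y. U2 y - 2 * b" U3])
    show "((\<lambda>y. U2 y - 2 * b) has_real_derivative U3 x) (at x within {0..})" if "0 \<le> x" for x
      by (auto intro!: derivative_eq_intros U2_deriv that)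
    show "\<bar>U3 x\<bar> \<le> A * \<bar>x - a\<bar> ^ 0" if "0 \<le> x" for x
      using U3_le[OF that] mult_left_mono[OF exp_le_1[OF that] A_nonneg] by simp
  qed (use that a_pos A_nonneg U2_a in auto)
  have 1: "\<bar>U1 y - 2 * b * (y - a)\<bar> \<le> A * \<bar>y - a\<bar> ^ Suc (Suc 0)" if "0 \<le> y" for y
  proof (rule power_growth_bound[of "\<lambda>y. U1 y - 2 * b * (y - a)" "\<lambda>y. U2 y - 2 * b"])
    show "((\<lambda>y. U1 y - 2 * b * (y - a)) has_real_derivative U2 x - 2 * b) (at x within {0..})" if "0 \<le> x" for x
      by (auto intro!: derivative_eq_intros U1_deriv that)
  qed (use 2 that a_pos A_nonneg U1_a in auto)
  have "\<bar>U y - U a - b * (y - a)\<^sup>2\<bar> \<le> A * \<bar>y - a\<bar> ^ Suc (Suc (Suc 0))"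
  proof (rule power_growth_bound[of "\<lambda>y. U y - U a - b * (y - a)\<^sup>2" "\<lambda>y. U1 y - 2 * b * (y - a)"])
    show "((\<lambda>y. U y - U a - b * (y - a)\<^sup>2) has_real_derivative U1 x - 2 * b * (x - a)) (at x within {0..})" if "0 \<le> x" for x
      by (auto intro!: derivative_eq_intros U_deriv that)
  qed (use 1 assms a_pos A_nonneg in auto)
  then show "\<bar>U y - U a - b * (y - a)\<^sup>2\<bar> \<le> A * \<bar>y - a\<bar> ^ 3" by (simp add: eval_nat_numeral)
  show "\<bar>U2 y - 2 * b\<bar> \<le> A * \<bar>y - a\<bar>" "\<bar>U1 y - 2 * b * (y - a)\<bar> \<le> A * \<bar>y - a\<bar> ^ 2"
    using 1[OF assms] 2[OF assms] by (auto simp: eval_nat_numeral)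
qed

text \<open>A multiple of \<open>mode_ode\<close>, as \<open>b c^2 = - \<i>\<close> means
  \<open>1 / c^2 = \<i> * b\<close>.\<close>

lemma layer_equation:
  "of_real b ^ 2 * q z ^ 2 * w z
    + \<i> * (6 * of_real b * w z + 6 * of_real b * of_real z * w1 z + of_real b * q z * w2 z) = 0"
proof -
  have "1 / c\<^sup>2 = \<i> * of_real b" using b_c c_nz by (simp add: field_simps)
  then have "6 * w z + 6 * of_real z * w1 z + q z * w2 z = q z ^ 2 * w z * (\<i> * of_real b)"
    using mode_ode[of z] by (metis divide_inverse inverse_eq_divide)
  then have "\<i> * of_real b * (6 * w z + 6 * of_real z * w1 z + q z * w2 z) = \<i> * of_real b * (q z ^ 2 * w z * (\<i> * of_real b))"
    by simp
  then show ?thesis by (simp add: algebra_simps power2_eq_square)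
qed

text \<open>\<open>e0\<close>, \<open>e1\<close>, \<open>e2\<close> are the Taylor errors of the
  shear, of \<open>U1\<close> and of \<open>U2\<close>. The terms free of errors add up to
  \<open>\<i> / D\<close> times the layer equation; the others contain the errors divided by
  \<open>D^3\<close>, \<open>D^2\<close> and \<open>D\<close>, which are the orders of their own
  bounds.\<close>

lemma layer_cancellation:
  fixes Z Q W W1 W2 e0 e1 e2 \<beta> D :: complex
  assumes "\<beta> ^ 2 * Q ^ 2 * W + \<i> * (6 * \<beta> * W + 6 * \<beta> * Z * W1 + \<beta> * Q * W2) = 0" and D: "D \<noteq> 0"
  shows "\<i> / D ^ 4 * ((D ^ 2 * (\<beta> * Q) + e0) ^ 2 * (W / D)) - 3 * (2 * \<beta> + e2) * (W / D)
      - 3 * (2 * \<beta> * (D * Z) + e1) * (W1 / D ^ 2) - (D ^ 2 * (\<beta> * Q) + e0) * (W2 / D ^ 3)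
    = 2 * \<i> * \<beta> * Q * (e0 / D ^ 3) * W + \<i> * (e0 ^ 2 / D ^ 5) * W - 3 * (e2 / D) * W
      - 3 * (e1 / D ^ 2) * W1 - (e0 / D ^ 3) * W2"
proof -
  have "\<i> / D ^ 4 * ((D ^ 2 * (\<beta> * Q) + e0) ^ 2 * (W / D)) - 3 * (2 * \<beta> + e2) * (W / D)
      - 3 * (2 * \<beta> * (D * Z) + e1) * (W1 / D ^ 2) - (D ^ 2 * (\<beta> * Q) + e0) * (W2 / D ^ 3)
    - (2 * \<i> * \<beta> * Q * (e0 / D ^ 3) * W + \<i> * (e0 ^ 2 / D ^ 5) * W - 3 * (e2 / D) * W
      - 3 * (e1 / D ^ 2) * W1 - (e0 / D ^ 3) * W2)
    = \<i> / D * (\<beta> ^ 2 * Q ^ 2 * W + \<i> * (6 * \<beta> * W + 6 * \<beta> * Z * W1 + \<beta> * Q * W2))"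
    using D by (simp add: field_simps eval_nat_numeral) 
  then show ?thesis by (simp add: assms(1))
qed

lemma q_le: "cmod (q z) \<le> (1 + cmod c) * (1 + \<bar>z\<bar>)\<^sup>2"
proof -
  have "cmod (q z) \<le> z\<^sup>2 + cmod c"
    unfolding q_def by (rule order_trans[OF norm_triangle_ineq]) (simp add: norm_power)
  also have "\<dots> \<le> 1 * (1 + \<bar>z\<bar>)\<^sup>2 + cmod c * (1 + \<bar>z\<bar>)\<^sup>2"
  proof (rule add_mono)
    have "1 \<le> (1 + \<bar>z\<bar>)\<^sup>2" by simp
    then show "cmod c \<le> cmod c * (1 + \<bar>z\<bar>)\<^sup>2"
      using mult_left_mono[of 1 "(1 + \<bar>z\<bar>)\<^sup>2" "cmod c"] by simp
  qed (simp add: power2_eq_square algebra_simps)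
  also have "\<dots> = (1 + cmod c) * (1 + \<bar>z\<bar>)\<^sup>2" by (simp add: distrib_right)
  finally show ?thesis .
qed

lemma shear_le:
  assumes "0 < d" "d \<le> 1" "0 \<le> y"
  shows "cmod (shear d y) \<le> 2 * A + cmod \<tau>"
proof -
  have "cmod (of_real (U y - U a)) \<le> 2 * A"
    unfolding norm_of_real using U_le[OF assms(3)] U_le[of a] a_pos by linarith
  moreover have "cmod (of_real d ^ 2 * \<tau>) \<le> 1 * cmod \<tau>"
    unfolding norm_mult norm_power norm_of_real using assms by (intro mult_right_mono) (auto simp: power_le_one)
  ultimately show ?thesis unfolding shear_def by (intro norm_triangle_le) simp
qed

text \<open>The constants must not depend on \<open>d\<close>. The Gaussian part is controlled by
  \<open>layer_cancellation\<close>, the wall correction by its smallness, and the part containing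
  \<open>Om\<close>, which does not decay away from the layer, by the decay of the derivatives of
  the flow. The two bounds of order \<open>d\<close> serve the lower bound for the profile.\<close>

lemma quasimode_bounds:
  obtains M N where "0 < M" "0 < N"
    "\<And>d y. 0 < d \<Longrightarrow> d \<le> 1 \<Longrightarrow> 0 \<le> y \<Longrightarrow> cmod (\<phi> d y) \<le> M * decay y"
    "\<And>d y. 0 < d \<Longrightarrow> d \<le> 1 \<Longrightarrow> 0 \<le> y \<Longrightarrow> cmod (residual d y) \<le> M * decay y"
    "\<And>d y. 0 < d \<Longrightarrow> d \<le> 1 \<Longrightarrow> 0 \<le> y \<Longrightarrow> cmod (shear d y * om d y) \<le> d * N"
    "\<And>d. 0 < d \<Longrightarrow> d \<le> 1 \<Longrightarrow> cmod (wall d) \<le> d * N"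
proof -
  obtain C1 where C1: "0 < C1"
    "\<And>z. (1 + \<bar>z\<bar>) ^ 6 * exp (\<alpha> * \<bar>z\<bar>) * cmod (w z) \<le> C1"
    "\<And>z. (1 + \<bar>z\<bar>) ^ 6 * exp (\<alpha> * \<bar>z\<bar>) * cmod (w1 z) \<le> C1"
    "\<And>z. (1 + \<bar>z\<bar>) ^ 6 * exp (\<alpha> * \<bar>z\<bar>) * cmod (w2 z) \<le> C1"
    using mode_decay[OF \<alpha>_pos] by metis
  obtain CG where CG: "\<And>z. cmod (\<Gamma> z) \<le> CG" using \<Gamma>_bound by metis
  define C2 where "C2 = C1 * exp (\<alpha> * a)"
  have C2: "0 < C2" using C1 by (simp add: C2_def)
  define e where "e y = decay y" for y
  have e_pos: "0 < e y" for y by (simp add: e_def)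
  \<comment> \<open>As \<open>d \<le> 1\<close>, \<open>y - a\<close> is at most
    \<open>\<bar>z\<bar>\<close>. So the exponential weight in the layer variable dominates the one
    in \<open>y\<close>, up to the factor \<open>exp (\<alpha> * a)\<close> collected in
    \<open>C2\<close>.\<close>
  have decay: "(1 + \<bar>z\<bar>) ^ n * X \<le> C2 * e y"
    if X: "(1 + \<bar>z\<bar>) ^ 6 * exp (\<alpha> * \<bar>z\<bar>) * X \<le> C1" "0 \<le> X" and d: "0 < d" "d \<le> 1" "z = (y - a) / d" and n: "n \<le> 6" for z X d y n
  proof -
    have "y - a \<le> \<bar>z\<bar>"
    proof -
      have "y - a \<le> \<bar>y - a\<bar>" by simp
      also have "\<dots> \<le> \<bar>y - a\<bar> / d" using d by (simp add: pos_le_divide_eq mult_left_le)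
      finally show ?thesis using d by (simp add: abs_divide)
    qed
    then have "exp (\<alpha> * y) \<le> exp (\<alpha> * a) * exp (\<alpha> * \<bar>z\<bar>)"
      using \<alpha>_pos by (simp add: distrib_left[symmetric] flip: exp_add)
    then have 1: "1 \<le> exp (\<alpha> * a) * exp (\<alpha> * \<bar>z\<bar>) * e y"
      by (simp add: e_def exp_minus field_simps)
    have "(1 + \<bar>z\<bar>) ^ n * X \<le> (1 + \<bar>z\<bar>) ^ 6 * X"
      using n X(2) by (intro mult_right_mono power_increasing) auto
    also have "\<dots> = ((1 + \<bar>z\<bar>) ^ 6 * X) * 1" by simp
    also have "\<dots> \<le> ((1 + \<bar>z\<bar>) ^ 6 * X) * (exp (\<alpha> * a) * exp (\<alpha> * \<bar>z\<bar>) * e y)"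
      using X(2) by (intro mult_left_mono 1) auto
    also have "\<dots> = ((1 + \<bar>z\<bar>) ^ 6 * exp (\<alpha> * \<bar>z\<bar>) * X) * (exp (\<alpha> * a) * e y)" by (simp add: mult_ac)
    also have "\<dots> \<le> C1 * (exp (\<alpha> * a) * e y)" using e_pos[of y] by (intro mult_right_mono X(1)) auto
    finally show ?thesis by (simp add: C2_def mult_ac)
  qed
  define C3 where "C3 = C1 / a ^ 5"
  have C3: "0 < C3" using C1 a_pos by (simp add: C3_def)
  \<comment> \<open>Four powers of \<open>d\<close> are needed against the factor
    \<open>1 / d^4\<close> in the residual, and one more against the factor \<open>1 / d\<close> in
    \<open>wall\<close>; at the wall \<open>\<bar>z\<bar> = a / d\<close>, so five powers come from
    the polynomial weight.\<close>
  have wall4: "cmod (wall d) \<le> C3 * d ^ 4" if d: "0 < d" "d \<le> 1" for d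
  proof -
    let ?z = "(0 - a) / d"
    have az: "\<bar>?z\<bar> = a / d" using d a_pos by simp
    have "\<bar>?z\<bar> ^ 5 * 1 \<le> (1 + \<bar>?z\<bar>) ^ 6 * exp (\<alpha> * \<bar>?z\<bar>)"
    proof (rule mult_mono)
      have "\<bar>?z\<bar> ^ 5 \<le> (1 + \<bar>?z\<bar>) ^ 5" by (intro power_mono) auto
      also have "\<dots> \<le> (1 + \<bar>?z\<bar>) ^ 6" by (intro power_increasing) auto
      finally show "\<bar>?z\<bar> ^ 5 \<le> (1 + \<bar>?z\<bar>) ^ 6" .
      show "1 \<le> exp (\<alpha> * \<bar>?z\<bar>)" using \<alpha>_pos by simp
    qed auto
    from mult_right_mono[OF this norm_ge_zero[of "w ?z"]] C1(2)[of ?z]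
    have "(a / d) ^ 5 * cmod (w ?z) \<le> C1" unfolding az by linarith
    then have "cmod (w ?z) \<le> C1 * (d / a) ^ 5" using d a_pos by (simp add: field_simps)
    moreover have "cmod (wall d) = cmod (w ?z) / d" using d by (simp add: wall_def norm_divide)
    ultimately have "cmod (wall d) \<le> C1 * (d / a) ^ 5 / d" using d by (simp add: divide_right_mono)
    also have "\<dots> = C3 * d ^ 4" using d a_pos by (simp add: C3_def power_divide eval_nat_numeral)
    finally show ?thesis .
  qed
  have wall1: "cmod (wall d) \<le> C3 * d" and wall0: "cmod (wall d) \<le> C3" if d: "0 < d" "d \<le> 1" for d
  proof -
    have "d ^ 4 \<le> d ^ 1" by (rule power_decreasing) (use d in auto)
    then have "C3 * d ^ 4 \<le> C3 * d" using C3 by (intro mult_left_mono) auto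
    then show 1: "cmod (wall d) \<le> C3 * d" using wall4[OF d] by linarith
    have "C3 * d \<le> C3 * 1" using C3 d by (intro mult_left_mono) auto
    then show "cmod (wall d) \<le> C3" using 1 by linarith
  qed
  define B0 where "B0 = 2 * A + cmod \<tau>"
  have B0: "0 \<le> B0" using A_nonneg by (simp add: B0_def)
  define Q0 where "Q0 = \<bar>b\<bar> * (1 + cmod c)"
  have Q0: "0 \<le> Q0" by (simp add: Q0_def)
  have taylor: "\<exists>e0 e1 e2 :: complex. shear d y = of_real d ^ 2 * (of_real b * q ((y - a) / d)) + e0 \<and>
      of_real (U1 y) = 2 * of_real b * (of_real d * of_real ((y - a) / d)) + e1 \<and> of_real (U2 y) = 2 * of_real b + e2 \<and>
      cmod e0 \<le> A * (d * (1 + \<bar>(y - a) / d\<bar>)) ^ 3 \<and> cmod e1 \<le> A * (d * (1 + \<bar>(y - a) / d\<bar>)) ^ 2 \<and>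
      cmod e2 \<le> A * (d * (1 + \<bar>(y - a) / d\<bar>))" if d: "0 < d" "0 \<le> y" for d y
  proof (intro exI conjI)
    have ya: "\<bar>y - a\<bar> \<le> d * (1 + \<bar>(y - a) / d\<bar>)" using d by (simp add: distrib_left abs_divide)
    have le: "A * \<bar>y - a\<bar> ^ n \<le> A * (d * (1 + \<bar>(y - a) / d\<bar>)) ^ n" for n
      using A_nonneg ya by (intro mult_left_mono power_mono) auto
    show "of_real (U2 y) = 2 * of_real b + complex_of_real (U2 y - 2 * b)" by simp
    show "complex_of_real (U1 y) = 2 * of_real b * (of_real d * of_real ((y - a) / d)) + complex_of_real (U1 y - 2 * b * (y - a))"
      using d by simp
    show "shear d y = of_real d ^ 2 * (of_real b * q ((y - a) / d)) + complex_of_real (U y - U a - b * (y - a)\<^sup>2)"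
      using d by (simp add: shear_def q_def \<tau>_def field_simps)
    show "cmod (complex_of_real (U2 y - 2 * b)) \<le> A * (d * (1 + \<bar>(y - a) / d\<bar>))"
      unfolding norm_of_real using profile_taylor(1)[OF d(2)] le[of 1] by simp
    show "cmod (complex_of_real (U1 y - 2 * b * (y - a))) \<le> A * (d * (1 + \<bar>(y - a) / d\<bar>)) ^ 2"
      unfolding norm_of_real by (rule order_trans[OF profile_taylor(2)[OF d(2)] le])
    show "cmod (complex_of_real (U y - U a - b * (y - a)\<^sup>2)) \<le> A * (d * (1 + \<bar>(y - a) / d\<bar>)) ^ 3"
      unfolding norm_of_real by (rule order_trans[OF profile_taylor(3)[OF d(2)] le])
  qed
  define C4 where "C4 = (Q0 + A) * C2 + B0 * C3"
  have C4: "0 \<le> C4" using Q0 A_nonneg C2 B0 C3 by (simp add: C4_def)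
  \<comment> \<open>In the layer the shear is \<open>d^2\<close> times a polynomial in
    \<open>z\<close>, whereas \<open>om\<close> is of size \<open>1 / d\<close>.\<close>
  have shear_om: "cmod (shear d y * om d y) \<le> d * C4 * e y" if d: "0 < d" "d \<le> 1" "0 \<le> y" for d y
  proof -
    define z where "z = (y - a) / d"
    obtain e0 where e0: "shear d y = of_real d ^ 2 * (of_real b * q z) + e0" "cmod e0 \<le> A * (d * (1 + \<bar>z\<bar>)) ^ 3"
      using taylor[OF d(1,3)] unfolding z_def by blast
    have "cmod (shear d y) \<le> d\<^sup>2 * (\<bar>b\<bar> * ((1 + cmod c) * (1 + \<bar>z\<bar>)\<^sup>2)) + A * (d * (1 + \<bar>z\<bar>)) ^ 3"
    proof -
      have "cmod (of_real d ^ 2 * (of_real b * q z)) \<le> d\<^sup>2 * (\<bar>b\<bar> * ((1 + cmod c) * (1 + \<bar>z\<bar>)\<^sup>2))"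
        unfolding norm_mult norm_power norm_of_real using q_le[of z] d
        by (intro mult_mono) auto
      then show ?thesis unfolding e0(1) using e0(2) by (intro norm_triangle_le) simp
    qed
    also have "\<dots> \<le> d\<^sup>2 * (Q0 * (1 + \<bar>z\<bar>) ^ 3) + A * (d\<^sup>2 * (1 + \<bar>z\<bar>) ^ 3)"
    proof (rule add_mono)
      have "(1 + \<bar>z\<bar>) ^ 2 \<le> (1 + \<bar>z\<bar>) ^ 3" by (rule power_increasing) auto
      then show "d\<^sup>2 * (\<bar>b\<bar> * ((1 + cmod c) * (1 + \<bar>z\<bar>)\<^sup>2)) \<le> d\<^sup>2 * (Q0 * (1 + \<bar>z\<bar>) ^ 3)"
        unfolding Q0_def mult.assoc by (intro mult_left_mono) auto
      have "d ^ 3 \<le> d ^ 2" by (rule power_decreasing) (use d in auto)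
      then show "A * (d * (1 + \<bar>z\<bar>)) ^ 3 \<le> A * (d\<^sup>2 * (1 + \<bar>z\<bar>) ^ 3)"
        unfolding power_mult_distrib using A_nonneg by (intro mult_left_mono mult_right_mono) auto
    qed
    also have "\<dots> = d\<^sup>2 * ((Q0 + A) * (1 + \<bar>z\<bar>) ^ 3)" by (simp add: algebra_simps)
    finally have s: "cmod (shear d y) \<le> d\<^sup>2 * ((Q0 + A) * (1 + \<bar>z\<bar>) ^ 3)" .
    have 1: "cmod (shear d y * (w z / of_real d)) \<le> d * (Q0 + A) * C2 * e y"
    proof -
      have "cmod (shear d y * (w z / of_real d)) = cmod (shear d y) * (cmod (w z) / d)"
        using d by (simp add: norm_mult norm_divide)
      also have "\<dots> \<le> d\<^sup>2 * ((Q0 + A) * (1 + \<bar>z\<bar>) ^ 3) * (cmod (w z) / d)"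
        by (rule mult_right_mono[OF s]) (use d in auto)
      also have "\<dots> = d * (Q0 + A) * ((1 + \<bar>z\<bar>) ^ 3 * cmod (w z))" using d by (simp add: power2_eq_square)
      also have "\<dots> \<le> d * (Q0 + A) * (C2 * e y)"
        by (intro mult_left_mono decay[OF C1(2) _ d(1,2) z_def]) (use d Q0 A_nonneg in auto)
      finally show ?thesis by simp
    qed
    have 2: "cmod (shear d y * (wall d * of_real (e y))) \<le> B0 * (C3 * d * e y)"
    proof -
      have "cmod (shear d y * (wall d * of_real (e y))) = cmod (shear d y) * (cmod (wall d) * e y)"
        using e_pos[of y] by (simp add: norm_mult)
      also have "\<dots> \<le> B0 * (C3 * d * e y)"
        using shear_le[OF d] wall1[OF d(1,2)] e_pos[of y] B0
        by (intro mult_mono mult_right_mono) (auto simp: B0_def)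
      finally show ?thesis .
    qed
    have "shear d y * om d y = shear d y * (w z / of_real d) - shear d y * (wall d * of_real (e y))"
      by (simp add: om_def z_def e_def algebra_simps)
    also have "cmod \<dots> \<le> d * (Q0 + A) * C2 * e y + B0 * (C3 * d * e y)"
      by (rule norm_triangle_le_diff) (use 1 2 in simp)
    also have "\<dots> = d * C4 * e y" by (simp add: C4_def algebra_simps)
    finally show ?thesis .
  qed
  define C5 where "C5 = 2 * CG + C3 / \<alpha>"
  have CG0: "0 \<le> CG" using CG[of 0] norm_ge_zero[of "\<Gamma> 0"] by linarith
  have C5: "0 \<le> C5" using C3 \<alpha>_pos CG0 by (simp add: C5_def)
  have Om_le: "cmod (Om d y) \<le> C5" if d: "0 < d" "d \<le> 1" "0 \<le> y" for d y
  proof -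
    have "cmod (wall d * of_real ((1 - e y) / \<alpha>)) \<le> C3 * (1 / \<alpha>)"
      unfolding norm_mult norm_of_real
    proof (rule mult_mono[OF wall0[OF d(1,2)]])
      have "e y \<le> 1" using exp_le_1[OF d(3)] by (simp add: e_def)
      then show "\<bar>(1 - e y) / \<alpha>\<bar> \<le> 1 / \<alpha>" using \<alpha>_pos e_pos[of y] by (simp add: divide_right_mono)
    qed (use C3 in auto)
    then have "cmod (\<Gamma> ((y - a) / d)) + cmod (\<Gamma> ((0 - a) / d)) + cmod (wall d * of_real ((1 - e y) / \<alpha>)) \<le> CG + CG + C3 * (1 / \<alpha>)"
      using CG by (intro add_mono) auto
    then show ?thesis
      unfolding Om_def e_def C5_def
      by (intro norm_triangle_le_diff order_trans[OF add_mono[OF norm_triangle_ineq4 order_refl]]) simp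
  qed
  have U_Om: "cmod (of_real u * Om d y) \<le> A * C5 * e y"
    if "\<bar>u\<bar> \<le> A * e y" "0 < d" "d \<le> 1" "0 \<le> y" for u d y
  proof -
    have "cmod (of_real u * Om d y) \<le> (A * e y) * C5"
      unfolding norm_mult norm_of_real by (rule mult_mono) (use that Om_le A_nonneg e_pos[of y] in auto)
    then show ?thesis by (simp add: mult_ac)
  qed
  have \<phi>_le: "cmod (\<phi> d y) \<le> (A * C5 + C4) * e y" if d: "0 < d" "d \<le> 1" "0 \<le> y" for d y
  proof -
    have "cmod (of_real (U1 y) * Om d y) \<le> A * C5 * e y"
      by (rule U_Om[OF _ d]) (use U1_le[OF d(3)] in \<open>simp add: e_def\<close>)
    moreover have "d * C4 * e y \<le> 1 * C4 * e y"
      using d C4 e_pos[of y] by (intro mult_right_mono) auto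
    ultimately show ?thesis
      unfolding \<phi>_def distrib_right using shear_om[OF d] by (intro norm_triangle_le) simp
  qed
  define C6 where "C6 = 2 * Q0 * A + A\<^sup>2 + 3 * A + 3 * A + A"
  have C6: "0 \<le> C6" using Q0 A_nonneg by (simp add: C6_def)
  define C7 where "C7 = B0\<^sup>2 * C3 + 3 * A * C3 + 3 * A * \<alpha> * C3 + B0 * \<alpha>\<^sup>2 * C3"
  have C7: "0 \<le> C7" using B0 C3 A_nonneg \<alpha>_pos by (simp add: C7_def)
  have residual_le: "cmod (residual d y) \<le> (C6 * C2 + C7 + A * C5) * e y" if d: "0 < d" "d \<le> 1" "0 \<le> y" for d y
  proof -
    define z where "z = (y - a) / d"
    define P where "P = 1 + \<bar>z\<bar>"
    have P: "1 \<le> P" by (simp add: P_def)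
    define D where "D = complex_of_real d"
    have D: "D \<noteq> 0" "cmod D = d" using d by (auto simp: D_def)
    obtain e0 e1 e2 where e0: "shear d y = D ^ 2 * (of_real b * q z) + e0" "cmod e0 \<le> A * (d * P) ^ 3"
      and e1: "of_real (U1 y) = 2 * of_real b * (D * of_real z) + e1" "cmod e1 \<le> A * (d * P) ^ 2"
      and e2: "of_real (U2 y) = 2 * of_real b + e2" "cmod e2 \<le> A * (d * P)"
      using taylor[OF d(1,3)] unfolding z_def D_def P_def by blast
    \<comment> \<open>\<open>R1\<close> contains the contributions of the Gaussian,
      \<open>R2\<close> those of the wall correction.\<close>
    define R1 where "R1 = \<i> / D ^ 4 * (shear d y ^ 2 * (w z / D)) - 3 * of_real (U2 y) * (w z / D)
      - 3 * of_real (U1 y) * (w1 z / D ^ 2) - shear d y * (w2 z / D ^ 3)"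
    define R2 where "R2 = \<i> / D ^ 4 * (shear d y ^ 2 * (wall d * of_real (e y))) - 3 * of_real (U2 y) * (wall d * of_real (e y))
      + 3 * of_real (U1 y) * (of_real \<alpha> * (wall d * of_real (e y))) - shear d y * (of_real \<alpha> ^ 2 * (wall d * of_real (e y)))"
    have split: "residual d y = R1 - R2 - of_real (U3 y) * Om d y"
      unfolding residual_def \<phi>2_def om_def om1_def om2_def R1_def R2_def
      by (simp add: z_def D_def e_def algebra_simps)
    have R1: "R1 = 2 * \<i> * of_real b * q z * (e0 / D ^ 3) * w z + \<i> * (e0 ^ 2 / D ^ 5) * w z - 3 * (e2 / D) * w z
      - 3 * (e1 / D ^ 2) * w1 z - (e0 / D ^ 3) * w2 z"
      unfolding R1_def e0(1) e1(1) e2(1)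
      by (rule layer_cancellation[OF layer_equation D(1)])
    have f0: "cmod (e0 / D ^ 3) \<le> A * P ^ 3" and f1: "cmod (e1 / D ^ 2) \<le> A * P ^ 2" and f2: "cmod (e2 / D) \<le> A * P"
      using e0(2) e1(2) e2(2) d by (auto simp: norm_divide norm_power D(2) power_mult_distrib field_simps)
    \<comment> \<open>The quadratic error is even of order \<open>d\<close>; its weight
      \<open>P ^ 6\<close> is the largest that occurs.\<close>
    have f5: "cmod (e0 ^ 2 / D ^ 5) \<le> A\<^sup>2 * P ^ 6"
    proof -
      have "e0 ^ 2 / D ^ 5 = D * (e0 / D ^ 3) ^ 2" using D(1) by (simp add: power_divide eval_nat_numeral)
      then have "cmod (e0 ^ 2 / D ^ 5) = d * (cmod (e0 / D ^ 3))\<^sup>2" by (simp only: norm_mult norm_power D(2))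
      also have "\<dots> \<le> 1 * (A * P ^ 3)\<^sup>2" by (intro mult_mono power_mono f0) (use d in auto)
      finally show ?thesis by (simp add: power_mult_distrib)
    qed
    have pw: "P ^ n * X \<le> C2 * e y" if "X \<in> {cmod (w z), cmod (w1 z), cmod (w2 z)}" "n \<le> 6" for n X
      unfolding P_def using that C1(2-4)[of z] by (intro decay[OF _ _ d(1,2) z_def]) auto
    have g: "cmod (x * y') \<le> k * (C2 * e y)" if "cmod x \<le> k * P ^ n" "0 \<le> k" "n \<le> 6"
      "cmod y' \<in> {cmod (w z), cmod (w1 z), cmod (w2 z)}" for x y' k n
    proof -
      have "cmod (x * y') \<le> (k * P ^ n) * cmod y'" unfolding norm_mult using that by (intro mult_right_mono) auto
      also have "\<dots> = k * (P ^ n * cmod y')" by simp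
      also have "\<dots> \<le> k * (C2 * e y)" using that by (intro mult_left_mono pw) auto
      finally show ?thesis .
    qed
    have t1: "cmod (2 * \<i> * of_real b * q z * (e0 / D ^ 3) * w z) \<le> (2 * Q0 * A) * (C2 * e y)"
    proof (rule g[of _ _ 5])
      have "cmod (2 * \<i> * of_real b * q z * (e0 / D ^ 3)) = 2 * (\<bar>b\<bar> * cmod (q z)) * cmod (e0 / D ^ 3)"
        by (simp only: norm_mult) simp
      also have "\<dots> \<le> 2 * (\<bar>b\<bar> * ((1 + cmod c) * P\<^sup>2)) * (A * P ^ 3)"
        using q_le[of z] f0 P by (intro mult_mono mult_left_mono) (auto simp: P_def)
      also have "\<dots> = 2 * Q0 * A * P ^ 5" by (simp add: Q0_def eval_nat_numeral)
      finally show "cmod (2 * \<i> * of_real b * q z * (e0 / D ^ 3)) \<le> 2 * Q0 * A * P ^ 5" .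
    qed (use Q0 A_nonneg in auto)
    have t2: "cmod (\<i> * (e0 ^ 2 / D ^ 5) * w z) \<le> A\<^sup>2 * (C2 * e y)"
    proof (rule g[of _ _ 6])
      show "cmod (\<i> * (e0 ^ 2 / D ^ 5)) \<le> A\<^sup>2 * P ^ 6"
        using f5 by (simp only: norm_mult norm_ii mult_1_left)
    qed auto
    have t3: "cmod (3 * (e2 / D) * w z) \<le> (3 * A) * (C2 * e y)"
    proof (rule g[of _ _ 1])
      show "cmod (3 * (e2 / D)) \<le> 3 * A * P ^ 1"
        using f2 unfolding norm_mult norm_numeral by simp
    qed (use A_nonneg in auto)
    have t4: "cmod (3 * (e1 / D ^ 2) * w1 z) \<le> (3 * A) * (C2 * e y)"
    proof (rule g[of _ _ 2])
      show "cmod (3 * (e1 / D ^ 2)) \<le> 3 * A * P ^ 2"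
        using f1 unfolding norm_mult norm_numeral by simp
    qed (use A_nonneg in auto)
    have t5: "cmod ((e0 / D ^ 3) * w2 z) \<le> A * (C2 * e y)"
      by (rule g[of _ _ 3]) (use f0 A_nonneg in auto)
    have "cmod R1 \<le> (2 * Q0 * A) * (C2 * e y) + A\<^sup>2 * (C2 * e y) + (3 * A) * (C2 * e y) + (3 * A) * (C2 * e y) + A * (C2 * e y)"
      unfolding R1 by (intro norm_triangle_le_diff norm_triangle_le add_mono t1 t2 t3 t4 t5
          order_trans[OF norm_triangle_ineq4] order_trans[OF norm_triangle_ineq])
    then have R1_le: "cmod R1 \<le> C6 * C2 * e y" by (simp add: C6_def algebra_simps)
    have wl: "cmod (wall d * of_real (e y)) \<le> C3 * e y"
      unfolding norm_mult using wall0[OF d(1,2)] e_pos[of y] by (simp add: mult_right_mono)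
    have S: "cmod (shear d y) \<le> B0" using shear_le[OF d] by (simp add: B0_def)
    have Uj: "\<bar>U1 y\<bar> \<le> A" "\<bar>U2 y\<bar> \<le> A"
      using U1_le[OF d(3)] U2_le[OF d(3)] mult_left_mono[OF exp_le_1[OF d(3)] A_nonneg] by auto
    have h: "cmod (x * (wall d * of_real (e y))) \<le> k * (C3 * e y)" if "cmod x \<le> k" for x k
      unfolding norm_mult[of x] using wl C3 e_pos[of y] order_trans[OF norm_ge_zero that] by (intro mult_mono that) auto
    have s1: "cmod (\<i> / D ^ 4 * (shear d y ^ 2 * (wall d * of_real (e y)))) \<le> B0\<^sup>2 * (C3 * e y)"
    proof -
      have "cmod (\<i> / D ^ 4 * (shear d y ^ 2 * (wall d * of_real (e y)))) = (cmod (shear d y))\<^sup>2 * (cmod (wall d) / d ^ 4 * e y)"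
        using e_pos[of y] by (simp add: norm_mult norm_divide norm_power D(2))
      also have "\<dots> \<le> B0\<^sup>2 * (C3 * e y)"
        using S wall4[OF d(1,2)] d e_pos[of y] C3
        by (intro mult_mono power_mono) (auto simp: field_simps)
      finally show ?thesis .
    qed
    have s2: "cmod (3 * of_real (U2 y) * (wall d * of_real (e y))) \<le> (3 * A) * (C3 * e y)"
      by (rule h) (use Uj in \<open>simp add: norm_mult\<close>)
    have s3: "cmod (3 * of_real (U1 y) * (of_real \<alpha> * (wall d * of_real (e y)))) \<le> (3 * A * \<alpha>) * (C3 * e y)"
      using h[of "3 * of_real (U1 y) * of_real \<alpha>" "3 * A * \<alpha>"] Uj \<alpha>_pos by (simp add: norm_mult mult.assoc)
    have s4: "cmod (shear d y * (of_real \<alpha> ^ 2 * (wall d * of_real (e y)))) \<le> (B0 * \<alpha>\<^sup>2) * (C3 * e y)"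
      using h[of "shear d y * of_real \<alpha> ^ 2" "B0 * \<alpha>\<^sup>2"] S by (simp add: norm_mult norm_power mult.assoc mult_right_mono)
    have "cmod R2 \<le> B0\<^sup>2 * (C3 * e y) + (3 * A) * (C3 * e y) + (3 * A * \<alpha>) * (C3 * e y) + (B0 * \<alpha>\<^sup>2) * (C3 * e y)"
      unfolding R2_def by (intro norm_triangle_le_diff norm_triangle_le add_mono s1 s2 s3 s4
          order_trans[OF norm_triangle_ineq4] order_trans[OF norm_triangle_ineq])
    then have R2_le: "cmod R2 \<le> C7 * e y" by (simp add: C7_def algebra_simps)
    have "cmod (of_real (U3 y) * Om d y) \<le> A * C5 * e y"
      by (rule U_Om[OF _ d]) (use U3_le[OF d(3)] in \<open>simp add: e_def\<close>)
    with R1_le R2_le have "cmod R1 + cmod R2 + cmod (of_real (U3 y) * Om d y) \<le> (C6 * C2 + C7 + A * C5) * e y"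
      by (simp add: distrib_right)
    then show ?thesis
      unfolding split by (intro norm_triangle_le_diff order_trans[OF add_mono[OF norm_triangle_ineq4 order_refl]])
  qed
  define M where "M = 1 + (A * C5 + C4) + (C6 * C2 + C7 + A * C5)"
  have M: "(A * C5 + C4) \<le> M" "C6 * C2 + C7 + A * C5 \<le> M" "0 < M"
  proof -
    have "0 \<le> A * C5" "0 \<le> C6 * C2" using A_nonneg C5 C6 C2 by simp_all
    then show "(A * C5 + C4) \<le> M" "C6 * C2 + C7 + A * C5 \<le> M" "0 < M"
      using C4 C7 by (simp_all add: M_def)
  qed
  show ?thesis
  proof (rule that[of M "1 + C4 + C3"])
    show "0 < M" by (rule M)
    show "0 < 1 + C4 + C3" using C4 C3 by simp
    fix d :: real assume d: "0 < d" "d \<le> 1"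
    have "C3 * d \<le> d * (1 + C4 + C3)" using d C4 by (simp add: distrib_left)
    then show "cmod (wall d) \<le> d * (1 + C4 + C3)" using wall1[OF d] by linarith
    fix y :: real assume y: "0 \<le> y"
    have "(A * C5 + C4) * e y \<le> M * e y" "(C6 * C2 + C7 + A * C5) * e y \<le> M * e y"
      using M e_pos[of y] by (auto intro: mult_right_mono)
    then show "cmod (\<phi> d y) \<le> M * decay y" "cmod (residual d y) \<le> M * decay y"
      using \<phi>_le[OF d y] residual_le[OF d y] unfolding e_def by linarith+
    have "d * C4 * e y \<le> d * C4 * 1"
      using d C4 exp_le_1[OF y] by (intro mult_left_mono) (auto simp: e_def)
    also have "\<dots> \<le> d * (1 + C4 + C3)" using d C3 by (simp add: distrib_left)
    finally show "cmod (shear d y * om d y) \<le> d * (1 + C4 + C3)" using shear_om[OF d y] by linarith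
  qed
qed

lemma b_nz: "b \<noteq> 0"
  using b_c by auto

text \<open>At a fixed \<open>y1\<close> beyond \<open>a\<close> both \<open>h / d\<close> and
  \<open>a / d\<close> become large. By oddness the difference of the values of
  \<open>\<Gamma>\<close> in \<open>Om d y1\<close> is a sum, which
  \<open>\<Gamma>_sum_lower_bound\<close> keeps away from 0, and the other contributions are of
  order \<open>d\<close>.\<close>

lemma quasimode_lower_bound:
  obtains y1 m d0 where "0 \<le> y1" "0 < m" "0 < d0" "d0 \<le> 1"
    "\<And>d. 0 < d \<Longrightarrow> d \<le> d0 \<Longrightarrow> m \<le> cmod (\<phi> d y1)"
proof -
  obtain N where N: "0 < N"
    "\<And>d y. 0 < d \<Longrightarrow> d \<le> 1 \<Longrightarrow> 0 \<le> y \<Longrightarrow> cmod (shear d y * om d y) \<le> d * N"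
    "\<And>d. 0 < d \<Longrightarrow> d \<le> 1 \<Longrightarrow> cmod (wall d) \<le> d * N"
    using quasimode_bounds by metis
  obtain m0 X where X: "0 < m0" "0 < X" "\<And>x y. X \<le> x \<Longrightarrow> X \<le> y \<Longrightarrow> m0 \<le> cmod (\<Gamma> x + \<Gamma> y)"
    using \<Gamma>_sum_lower_bound by metis
  \<comment> \<open>Chosen so that \<open>A * h \<le> \<bar>b\<bar>\<close>: the Taylor error of
    \<open>U1\<close> at \<open>a + h\<close> is then at most half of its linear part, and
    \<open>U1 y1\<close> is not 0.\<close>
  define h where "h = \<bar>b\<bar> / (A + 1)"
  have h: "0 < h" using b_nz A_nonneg by (simp add: h_def)
  define y1 where "y1 = a + h"
  have y1: "0 \<le> y1" using a_pos h by (simp add: y1_def)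
  define v where "v = \<bar>U1 y1\<bar>"
  have v: "0 < v"
  proof -
    have "A * h \<le> \<bar>b\<bar>" using A_nonneg by (simp add: h_def field_simps)
    then have "A * h * h \<le> \<bar>b\<bar> * h" using h by (intro mult_right_mono) auto
    moreover have "0 < \<bar>b\<bar> * h" using b_nz h by simp
    moreover have "\<bar>2 * b * h\<bar> = 2 * (\<bar>b\<bar> * h)" using h by (simp add: abs_mult)
    moreover have "\<bar>U1 y1 - 2 * b * h\<bar> \<le> A * h * h"
      using profile_taylor(2)[OF y1] h by (simp add: y1_def power2_eq_square)
    ultimately show ?thesis unfolding v_def by linarith
  qed
  \<comment> \<open>The bounds \<open>h / X\<close> and \<open>a / X\<close> push both arguments of
    \<open>\<Gamma>\<close> beyond \<open>X\<close>; the last entry keeps the corrections below half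
    of \<open>v * m0\<close>.\<close>
  define d0 where "d0 = Min {1, h / X, a / X, v * m0 / 2 / (v * N / \<alpha> + N)}"
  have den: "0 < v * N / \<alpha> + N" using v N \<alpha>_pos by (intro add_pos_pos) auto
  have d0: "0 < d0" unfolding d0_def using h X a_pos v den by auto
  have d0_le: "d0 \<le> 1" "d0 \<le> h / X" "d0 \<le> a / X" "d0 \<le> v * m0 / 2 / (v * N / \<alpha> + N)"
    unfolding d0_def by (auto intro!: Min_le)
  show ?thesis
  proof (rule that[of y1 "v * m0 / 2" d0])
    show "0 < v * m0 / 2" using v X by simp
    fix d assume d: "0 < d" "d \<le> d0"
    have d1: "d \<le> 1" using d d0_le by simp
    have e1: "X \<le> h / d" "X \<le> a / d"
    proof -
      have "d \<le> h / X" "d \<le> a / X" using d d0_le by linarith+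
      then show "X \<le> h / d" "X \<le> a / d" using d X by (auto simp: field_simps)
    qed
    have e2: "d * (v * N / \<alpha> + N) \<le> v * m0 / 2"
    proof -
      have "d * (v * N / \<alpha> + N) \<le> d0 * (v * N / \<alpha> + N)" using d den by (intro mult_right_mono) auto
      also have "\<dots> \<le> v * m0 / 2" using d0_le(4) by (simp only: pos_le_divide_eq[OF den])
      finally show ?thesis .
    qed
    have "\<Gamma> ((0 - a) / d) = - \<Gamma> (a / d)" using \<Gamma>_minus[of "a / d"] by simp
    then have Om: "\<Gamma> (h / d) + \<Gamma> (a / d) = Om d y1 + wall d * of_real ((1 - decay y1) / \<alpha>)"
      by (simp add: Om_def y1_def)
    have "cmod (wall d * of_real ((1 - decay y1) / \<alpha>)) \<le> (d * N) * (1 / \<alpha>)"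
      unfolding norm_mult norm_of_real
      by (rule mult_mono[OF N(3)[OF d(1) d1]]) (use \<alpha>_pos y1 d N in \<open>auto simp: divide_right_mono\<close>)
    then have "m0 \<le> cmod (Om d y1) + d * N / \<alpha>"
      using X(3)[OF e1] norm_triangle_ineq[of "Om d y1" "wall d * of_real ((1 - decay y1) / \<alpha>)"]
      unfolding Om by simp
    then have "v * (m0 - d * N / \<alpha>) \<le> v * cmod (Om d y1)" using v by (intro mult_left_mono) auto
    also have "\<dots> = cmod (of_real (U1 y1) * Om d y1)" by (simp add: norm_mult v_def)
    also have "\<dots> \<le> cmod (\<phi> d y1) + cmod (shear d y1 * om d y1)"
      using norm_triangle_ineq4[of "\<phi> d y1" "shear d y1 * om d y1"] by (simp add: \<phi>_def)
    also have "\<dots> \<le> cmod (\<phi> d y1) + d * N" using N(2)[OF d(1) d1 y1] by simp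
    finally have "v * (m0 - d * N / \<alpha>) \<le> cmod (\<phi> d y1) + d * N" .
    moreover have "v * (m0 - d * N / \<alpha>) = v * m0 - d * (v * N / \<alpha>)" by (simp add: algebra_simps)
    ultimately show "v * m0 / 2 \<le> cmod (\<phi> d y1)" using e2 unfolding distrib_left by linarith
  qed (use y1 d0 d0_le in auto)
qed

end

section \<open>The semigroup\<close>

lemma wnorm_le_pointwise:
  assumes "continuous_on {0..} f" "wnorm \<alpha> f \<le> ereal M" "0 \<le> y"
  shows "cmod (f y) \<le> M * exp (- (\<alpha> * y))"
proof -
  have "AE y in halfline. ereal (exp (\<alpha> * y) * cmod (f y)) \<le> wnorm \<alpha> f"
    unfolding wnorm_def by (rule esssup_AE)
  then have "AE y in halfline. exp (\<alpha> * y) * cmod (f y) \<le> M"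
    by eventually_elim (use assms(2) in \<open>auto dest: order_trans\<close>)
  then have "exp (\<alpha> * y) * cmod (f y) \<le> M"
    by (rule AE_halfline_continuous_le[rotated]) (use assms in \<open>auto intro!: continuous_intros\<close>)
  then show ?thesis by (simp add: exp_minus field_simps)
qed

lemma pointwise_wnorm_le:
  assumes f: "continuous_on {0..} f" and le: "\<And>y. 0 \<le> y \<Longrightarrow> cmod (f y) \<le> M * exp (- (\<alpha> * y))"
  shows "W0 \<alpha> f" "wnorm \<alpha> f \<le> ereal M"
proof -
  have m: "f \<in> borel_measurable halfline"
    unfolding halfline_def by (rule continuous_imp_measurable_on_sets_lebesgue[OF f]) auto
  have "AE y in halfline. ereal (exp (\<alpha> * y) * cmod (f y)) \<le> ereal M"
  proof (rule AE_I2)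
    fix y assume "y \<in> space halfline"
    then have "0 \<le> y" by (simp add: halfline_def)
    from le[OF this] show "ereal (exp (\<alpha> * y) * cmod (f y)) \<le> ereal M" by (simp add: exp_minus field_simps)
  qed
  moreover have "(\<lambda>y. ereal (exp (\<alpha> * y) * cmod (f y))) \<in> borel_measurable halfline"
  proof -
    have "(\<lambda>y. exp (\<alpha> * y)) \<in> borel_measurable halfline"
      unfolding halfline_def
      by (rule continuous_imp_measurable_on_sets_lebesgue) (auto intro!: continuous_intros)
    with m show ?thesis by measurable
  qed
  ultimately show "wnorm \<alpha> f \<le> ereal M" unfolding wnorm_def by (intro esssup_I)
  then show "W0 \<alpha> f" using m by (auto simp: W0_def intro: le_less_trans)
qed

lemma wnorm_exp: "1 \<le> wnorm \<alpha> (\<lambda>y. complex_of_real (exp (- (\<alpha> * y))))"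
proof (rule ccontr)
  assume "\<not> ?thesis"
  then obtain M where M: "wnorm \<alpha> (\<lambda>y. complex_of_real (exp (- (\<alpha> * y)))) < ereal M" "ereal M < 1"
    using ereal_dense2 by (metis not_le)
  have "continuous_on {0..} (\<lambda>y. complex_of_real (exp (- (\<alpha> * y))))" by (intro continuous_intros)
  from wnorm_le_pointwise[OF this less_imp_le[OF M(1)], of 0] M(2) show False by simp
qed

lemma opnorm_upper: "W0 \<alpha> f \<Longrightarrow> wnorm \<alpha> f \<le> 1 \<Longrightarrow> wnorm \<alpha> (B f) \<le> opnorm \<alpha> B"
  unfolding opnorm_def by (rule SUP_upper) simp

text \<open>The test function \<open>exp (- (\<alpha> * y))\<close> has norm 1. This settles the
  finitely many small frequencies, for which time 0 alone is enough.\<close>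

lemma opnorm_id_ge_1:
  assumes "\<And>f. W0 \<alpha> f \<Longrightarrow> B f = f"
  shows "1 \<le> opnorm \<alpha> B"
proof -
  let ?f = "\<lambda>y. complex_of_real (exp (- (\<alpha> * y)))"
  have "W0 \<alpha> ?f" "wnorm \<alpha> ?f \<le> ereal 1"
    by (rule pointwise_wnorm_le; auto intro!: continuous_intros)+
  then have "wnorm \<alpha> (B ?f) \<le> opnorm \<alpha> B" by (intro opnorm_upper) (auto simp: one_ereal_def)
  then show ?thesis using assms[OF \<open>W0 \<alpha> ?f\<close>] wnorm_exp[of \<alpha>] by simp
qed

section \<open>Decay of the derivatives of the shear flow\<close>

lemma weighted_derivative:
  fixes f f' g g' :: "real \<Rightarrow> real"
  assumes y: "0 \<le> y" and f: "(f has_real_derivative f' y) (at y within {0..})"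
    and g: "(g has_real_derivative g' y) (at y within {0..})"
    and eq: "\<And>x. 0 \<le> x \<Longrightarrow> exp (\<alpha> * x) * f x = g x"
  shows "exp (\<alpha> * y) * f' y = g' y - \<alpha> * g y"
proof -
  have "((\<lambda>x. exp (\<alpha> * x) * f x) has_real_derivative exp (\<alpha> * y) * f' y + exp (\<alpha> * y) * \<alpha> * f y) (at y within {0..})"
    by (rule derivative_eq_intros f refl)+ simp
  then have "((\<lambda>x. exp (\<alpha> * x) * f x) has_vector_derivative exp (\<alpha> * y) * f' y + exp (\<alpha> * y) * \<alpha> * f y) (at y within {0..})"
    by (simp add: has_real_derivative_iff_has_vector_derivative)
  then have "(g has_vector_derivative exp (\<alpha> * y) * f' y + exp (\<alpha> * y) * \<alpha> * f y) (at y within {0..})"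
    by (rule has_vector_derivative_transform[rotated 2]) (use y eq in auto)
  moreover have "at y within {0..} \<noteq> bot"
  proof -
    have "at_right y \<le> at y within {0..}" by (rule at_le) (use y in auto)
    then show ?thesis using trivial_limit_at_right_real[of y] by (auto simp: bot_unique)
  qed
  ultimately have "exp (\<alpha> * y) * f' y + exp (\<alpha> * y) * \<alpha> * f y = g' y"
    using g unfolding has_real_derivative_iff_has_vector_derivative
    by (intro vector_derivative_unique_within) auto
  then show ?thesis using eq[OF y] by (simp add: algebra_simps)
qed

lemma W4alpha_profile:
  assumes \<alpha>: "0 < \<alpha>" and Us: "W4alpha \<alpha> Us"
  obtains U U1 U2 U3 A where "\<And>y. 0 \<le> y \<Longrightarrow> U y = Us y"
    "\<And>y. 0 \<le> y \<Longrightarrow> (U has_real_derivative U1 y) (at y within {0..})"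
    "\<And>y. 0 \<le> y \<Longrightarrow> (U1 has_real_derivative U2 y) (at y within {0..})"
    "\<And>y. 0 \<le> y \<Longrightarrow> (U2 has_real_derivative U3 y) (at y within {0..})"
    "continuous_on {0..} U3"
    "\<And>y. 0 \<le> y \<Longrightarrow> \<bar>U y\<bar> \<le> A"
    "\<And>y. 0 \<le> y \<Longrightarrow> \<bar>U1 y\<bar> \<le> A * exp (- (\<alpha> * y))"
    "\<And>y. 0 \<le> y \<Longrightarrow> \<bar>U2 y\<bar> \<le> A * exp (- (\<alpha> * y))"
    "\<And>y. 0 \<le> y \<Longrightarrow> \<bar>U3 y\<bar> \<le> A * exp (- (\<alpha> * y))"
proof -
  obtain D L where D: "\<And>y. 0 \<le> y \<Longrightarrow> D 0 y = Us y"
      "\<And>j y. j < 3 \<Longrightarrow> 0 \<le> y \<Longrightarrow> (D j has_real_derivative D (Suc j) y) (at y within {0..})"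
      "\<And>j. j \<le> 3 \<Longrightarrow> bounded (D j ` {0..})" "lipschitz_on L {0..} (D 3)"
    using Us unfolding W4alpha_def W4inf_def by metis
  obtain E where E: "\<And>y. 0 \<le> y \<Longrightarrow> E 0 y = exp (\<alpha> * y) * Us y"
      "\<And>j y. j < 3 \<Longrightarrow> 0 \<le> y \<Longrightarrow> (E j has_real_derivative E (Suc j) y) (at y within {0..})"
      "\<And>j. j \<le> 3 \<Longrightarrow> bounded (E j ` {0..})"
    using Us unfolding W4alpha_def W4inf_def by metis
  obtain C where C: "\<And>y. 0 \<le> y \<Longrightarrow> \<bar>D 0 y\<bar> \<le> C"
    using D(3)[of 0] unfolding bounded_iff by auto
  have "\<exists>e. \<forall>y\<ge>0. \<bar>E j y\<bar> \<le> e" if "j \<le> 3" for j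
    using E(3)[OF that] unfolding bounded_iff by auto
  then obtain e where e: "\<And>j y. j \<le> 3 \<Longrightarrow> 0 \<le> y \<Longrightarrow> \<bar>E j y\<bar> \<le> e j" by metis
  \<comment> \<open>\<open>X1\<close>, \<open>X2\<close>, \<open>X3\<close> are
    \<open>exp (\<alpha> * y)\<close> times the derivatives of the flow. They come from solving the
    product rule recursively for the bounded derivatives \<open>E j\<close> of the weighted flow,
    which is how boundedness becomes decay.\<close>
  define X1 where "X1 = (\<lambda>y. E 1 y - \<alpha> * E 0 y)"
  define X2 where "X2 = (\<lambda>y. E 2 y - \<alpha> * E 1 y - \<alpha> * X1 y)"
  define X3 where "X3 = (\<lambda>y. E 3 y - \<alpha> * E 2 y - \<alpha> * (E 2 y - \<alpha> * E 1 y) - \<alpha> * X2 y)"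
  have E_der: "(E 0 has_real_derivative E 1 y) (at y within {0..})" "(E 1 has_real_derivative E 2 y) (at y within {0..})"
      "(E 2 has_real_derivative E 3 y) (at y within {0..})" if "0 \<le> y" for y
    using E(2)[of 0 y] E(2)[of 1 y] E(2)[of 2 y] that by (auto simp: numeral_2_eq_2 numeral_3_eq_3)
  have D_der: "(D 0 has_real_derivative D 1 y) (at y within {0..})" "(D 1 has_real_derivative D 2 y) (at y within {0..})"
      "(D 2 has_real_derivative D 3 y) (at y within {0..})" if "0 \<le> y" for y
    using D(2)[of 0 y] D(2)[of 1 y] D(2)[of 2 y] that by (auto simp: numeral_2_eq_2 numeral_3_eq_3)
  have w1: "exp (\<alpha> * y) * D 1 y = X1 y" if "0 \<le> y" for y
    unfolding X1_def by (rule weighted_derivative[where f = "D 0" and f' = "D 1" and g = "E 0" and g' = "E 1"]) (use that D(1) E(1) D_der E_der in auto)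
  have X1_der: "(X1 has_real_derivative E 2 y - \<alpha> * E 1 y) (at y within {0..})" if "0 \<le> y" for y
    unfolding X1_def by (auto intro!: derivative_eq_intros E_der that simp del: One_nat_def)
  have w2: "exp (\<alpha> * y) * D 2 y = X2 y" if "0 \<le> y" for y
    unfolding X2_def by (rule weighted_derivative[where f = "D 1" and f' = "D 2" and g = X1 and g' = "\<lambda>y. E 2 y - \<alpha> * E 1 y"]) (use that w1 D_der X1_der in auto)
  have X2_der: "(X2 has_real_derivative E 3 y - \<alpha> * E 2 y - \<alpha> * (E 2 y - \<alpha> * E 1 y)) (at y within {0..})" if "0 \<le> y" for y
    unfolding X2_def by (auto intro!: derivative_eq_intros E_der X1_der that simp del: One_nat_def)
  have w3: "exp (\<alpha> * y) * D 3 y = X3 y" if "0 \<le> y" for y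
    unfolding X3_def by (rule weighted_derivative[where f = "D 2" and f' = "D 3" and g = X2 and g' = "\<lambda>y. E 3 y - \<alpha> * E 2 y - \<alpha> * (E 2 y - \<alpha> * E 1 y)"]) (use that w2 D_der X2_der in auto)
  define x1 where "x1 = e 1 + \<alpha> * e 0"
  define x2 where "x2 = e 2 + \<alpha> * e 1 + \<alpha> * x1"
  define x3 where "x3 = e 3 + \<alpha> * e 2 + \<alpha> * (e 2 + \<alpha> * e 1) + \<alpha> * x2"
  have tri: "\<bar>p - \<alpha> * q\<bar> \<le> P + \<alpha> * Q" if "\<bar>p\<bar> \<le> P" "\<bar>q\<bar> \<le> Q" for p q P Q
  proof -
    have "\<bar>\<alpha> * q\<bar> \<le> \<alpha> * Q" using that(2) \<alpha> by (simp add: abs_mult)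
    then show ?thesis using that(1) by linarith
  qed
  have b1: "\<bar>X1 y\<bar> \<le> x1" if "0 \<le> y" for y unfolding X1_def x1_def by (intro tri e that) auto
  have b2: "\<bar>X2 y\<bar> \<le> x2" if "0 \<le> y" for y unfolding X2_def x2_def by (intro tri e b1 that) auto
  have b3: "\<bar>X3 y\<bar> \<le> x3" if "0 \<le> y" for y unfolding X3_def x3_def by (intro tri e b2 that) auto
  have "0 \<le> x1" "0 \<le> x2" "0 \<le> x3" "0 \<le> C"
    using b1[of 0] b2[of 0] b3[of 0] C[of 0] by linarith+
  then have A: "x1 \<le> C + x1 + x2 + x3" "x2 \<le> C + x1 + x2 + x3" "x3 \<le> C + x1 + x2 + x3" "C \<le> C + x1 + x2 + x3" by auto
  have fin: "\<bar>f\<bar> \<le> (C + x1 + x2 + x3) * exp (- (\<alpha> * y))"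
    if "exp (\<alpha> * y) * f = X" "\<bar>X\<bar> \<le> x" "x \<le> C + x1 + x2 + x3" for f X x y
  proof -
    have "exp (\<alpha> * y) * \<bar>f\<bar> = \<bar>X\<bar>" unfolding that(1)[symmetric] by (simp add: abs_mult)
    then have "exp (\<alpha> * y) * \<bar>f\<bar> \<le> C + x1 + x2 + x3" using that by linarith
    then show ?thesis by (simp add: exp_minus field_simps)
  qed
  show ?thesis
  proof (rule that[of "D 0" "D 1" "D 2" "D 3" "C + x1 + x2 + x3"])
    show "continuous_on {0..} (D 3)" by (rule lipschitz_on_continuous_on[OF D(4)])
    show "\<bar>D 0 y\<bar> \<le> C + x1 + x2 + x3" if "0 \<le> y" for y by (rule order_trans[OF C[OF that] A(4)])
    show "\<bar>D 1 y\<bar> \<le> (C + x1 + x2 + x3) * exp (- (\<alpha> * y))" if "0 \<le> y" for y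
      by (rule fin[OF w1[OF that] b1[OF that] A(1)])
    show "\<bar>D 2 y\<bar> \<le> (C + x1 + x2 + x3) * exp (- (\<alpha> * y))" if "0 \<le> y" for y
      by (rule fin[OF w2[OF that] b2[OF that] A(2)])
    show "\<bar>D 3 y\<bar> \<le> (C + x1 + x2 + x3) * exp (- (\<alpha> * y))" if "0 \<le> y" for y
      by (rule fin[OF w3[OF that] b3[OF that] A(3)])
  qed (use D(1) D_der in auto)
qed

context shear_flow
begin

text \<open>Integrating the divergence condition from the wall gives \<open>v\<close> as
  \<open>- \<kappa>\<close> times the integral of \<open>u\<close>. The essential bound on
  \<open>u t\<close> holds pointwise because \<open>u t\<close> is continuous for positive
  times.\<close>

lemma prandtl_strong_sol:
  assumes \<kappa>: "\<kappa> = \<i> * of_nat k" and Us: "\<And>y. 0 < y \<Longrightarrow> Us y = U y" "\<And>y. 0 < y \<Longrightarrow> deriv Us y = U1 y"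
    and u: "prandtl_sol Us k u" and bd: "\<And>T0. \<exists>M. \<forall>t\<in>{0..T0}. wnorm \<alpha> (u t) \<le> ereal M"
  shows "strong_sol 0 u"
proof -
  obtain ut uy uyy v where cu: "continuous_on ({0<..} \<times> {0..}) (\<lambda>(t,y). u t y)"
    and cont: "continuous_on ({0<..} \<times> {0<..}) (\<lambda>(t,y). ut t y)"
        "continuous_on ({0<..} \<times> {0<..}) (\<lambda>(t,y). uy t y)"
        "continuous_on ({0<..} \<times> {0<..}) (\<lambda>(t,y). uyy t y)"
    and eq: "\<forall>t>0. \<forall>y>0.
           ((\<lambda>s. u s y) has_vector_derivative ut t y) (at t) \<and>
           ((\<lambda>z. u t z) has_vector_derivative uy t y) (at y) \<and>
           ((\<lambda>z. uy t z) has_vector_derivative uyy t y) (at y) \<and>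
           ut t y + \<i> * of_nat k * of_real (Us y) * u t y
             + v t y * of_real (deriv Us y) - uyy t y = 0"
    and v: "\<And>t y. 0 < t \<Longrightarrow> 0 \<le> y \<Longrightarrow> (v t has_vector_derivative - (\<i> * of_nat k * u t y)) (at y within {0..})"
    and zero: "\<And>t. 0 < t \<Longrightarrow> u t 0 = 0" "\<And>t. 0 < t \<Longrightarrow> v t 0 = 0"
    using u unfolding prandtl_sol_def by blast
  have cu1: "continuous_on {0..} (u t)" if "0 < t" for t
  proof -
    have "continuous_on {0..} (\<lambda>y. case (t, y) of (t, y) \<Rightarrow> u t y)"
      by (rule continuous_on_compose2[OF cu]) (use that in \<open>auto intro!: continuous_intros\<close>)
    then show ?thesis by simp
  qed
  have "tame u"
    unfolding tame_def
  proof (intro conjI allI impI)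
    fix T0
    obtain M where M: "\<forall>t\<in>{0..T0}. wnorm \<alpha> (u t) \<le> ereal M" using bd by metis
    have "cmod (u t y) \<le> M * decay y" if "0 < t" "t \<le> T0" "0 \<le> y" for t y
      by (rule wnorm_le_pointwise[OF cu1]) (use that M in auto)
    then show "\<exists>M. \<forall>t y. 0 < t \<longrightarrow> t \<le> T0 \<longrightarrow> 0 \<le> y \<longrightarrow> cmod (u t y) \<le> M * decay y" by blast
  qed (use cu zero in auto)
  moreover have "ut t y = uyy t y - (0 + \<kappa> * U y) * u t y + \<kappa> * U1 y * integral {0..y} (u t)" if ty: "0 < t" "0 < y" for t y
  proof -
    have "((\<lambda>z. - (\<i> * of_nat k * u t z)) has_integral v t y - v t 0) {0..y}"
      by (rule fundamental_theorem_of_calculus) (use ty in \<open>auto intro!: has_vector_derivative_within_subset[OF v]\<close>)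
    from integral_unique[OF this] have "v t y = - \<kappa> * integral {0..y} (u t)"
      by (simp add: \<kappa> zero(2)[OF ty(1)])
    then show ?thesis using eq[rule_format, OF ty] Us[OF ty(2)] by (simp add: \<kappa> algebra_simps eq_diff_eq)
  qed
  ultimately show ?thesis
    unfolding strong_sol_def classical_sol_def using cont eq
    by (intro conjI exI[of _ ut] exI[of _ uy] exI[of _ uyy]) auto
qed

end

lemma opnorm_le_imp_pointwise:
  assumes "W0 \<alpha> f" "wnorm \<alpha> f \<le> 1" "continuous_on {0..} (B f)" "0 \<le> y"
    and "ereal e * opnorm \<alpha> B \<le> ereal c" "0 < e"
  shows "cmod (B f y) \<le> c / e * exp (- (\<alpha> * y))"
proof (rule wnorm_le_pointwise[OF assms(3) _ assms(4)])
  have "ereal e * wnorm \<alpha> (B f) \<le> ereal e * opnorm \<alpha> B"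
    using opnorm_upper[OF assms(1,2)] \<open>0 < e\<close> by (intro ereal_mult_left_mono) auto
  also note assms(5)
  finally show "wnorm \<alpha> (B f) \<le> ereal (c / e)"
    using \<open>0 < e\<close> by (cases "wnorm \<alpha> (B f)") (auto simp: field_simps)
qed

context critical_profile
begin

text \<open>The form used is the contrapositive: an assumed bound on the semigroup forces the
  profile to be small. The first summand is the orbit of the profile at time \<open>t\<close>, the
  second the time integral of the orbit of the residual, both damped by
  \<open>exp (- \<mu> t)\<close>.\<close>

lemma semigroup_lower_bound:
  fixes T :: "nat \<Rightarrow> real \<Rightarrow> (real \<Rightarrow> complex) \<Rightarrow> real \<Rightarrow> complex"
  assumes sg: "prandtl_semigroup \<alpha> Us T"
    and Us: "\<And>y. 0 < y \<Longrightarrow> Us y = U y" "\<And>y. 0 < y \<Longrightarrow> deriv Us y = U1 y"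
    and d: "0 < d" "d \<le> 1" and k: "of_nat k * d ^ 4 = (1::real)"
    and M: "0 < M" "\<And>y. 0 \<le> y \<Longrightarrow> cmod (\<phi> d y) \<le> M * decay y"
      "\<And>y. 0 \<le> y \<Longrightarrow> cmod (residual d y) \<le> M * decay y"
    and C: "0 \<le> C" and s: "s = - Im \<tau>" "\<sigma> < s" and t: "0 < t"
    and op: "\<And>t'. 0 \<le> t' \<Longrightarrow> t' \<le> t \<Longrightarrow> ereal (exp (- \<sigma> * t' * sqrt (real k))) * opnorm \<alpha> (T k t') \<le> ereal (C * sqrt (real k))"
    and y: "0 \<le> y"
  shows "cmod (\<phi> d y) \<le> M * (C * sqrt (real k) * exp (- ((s - \<sigma>) * sqrt (real k) * t)) + C / (s - \<sigma>))"
proof -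
  define r where "r = sqrt (real k)"
  have k0: "0 < k" using k by (cases k) auto
  have r0: "0 < r" using k0 by (simp add: r_def)
  \<comment> \<open>Hence \<open>k * d^2 = sqrt k\<close>, which sets the scale of the growth rate
    \<open>Re \<mu>\<close>.\<close>
  have rd: "r * d ^ 2 = 1"
  proof -
    have "(r * d ^ 2) ^ 2 = 1" using k by (simp add: r_def power_mult_distrib flip: power_mult)
    then show ?thesis using r0 d by (simp add: power2_eq_1_iff) (smt (verit) mult_nonneg_nonneg zero_le_power2)
  qed
  define \<kappa> where "\<kappa> = \<i> * of_nat k"
  have \<kappa>: "\<kappa> = \<i> / of_real d ^ 4"
  proof -
    have "complex_of_real (of_nat k * d ^ 4) = 1" unfolding k by simp
    then show ?thesis using d by (simp add: \<kappa>_def field_simps)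
  qed
  define \<mu> where "\<mu> = \<kappa> * (of_real d ^ 2 * \<tau> - of_real (U a))"
  have Re_\<mu>: "Re \<mu> = s * r"
  proof -
    have "real k * d ^ 2 = r" using rd r0 by (simp add: r_def power2_eq_square field_simps)
      (metis (no_types, opaque_lifting) mult.commute mult.left_commute mult_1 of_nat_0_le_iff real_sqrt_mult_self real_sqrt_pow2 power2_eq_square)
    moreover have "Re \<mu> = - (real k * d ^ 2 * Im \<tau>)"
      by (simp add: \<mu>_def \<kappa>_def flip: of_real_power)
    ultimately show ?thesis by (simp add: s(1))
  qed
  interpret F: shear_flow \<alpha> \<kappa> U U1 A
  proof
    show "continuous_on {0..} U" "continuous_on {0..} U1"
      using U_deriv U1_deriv by (auto simp: continuous_on_eq_continuous_within intro!: DERIV_continuous)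
  qed (use \<alpha>_pos U_le U1_le in auto)
  \<comment> \<open>Division by \<open>M\<close> puts profile and residual into the unit ball, where
    the operator norm can be applied directly.\<close>
  define f1 where "f1 y = \<phi> d y / of_real M" for y
  define f2 where "f2 y = residual d y / of_real M" for y
  have f_cont: "continuous_on {0..} f1" "continuous_on {0..} f2"
    unfolding f1_def f2_def using M(1)
    by (auto intro!: continuous_intros \<phi>_cont residual_cont d)
  have f_le: "cmod (f1 y) \<le> 1 * decay y" "cmod (f2 y) \<le> 1 * decay y" if "0 \<le> y" for y
    using M(2,3)[OF that] M(1) by (auto simp: f1_def f2_def norm_divide field_simps)
  have adm: "W0 \<alpha> f \<and> wnorm \<alpha> f \<le> 1" if "f = f1 \<or> f = f2" for f
    using pointwise_wnorm_le[OF f_cont(1) f_le(1)] pointwise_wnorm_le[OF f_cont(2) f_le(2)] that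
    by (auto simp: one_ereal_def)
  have sol: "F.strong_sol 0 (\<lambda>t. T k t f)" and init: "AE y in halfline. ((\<lambda>t. T k t f y) \<longlongrightarrow> f y) (at_right 0)"
    and T0: "T k 0 f = f" if "f = f1 \<or> f = f2" for f
  proof -
    have *: "T k 0 f = f" "\<And>T0. \<exists>M. \<forall>t\<in>{0..T0}. wnorm \<alpha> (T k t f) \<le> ereal M" "prandtl_sol Us k (\<lambda>t y. T k t f y)"
        "AE y in halfline. ((\<lambda>t. T k t f y) \<longlongrightarrow> f y) (at_right 0)"
      using sg adm[OF that] unfolding prandtl_semigroup_def by blast+
    then show "T k 0 f = f" "AE y in halfline. ((\<lambda>t. T k t f y) \<longlongrightarrow> f y) (at_right 0)" by auto
    show "F.strong_sol 0 (\<lambda>t. T k t f)"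
      by (rule F.prandtl_strong_sol[OF \<kappa>_def Us *(3,2)])
  qed
  have T_le: "cmod (T k t' f y) \<le> C * r * exp (\<sigma> * r * t')" if f: "f = f1 \<or> f = f2" and t': "0 \<le> t'" "t' \<le> t" for f t'
  proof -
    have "continuous_on {0..} (T k t' f)"
    proof (cases "t' = 0")
      case True then show ?thesis using T0[OF f] f_cont f by auto
    next
      case False
      have "F.tame (\<lambda>t. T k t f)" using sol[OF f] by (simp add: F.strong_sol_def)
      from F.tame_cont_space[OF this, of t'] show ?thesis using False t' by auto
    qed
    then have "cmod (T k t' f y) \<le> C * sqrt (real k) / exp (- \<sigma> * t' * sqrt (real k)) * decay y"
      by (intro opnorm_le_imp_pointwise) (use adm[OF f] y op[OF t'] in auto)
    also have "\<dots> \<le> C * sqrt (real k) / exp (- \<sigma> * t' * sqrt (real k)) * 1"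
      using C exp_le_1[OF y] by (intro mult_left_mono) auto
    also have "\<dots> = C * r * exp (\<sigma> * r * t')"
      by (simp add: r_def exp_minus field_simps)
    finally show ?thesis .
  qed
  let ?e = "\<lambda>t::real. exp (- \<mu> * of_real t)"
  define u1 where "u1 = (\<lambda>t y. ?e t * T k t f1 y)"
  define u2 where "u2 = (\<lambda>t y. ?e t * T k t f2 y)"
  have e_norm: "cmod (?e t') = exp (- (s * r * t'))" for t' using Re_\<mu> by simp
  have u_le: "cmod (?e t' * T k t' f y) \<le> C * r * exp (- ((s - \<sigma>) * r * t'))"
    if f: "f = f1 \<or> f = f2" and t': "0 \<le> t'" "t' \<le> t" for f t'
  proof -
    have "cmod (?e t' * T k t' f y) \<le> exp (- (s * r * t')) * (C * r * exp (\<sigma> * r * t'))"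
      unfolding norm_mult e_norm by (intro mult_left_mono T_le that) auto
    also have "\<dots> = C * r * exp (- ((s - \<sigma>) * r * t'))"
      by (simp add: algebra_simps flip: exp_add)
    finally show ?thesis .
  qed
  have e_lim: "(?e \<longlongrightarrow> 1) (at_right 0)" by (auto intro!: tendsto_eq_intros)
  have shifted: "F.strong_sol \<mu> (\<lambda>t y. ?e t * T k t f y)" "AE y in halfline. ((\<lambda>t. ?e t * T k t f y) \<longlongrightarrow> f y) (at_right 0)"
    if "f = f1 \<or> f = f2" for f
  proof -
    show "F.strong_sol \<mu> (\<lambda>t y. ?e t * T k t f y)" by (rule F.strong_sol_exp_shift[OF sol[OF that]])
    show "AE y in halfline. ((\<lambda>t. ?e t * T k t f y) \<longlongrightarrow> f y) (at_right 0)"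
      using init[OF that] by eventually_elim (use tendsto_mult[OF e_lim] in force)
  qed
  have split: "f1 y = u1 t y + F.primitive u2 t y"
  proof (rule F.duhamel_stationary[where \<mu> = \<mu> and r = f2 and M = 1])
    show "continuous_on {0..} f1" "continuous_on {0..} f2" by (rule f_cont)+
    show "f1 0 = 0" by (simp add: f1_def \<phi>_0)
    show "cmod (f1 y) \<le> 1 * decay y" if "0 \<le> y" for y by (rule f_le[OF that])
    show "(f1 has_vector_derivative \<phi>1 d y / of_real M) (at y)" if "0 < y" for y
      using \<phi>_deriv[OF d(1) less_imp_le[OF that]] unfolding at_within_halfline[OF that] f1_def[abs_def]
      by (rule has_vector_derivative_divide)
    show "((\<lambda>y. \<phi>1 d y / of_real M) has_vector_derivative \<phi>2 d y / of_real M) (at y)" if "0 < y" for y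
      using \<phi>1_deriv[OF d(1) less_imp_le[OF that]] unfolding at_within_halfline[OF that]
      by (rule has_vector_derivative_divide)
    show "continuous_on {0<..} (\<lambda>y. \<phi>2 d y / of_real M)"
      using M(1) by (intro continuous_intros continuous_on_subset[OF \<phi>2_cont[OF d(1)]]) auto
    show "f2 y = (\<mu> + \<kappa> * U y) * f1 y - \<kappa> * U1 y * integral {0..y} f1 - \<phi>2 d y / of_real M" if "0 < y" for y
      unfolding f2_def residual_eq[OF d(1) less_imp_le[OF that] \<kappa> \<mu>_def] f1_def using M(1)
      by (simp add: diff_divide_distrib)
    show "F.strong_sol \<mu> u1" "AE y in halfline. ((\<lambda>t. u1 t y) \<longlongrightarrow> f1 y) (at_right 0)"
      "F.strong_sol \<mu> u2" "AE y in halfline. ((\<lambda>t. u2 t y) \<longlongrightarrow> f2 y) (at_right 0)"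
      unfolding u1_def u2_def by (intro shifted; simp)+
  qed (use t y in auto)
  have "cmod (u1 t y) \<le> C * r * exp (- ((s - \<sigma>) * r * t))"
    unfolding u1_def using t by (intro u_le) auto
  moreover have "cmod (F.primitive u2 t y) \<le> C / (s - \<sigma>)"
  proof -
    define g where "g = (s - \<sigma>) * r"
    have g: "0 < g" using s r0 by (simp add: g_def)
    have t2: "F.tame u2" using shifted(1)[of f2] by (simp add: F.strong_sol_def u2_def)
    have "((\<lambda>t'. C * r * exp (- (g * t'))) has_integral (- C * r * exp (- (g * t)) / g - (- C * r * exp (- (g * 0)) / g))) {0..t}"
      using g t
      by (intro fundamental_theorem_of_calculus)
         (auto intro!: derivative_eq_intros simp: has_real_derivative_iff_has_vector_derivative[symmetric])
    note I = this
    have "cmod (integral {0..t} (\<lambda>t'. u2 t' y)) \<le> integral {0..t} (\<lambda>t'. C * r * exp (- (g * t')))"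
    proof (rule integral_norm_bound_integral)
      have c: "continuous_on {0<..t} (\<lambda>t'. u2 t' y)"
        by (rule continuous_on_subset[OF F.tame_cont_time[OF t2 y]]) auto
      have "cmod (u2 t' y) \<le> C * r" if "0 < t'" "t' \<le> t" for t'
      proof -
        have "cmod (u2 t' y) \<le> C * r * exp (- (g * t'))" unfolding u2_def g_def using that by (intro u_le) auto
        also have "\<dots> \<le> C * r * 1" using C r0 g that by (intro mult_left_mono) auto
        finally show ?thesis by simp
      qed
      then show "(\<lambda>t'. u2 t' y) integrable_on {0..t}" by (rule integrable_on_half_open[OF c])
      show "(\<lambda>t'. C * r * exp (- (g * t'))) integrable_on {0..t}" using I by blast
      show "cmod (u2 t' y) \<le> C * r * exp (- (g * t'))" if "t' \<in> {0..t}" for t'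
        unfolding u2_def g_def using that by (intro u_le) auto
    qed
    \<comment> \<open>The rate \<open>g = (s - \<sigma>) * r\<close> of the exponential contains
      \<open>r\<close>, so integration in time removes the factor \<open>sqrt k\<close> of the
      assumed bound.\<close>
    also have "\<dots> = C * r / g * (1 - exp (- (g * t)))"
      using integral_unique[OF I] g by (simp add: field_simps)
    also have "\<dots> \<le> C * r / g * 1" using C r0 g by (intro mult_left_mono) auto
    also have "\<dots> = C / (s - \<sigma>)" using r0 by (simp add: g_def)
    finally show ?thesis by (simp add: F.primitive_def)
  qed
  ultimately have "cmod (f1 y) \<le> C * r * exp (- ((s - \<sigma>) * r * t)) + C / (s - \<sigma>)"
    unfolding split by (rule norm_triangle_le[OF add_mono])
  moreover have "cmod (\<phi> d y) = M * cmod (f1 y)" using M(1) by (simp add: f1_def norm_divide)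
  ultimately show ?thesis using M(1) by (simp add: r_def)
qed

end

text \<open>\<open>c = x * (1 - \<i> * sgn b)\<close> is the root of \<open>b c^2 = - \<i>\<close>
  in the right half-plane: its square is \<open>- 2 \<i> * sgn b * x^2\<close>, so
  \<open>x^2 = 1 / (2 \<bar>b\<bar>)\<close>.\<close>

lemma critical_layer_constant:
  fixes b :: real
  assumes "b \<noteq> 0"
  obtains c where "0 < Re c" "0 < Re (1 / c)" "of_real b * c\<^sup>2 = - \<i>" "Im (of_real b * c) = - sqrt (\<bar>b\<bar> / 2)"
proof (rule that)
  define x where "x = 1 / sqrt (2 * \<bar>b\<bar>)"
  have x: "0 < x" using assms by (simp add: x_def)
  have x2: "x\<^sup>2 = 1 / (2 * \<bar>b\<bar>)" using assms by (simp add: x_def power_divide)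
  show "0 < Re (Complex x (- sgn b * x))" using x by simp
  show "0 < Re (1 / Complex x (- sgn b * x))" using x by (simp add: Re_divide) (auto intro!: divide_pos_pos add_pos_nonneg)
  show "of_real b * (Complex x (- sgn b * x))\<^sup>2 = - \<i>"
    using assms x2 by (auto simp: complex_eq_iff power2_eq_square sgn_if field_simps)
  show "Im (of_real b * Complex x (- sgn b * x)) = - sqrt (\<bar>b\<bar> / 2)"
  proof -
    have "sqrt (\<bar>b\<bar> / 2) = \<bar>b\<bar> * x"
    proof (rule real_sqrt_unique)
      show "(\<bar>b\<bar> * x)\<^sup>2 = \<bar>b\<bar> / 2" 
      proof -
        have "\<beta>\<^sup>2 * (1 / (2 * \<beta>)) = \<beta> / 2" if "\<beta> \<noteq> 0" for \<beta> :: real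
          using that by (simp add: power2_eq_square)
        then show ?thesis unfolding power_mult_distrib x2 using assms by (simp only: abs_eq_0 not_False_eq_True)
      qed
    qed (use x in auto)
    then show ?thesis by (simp add: abs_sgn[of b])
  qed
qed

theorem theorem1p4:
  fixes \<alpha> :: real and Us :: "real \<Rightarrow> real" and a :: real
    and T :: "nat \<Rightarrow> real \<Rightarrow> (real \<Rightarrow> complex) \<Rightarrow> (real \<Rightarrow> complex)"
  assumes "\<alpha> > 0"
    and "W4alpha \<alpha> Us"
    and "a > 0" and "deriv Us a = 0" and "deriv (deriv Us) a \<noteq> 0"
    and "prandtl_semigroup \<alpha> Us T"
  shows "\<exists>\<sigma>0>0. \<forall>\<sigma>\<in>{0..<\<sigma>0}. \<exists>C>0. \<forall>k::nat. k \<ge> 1 \<longrightarrow>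
           (SUP t\<in>{0 .. (1 / (2 * (\<sigma>0 - \<sigma>))) * (ln (real k) / sqrt (real k))}.
               ereal (exp (- \<sigma> * t * sqrt (real k))) * opnorm \<alpha> (T k t))
             > ereal (C * sqrt (real k))"
proof -
  obtain U U1 U2 U3 A where U: "\<And>y. 0 \<le> y \<Longrightarrow> U y = Us y"
    and der: "\<And>y. 0 \<le> y \<Longrightarrow> (U has_real_derivative U1 y) (at y within {0..})"
    "\<And>y. 0 \<le> y \<Longrightarrow> (U1 has_real_derivative U2 y) (at y within {0..})"
    "\<And>y. 0 \<le> y \<Longrightarrow> (U2 has_real_derivative U3 y) (at y within {0..})"
    and U3: "continuous_on {0..} U3"
    and bounds: "\<And>y. 0 \<le> y \<Longrightarrow> \<bar>U y\<bar> \<le> A"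
    "\<And>y. 0 \<le> y \<Longrightarrow> \<bar>U1 y\<bar> \<le> A * exp (- (\<alpha> * y))"
    "\<And>y. 0 \<le> y \<Longrightarrow> \<bar>U2 y\<bar> \<le> A * exp (- (\<alpha> * y))"
    "\<And>y. 0 \<le> y \<Longrightarrow> \<bar>U3 y\<bar> \<le> A * exp (- (\<alpha> * y))"
    using W4alpha_profile[OF assms(1,2)] by blast
  \<comment> \<open>\<open>deriv\<close> is two-sided whereas the derivatives of \<open>U\<close>
    are one-sided at the wall; the two agree on the open half-line, which contains
    \<open>a\<close>.\<close>
  have dUs: "deriv Us y = U1 y" if "0 < y" for y
  proof -
    have "(U has_real_derivative U1 y) (at y)" using der(1)[of y] that by (simp add: at_within_halfline)
    then have "(Us has_real_derivative U1 y) (at y)"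
      by (rule has_field_derivative_transform_within_open[of _ _ _ "{0<..}"]) (use that U in auto)
    then show ?thesis by (rule DERIV_imp_deriv)
  qed
  have ddUs: "deriv (deriv Us) a = U2 a"
  proof -
    have "(U1 has_real_derivative U2 a) (at a)" using der(2)[of a] \<open>a > 0\<close> by (simp add: at_within_halfline)
    then have "(deriv Us has_real_derivative U2 a) (at a)"
      by (rule has_field_derivative_transform_within_open[of _ _ _ "{0<..}"]) (use \<open>a > 0\<close> dUs in auto)
    then show ?thesis by (rule DERIV_imp_deriv)
  qed
  define b where "b = U2 a / 2"
  have b: "b \<noteq> 0" using assms(5) ddUs by (simp add: b_def)
  obtain c where c: "0 < Re c" "0 < Re (1 / c)" "of_real b * c\<^sup>2 = - \<i>" "Im (of_real b * c) = - sqrt (\<bar>b\<bar> / 2)"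
    using critical_layer_constant[OF b] by metis
  interpret critical_profile c \<alpha> a b A U U1 U2 U3
    by unfold_locales (use c der U3 bounds assms dUs[of a] in \<open>auto simp: b_def\<close>)
  define s where "s = sqrt (\<bar>b\<bar> / 2)"
  have s: "0 < s" "s = - Im \<tau>" using b c by (auto simp: s_def \<tau>_def)
  obtain M where M: "0 < M" "\<And>d y. 0 < d \<Longrightarrow> d \<le> 1 \<Longrightarrow> 0 \<le> y \<Longrightarrow> cmod (\<phi> d y) \<le> M * exp (- (\<alpha> * y))"
    "\<And>d y. 0 < d \<Longrightarrow> d \<le> 1 \<Longrightarrow> 0 \<le> y \<Longrightarrow> cmod (residual d y) \<le> M * exp (- (\<alpha> * y))"
    using quasimode_bounds by metis
  obtain y1 m d0 where m: "0 \<le> y1" "0 < m" "0 < d0" "d0 \<le> 1" "\<And>d. 0 < d \<Longrightarrow> d \<le> d0 \<Longrightarrow> m \<le> cmod (\<phi> d y1)"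
    using quasimode_lower_bound by metis
  show ?thesis
  proof (rule exI[of _ s], intro conjI ballI \<open>0 < s\<close>)
    fix \<sigma> assume \<sigma>: "\<sigma> \<in> {0..<s}"
    define g where "g = s - \<sigma>"
    have g: "0 < g" using \<sigma> by (simp add: g_def)
    \<comment> \<open>The first entry contradicts the bound at time 0 when
      \<open>d0 \<le> d\<close>, that is for small \<open>k\<close>; the second makes the Duhamel
      bound for the profile at most \<open>m / 2\<close>.\<close>
    define C where "C = min (d0\<^sup>2 / 2) (m / (2 * (M * (1 + 1 / g))))"
    have C_le: "C \<le> d0\<^sup>2 / 2" unfolding C_def by (rule min.cobounded1)
    have C: "0 < C" using m M g by (auto simp: C_def intro!: divide_pos_pos mult_pos_pos add_pos_pos)
    show "\<exists>C>0. \<forall>k::nat. k \<ge> 1 \<longrightarrow>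
           (SUP t\<in>{0 .. (1 / (2 * (s - \<sigma>))) * (ln (real k) / sqrt (real k))}.
               ereal (exp (- \<sigma> * t * sqrt (real k))) * opnorm \<alpha> (T k t))
             > ereal (C * sqrt (real k))"
    proof (rule exI[of _ C], intro conjI allI impI C)
      fix k :: nat assume k: "k \<ge> 1"
      define t where "t = (1 / (2 * (s - \<sigma>))) * (ln (real k) / sqrt (real k))"
      \<comment> \<open>The layer width \<open>k^(-1/4)\<close>.\<close>
      define d where "d = 1 / sqrt (sqrt (real k))"
      have d: "0 < d" "d \<le> 1" using k by (auto simp: d_def)
      have d2: "d\<^sup>2 = 1 / sqrt (real k)" by (simp add: d_def power_divide)
      have d4: "real k * d ^ 4 = 1"
      proof -
        have "d ^ 4 = (d\<^sup>2)\<^sup>2" by simp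
        also have "\<dots> = 1 / real k" unfolding d2 by (simp add: power_divide)
        finally show ?thesis using k by simp
      qed
      have t0: "0 \<le> t" using k g by (simp add: t_def g_def)
      let ?F = "\<lambda>t. ereal (exp (- \<sigma> * t * sqrt (real k))) * opnorm \<alpha> (T k t)"
      show "(SUP t\<in>{0 .. (1 / (2 * (s - \<sigma>))) * (ln (real k) / sqrt (real k))}. ?F t) > ereal (C * sqrt (real k))"
      proof (rule ccontr)
        assume "\<not> ?thesis"
        then have op: "?F t' \<le> ereal (C * sqrt (real k))" if "0 \<le> t'" "t' \<le> t" for t'
          using that by (intro order_trans[OF SUP_upper[of t' "{0..t}" ?F]]) (auto simp: t_def not_less)
        show False
        \<comment> \<open>For \<open>k = 1\<close> the time interval shrinks to the single point 0,
          while Duhamel's formula needs a positive time. This case joins the small frequencies,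
          since then \<open>d = 1\<close> and \<open>d0 \<le> 1\<close>.\<close>
        proof (cases "d \<le> d0 \<and> k \<noteq> 1")
          case False
          then have "d0 \<le> d" using m by (auto simp: d_def)
          have "1 \<le> opnorm \<alpha> (T k 0)"
            by (rule opnorm_id_ge_1) (use assms(6) in \<open>auto simp: prandtl_semigroup_def\<close>)
          also have "opnorm \<alpha> (T k 0) \<le> ereal (C * sqrt (real k))" using op[of 0] t0 by (simp flip: one_ereal_def)
          finally have "1 \<le> C * sqrt (real k)" by (simp add: one_ereal_def)
          also have "\<dots> \<le> d0\<^sup>2 / 2 * sqrt (real k)" by (intro mult_right_mono C_le) auto
          also have "\<dots> \<le> d\<^sup>2 / 2 * sqrt (real k)"
            using \<open>d0 \<le> d\<close> m by (intro mult_right_mono divide_right_mono power_mono) auto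
          also have "\<dots> = 1 / 2" using k by (simp add: d2)
          finally show False by simp
        next
          case True
          with k have k2: "1 < real k" by simp
          have "0 < t" using k2 g by (simp add: t_def g_def)
          have "m \<le> cmod (\<phi> d y1)" by (rule m(5)) (use True d in auto)
          also have "\<dots> \<le> M * (C * sqrt (real k) * exp (- ((s - \<sigma>) * sqrt (real k) * t)) + C / (s - \<sigma>))"
            by (rule semigroup_lower_bound[OF assms(6)])
               (use U dUs d d4 M m(1) C s \<sigma> \<open>0 < t\<close> op in auto)
          \<comment> \<open>The length of the time interval was chosen for this value: the
            exponential becomes \<open>1 / sqrt k\<close> and cancels the factor
            \<open>sqrt k\<close>.\<close>
          also have "(s - \<sigma>) * sqrt (real k) * t = ln (sqrt (real k))"
          proof -
            have "t = 1 / (2 * g) * (ln (real k) / sqrt (real k))" by (simp add: t_def g_def)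
            then have "g * sqrt (real k) * t = ln (real k) / 2" using g k2 by simp
            then show ?thesis using k2 by (simp add: g_def ln_sqrt)
          qed
          also have "exp (- ln (sqrt (real k))) = 1 / sqrt (real k)" using k2 by (simp add: exp_minus inverse_eq_divide)
          also have "M * (C * sqrt (real k) * (1 / sqrt (real k)) + C / (s - \<sigma>)) = C * (M * (1 + 1 / g))"
            using k2 by (simp add: g_def field_simps)
          also have "\<dots> \<le> m / (2 * (M * (1 + 1 / g))) * (M * (1 + 1 / g))"
            using M g by (intro mult_right_mono) (auto simp: C_def)
          also have "\<dots> = m / 2"
          proof -
            have "m / (2 * x) * x = m / 2" if "0 < x" for x using that by simp
            moreover have "0 < M * (1 + 1 / g)" using M g by (intro mult_pos_pos add_pos_pos) auto
            ultimately show ?thesis by blast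
          qed
          finally show False using m(2) by simp
        qed
      qed
    qed
  qed
qed

end
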